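(* There exist universal constants $\Lambda\ge\lambda>0$ such that the following holds. Let $K\subset B_1$ be any nonempty compact set that is nowhere dense in $\mathbb R^5$, where $B_1\subset\mathbb R^5$ is the open unit ball centered at the origin. Then there exist a countable set $A\subset B_1\setminus K$, a function $u\in C^{1,1}(B_1)$, and an operator $F:\operatorname{Sym}(5)\to\mathbb R$ that is uniformly elliptic with constants $\lambda,\Lambda$ (which are thus independent of $K$), such that $\operatorname{Sing}(u)=K\cup A$ and $F(D^2u)=0$ in $B_1$ in the viscosity sense. Moreover: (i) the set of accumulation points of $A$ in $\mathbb R^5$ is exactly $K$, and every point of $A$ is isolated in $\operatorname{Sing}(u)$; (ii) $u$ is smooth ($C^\infty$) in $B_1\setminus\operatorname{Sing}(u)$ and is not twice differentiable at any point of $A$; at every $x\in K$, $u$ is twice differentiable with $D^2u(x)=D^2P(x)$, and $$u(x+h)=P(x)+DP(x)\cdot h+\tfrac12 h^TD^2P(x)h+O(|h|^3)\quad\text{as }h\to0,$$ where the constant in $O(|h|^3)$ is independent of $x\in K$ (that is, there are $C,r>0$ such that for all $x\in K$ and all $|h|<r$ the remainder is at most $C|h|^3$ in absolute value). Here $P$ is the five-dimensional Cartan isoparametric cubic form defined in the context.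
   Context: $\operatorname{Sym}(n)$ is the space of real symmetric $n\times n$ matrices. An operator $F:\operatorname{Sym}(n)\to\mathbb R$ is uniformly elliptic with constants $\Lambda\ge\lambda>0$ if $\lambda\operatorname{tr}N\le F(M+N)-F(M)\le\Lambda\operatorname{tr}N$ for every $M\in\operatorname{Sym}(n)$ and every $N\ge0$. A continuous $u$ satisfies $F(D^2u)=0$ in $B_1$ in the viscosity sense if, whenever $\phi$ is $C^2$ near $x_0\in B_1$ and touches $u$ from above (resp. below) at $x_0$, i.e. $\phi(x_0)=u(x_0)$ and $\phi\ge u$ (resp. $\phi\le u$) near $x_0$, then $F(D^2\phi(x_0))\ge0$ (resp. $\le0$). $\operatorname{Sing}(u)$ is the set of $x\in B_1$ for which there is no neighborhood $U\subset B_1$ of $x$ with $u\in C^2(U)$. $C^{1,1}(B_1)$ means that $u$ is $C^1$ with Lipschitz gradient on $B_1$. Twice differentiable at $x$ means that $Du$ exists near $x$ and is differentiable at $x$. Writing $x=(x_1,x_2,z_1,z_2,z_3)\in\mathbb R^5$, the Cartan cubic is $$P(x)=x_1^3+\frac{3x_1}{2}\bigl(z_1^2+z_2^2-2z_3^2-2x_2^2\bigr)+\frac{3\sqrt3}{2}\bigl(x_2z_1^2-x_2z_2^2+2z_1z_2z_3\bigr).$$ *)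

theory Defs
  imports "HOL-Analysis.Analysis"
begin

section \<open>Gradient, Hessian, and regularity classes\<close>

text \<open>The two operators below are total; their values are meaningful only at points where
  the function (respectively its gradient) is differentiable.\<close>

definition grad :: "(real^'n \<Rightarrow> real) \<Rightarrow> real^'n \<Rightarrow> real^'n" where
  "grad f x = (\<chi> i. frechet_derivative f (at x) (axis i 1))"

definition hessian :: "(real^'n \<Rightarrow> real) \<Rightarrow> real^'n \<Rightarrow> real^'n^'n" where
  "hessian f x = matrix (frechet_derivative (grad f) (at x))"

definition twice_differentiable_at :: "(real^'n \<Rightarrow> real) \<Rightarrow> real^'n \<Rightarrow> bool" where
  "twice_differentiable_at f x \<longleftrightarrow>
     (\<forall>\<^sub>F y in nhds x. f differentiable (at y)) \<and> grad f differentiable (at x)"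

text \<open>The class $C^k(U)$ for open \<open>U\<close>: all partial derivatives up to order \<open>k\<close> exist and are
  continuous. Openness of \<open>U\<close> is not part of the definition and must be ensured at each use.\<close>

fun Ck_on :: "nat \<Rightarrow> (real^'n) set \<Rightarrow> (real^'n \<Rightarrow> real) \<Rightarrow> bool" where
  "Ck_on 0 U f \<longleftrightarrow> continuous_on U f"
| "Ck_on (Suc k) U f \<longleftrightarrow>
     (\<forall>x\<in>U. f differentiable (at x)) \<and> (\<forall>i. Ck_on k U (\<lambda>x. grad f x $ i))"

definition smooth_on :: "(real^'n) set \<Rightarrow> (real^'n \<Rightarrow> real) \<Rightarrow> bool" where
  "smooth_on U f \<longleftrightarrow> (\<forall>k. Ck_on k U f)"

definition C11_on :: "(real^'n) set \<Rightarrow> (real^'n \<Rightarrow> real) \<Rightarrow> bool" where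
  "C11_on U f \<longleftrightarrow> Ck_on 1 U f \<and> (\<exists>L. L-lipschitz_on U (grad f))"

definition Sing :: "(real^'n \<Rightarrow> real) \<Rightarrow> (real^'n) set" where
  "Sing u = {x \<in> ball 0 1. \<not> (\<exists>U. open U \<and> x \<in> U \<and> U \<subseteq> ball 0 1 \<and> Ck_on 2 U u)}"

section \<open>Elliptic operators and viscosity solutions\<close>

definition Sym :: "(real^'n^'n) set" where
  "Sym = {M. transpose M = M}"

definition psd :: "real^'n^'n \<Rightarrow> bool" where
  "psd N \<longleftrightarrow> N \<in> Sym \<and> (\<forall>v. 0 \<le> v \<bullet> (N *v v))"

text \<open>An operator on \<open>Sym\<close> is represented by a function on all matrices; only its values
  on \<open>Sym\<close> are ever used, here and in \<open>viscosity_solution\<close>.\<close>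

definition uniformly_elliptic :: "real \<Rightarrow> real \<Rightarrow> (real^'n^'n \<Rightarrow> real) \<Rightarrow> bool" where
  "uniformly_elliptic lam Lam F \<longleftrightarrow>
     0 < lam \<and> lam \<le> Lam \<and>
     (\<forall>M\<in>Sym. \<forall>N. psd N \<longrightarrow>
        lam * trace N \<le> F (M + N) - F M \<and> F (M + N) - F M \<le> Lam * trace N)"

definition C2_near :: "(real^'n \<Rightarrow> real) \<Rightarrow> real^'n \<Rightarrow> bool" where
  "C2_near \<phi> x \<longleftrightarrow> (\<exists>U. open U \<and> x \<in> U \<and> Ck_on 2 U \<phi>)"

definition touches_above :: "(real^'n \<Rightarrow> real) \<Rightarrow> (real^'n \<Rightarrow> real) \<Rightarrow> real^'n \<Rightarrow> bool" where
  "touches_above \<phi> u x \<longleftrightarrow> \<phi> x = u x \<and> (\<forall>\<^sub>F y in nhds x. u y \<le> \<phi> y)"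

definition touches_below :: "(real^'n \<Rightarrow> real) \<Rightarrow> (real^'n \<Rightarrow> real) \<Rightarrow> real^'n \<Rightarrow> bool" where
  "touches_below \<phi> u x \<longleftrightarrow> \<phi> x = u x \<and> (\<forall>\<^sub>F y in nhds x. \<phi> y \<le> u y)"

text \<open>\<open>F (D\<^sup>2 u) = 0\<close> in the open unit ball, in the viscosity sense.\<close>

definition viscosity_solution :: "(real^'n^'n \<Rightarrow> real) \<Rightarrow> (real^'n \<Rightarrow> real) \<Rightarrow> bool" where
  "viscosity_solution F u \<longleftrightarrow>
     continuous_on (ball 0 1) u \<and>
     (\<forall>x0\<in>ball 0 1. \<forall>\<phi>. C2_near \<phi> x0 \<longrightarrow>
        (touches_above \<phi> u x0 \<longrightarrow> 0 \<le> F (hessian \<phi> x0)) \<and>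
        (touches_below \<phi> u x0 \<longrightarrow> F (hessian \<phi> x0) \<le> 0))"

section \<open>The Cartan cubic\<close>

text \<open>The coordinates \<open>(x\<^sub>1, x\<^sub>2, z\<^sub>1, z\<^sub>2, z\<^sub>3)\<close> are \<open>(x$1, x$2, x$3, x$4, x$5)\<close>. In the index
  type \<open>5\<close> arithmetic is modulo 5, so the last index is the same element as \<open>0\<close>.\<close>

definition cartan_cubic :: "real^5 \<Rightarrow> real" where
  "cartan_cubic x =
     (x$1)^3
     + 3 * x$1 / 2 * ((x$3)^2 + (x$4)^2 - 2 * (x$5)^2 - 2 * (x$2)^2)
     + 3 * sqrt 3 / 2 * (x$2 * (x$3)^2 - x$2 * (x$4)^2 + 2 * x$3 * x$4 * x$5)"

end

theory Submission
  imports Defs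
begin

text \<open>
  Let \<open>P\<close> be the Cartan cubic. The solution is \<open>P\<close> plus tiny copies, with disjoint supports,
  of a cut-off of the degree-two singularity \<open>P(x)/|x|\<close>, one in a ball of radius \<open>\<rho>\<close> around each
  point \<open>a\<close> of a discrete set \<open>A\<close> accumulating exactly at \<open>K\<close>. Since \<open>P\<close> is a cubic, near \<open>a\<close> the
  solution is a quadratic polynomial plus \<open>P(h) + (\<rho>/M) P(h)/|h|\<close>, where \<open>h = x - a\<close>. The copies are
  \<open>O(\<rho>\<^sup>3)\<close> and the balls are at distance at least \<open>\<rho>\<close> from \<open>K\<close>, so that \<open>P\<close> is the third-order
  expansion at \<open>K\<close>.

  An elliptic operator vanishing on all the Hessians exists once any two of them, with difference
  \<open>D\<close>, satisfy \<open>tr D + \<kappa> \<lambda>_max(D) \<ge> 0\<close>: take \<open>F(M) = inf_B (tr (M - B) + \<kappa> \<lambda>_max(M - B))\<close>.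
  For two points not close to the same centre, \<open>D\<close> is a small relative perturbation of
  \<open>D\<^sup>2P(x - y)\<close>, which is traceless and not small. Otherwise, after rescaling, \<open>D\<close> is a difference of
  Hessians of \<open>P + P/|x|\<close>, whose trace is \<open>-8p\<close> with \<open>p = P(x)/|x|\<^sup>3\<close>. By Weyl's inequality
  \<open>\<lambda>_max(D)\<close> dominates the difference of the middle eigenvalues, and also that of the lowest
  ones; one of these always exceeds a multiple of the difference of the values of \<open>p\<close>.
\<close>

section \<open>Calculus of the gradient and of the classes $C^k$\<close>

text \<open>A copy of amplitude \<open>\<rho>^3 / M\<close> has a Hessian of size
  \<open>\<rho> / M\<close>. Zooming at \<open>a\<close> by \<open>M / \<rho>\<close> therefore
  gives both terms of \<open>P + P/|x|\<close> the same weight, up to a common factor and the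
  constant matrix D^2P(a). The two Hessians are homogeneous of different degrees, 1 and 0, so no
  further scaling removes the moduli of the two points: the eigenvalue gap has to hold uniformly
  over two independent radii.

  The gap obtained is \<open>1/50\<close>, and \<open>\<kappa> = 400 = 8 * 50\<close> makes it
  cancel the trace. The only smallness condition is that \<open>M\<close> dominate the Lipschitz
  constant of the Hessian of the cut-off model away from its centre. That constant does not see
  \<open>K\<close>, and the ellipticity constants come out as 1 and
  \<open>1 + 5 * 400 = 2001\<close>.

  At a centre no Hessian exists, and D^2P(a) takes its place in the family on which the operator
  vanishes. This is the right value because the copy is odd about \<open>a\<close>: it cancels from
  second differences, which is all that a touching test function is asked about.\<close>

lemma grad_has_derivative:
  fixes f :: "real^'n \<Rightarrow> real"
  assumes "f differentiable (at x)"
  shows "(f has_derivative (\<lambda>h. grad f x \<bullet> h)) (at x)"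
proof -
  let ?D = "frechet_derivative f (at x)"
  have D: "(f has_derivative ?D) (at x)" using assms frechet_derivative_works by blast
  have lin: "linear ?D" using D has_derivative_linear by blast
  have "?D h = grad f x \<bullet> h" for h
  proof -
    have "?D h = ?D (\<Sum>i\<in>UNIV. (h$i) *\<^sub>R axis i 1)"
      using basis_expansion[of h] by (simp add: scalar_mult_eq_scaleR)
    also have "\<dots> = (\<Sum>i\<in>UNIV. (h$i) * ?D (axis i 1))"
      by (simp add: linear_sum[OF lin] linear_scale[OF lin])
    finally show ?thesis by (simp add: grad_def inner_vec_def mult.commute)
  qed
  then have "?D = (\<lambda>h. grad f x \<bullet> h)" by (rule ext)
  then show ?thesis using D by metis
qed

lemma grad_eqI:
  fixes f :: "real^'n \<Rightarrow> real"
  assumes "(f has_derivative (\<lambda>h. g \<bullet> h)) (at x)"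
  shows "grad f x = g"
  using frechet_derivative_at[OF assms] by (simp add: grad_def vec_eq_iff inner_axis flip: frechet_derivative_at[OF assms])

lemma grad_cong:
  fixes f g :: "real^'n \<Rightarrow> real"
  assumes "open U" "x \<in> U" "\<And>y. y \<in> U \<Longrightarrow> f y = g y"
  shows "grad f x = grad g x" and "f differentiable (at x) \<longleftrightarrow> g differentiable (at x)"
proof -
  have *: "(f has_derivative D) (at x) \<longleftrightarrow> (g has_derivative D) (at x)" for D
    using has_derivative_transform_within_open[OF _ assms(1,2)] assms(3) by metis
  then show "f differentiable (at x) \<longleftrightarrow> g differentiable (at x)" by (simp add: differentiable_def)
  show "grad f x = grad g x" by (simp add: grad_def frechet_derivative_def *)
qed

lemma Ck_on_cong:
  fixes f g :: "real^'n \<Rightarrow> real"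
  assumes "open U" "\<And>y. y \<in> U \<Longrightarrow> f y = g y"
  shows "Ck_on k U f \<longleftrightarrow> Ck_on k U g"
  using assms(2)
proof (induction k arbitrary: f g)
  case 0 then show ?case by (simp cong: continuous_on_cong)
next
  case (Suc k)
  have "Ck_on k U (\<lambda>x. grad f x $ i) \<longleftrightarrow> Ck_on k U (\<lambda>x. grad g x $ i)" for i
    by (rule Suc.IH) (simp add: grad_cong(1)[OF assms(1) _ Suc.prems])
  then show ?case using grad_cong(2)[OF assms(1) _ Suc.prems] by auto
qed

lemma Ck_on_subset: "Ck_on k U f \<Longrightarrow> V \<subseteq> U \<Longrightarrow> Ck_on k V f"
  by (induction k arbitrary: f) (auto intro: continuous_on_subset)

lemma Ck_on_Suc_D: "Ck_on (Suc k) U f \<Longrightarrow> Ck_on k U f"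
proof (induction k arbitrary: f)
  case 0 then show ?case
    by (auto intro!: continuous_at_imp_continuous_on differentiable_imp_continuous_within)
next
  case (Suc k) then show ?case by (metis Ck_on.simps(2))
qed

lemma Ck_on_local:
  assumes "\<And>x. x \<in> U \<Longrightarrow> \<exists>V. open V \<and> x \<in> V \<and> Ck_on k V f"
  shows "Ck_on k U f"
  using assms
proof (induction k arbitrary: f)
  case 0
  then show ?case
    by (auto intro!: continuous_at_imp_continuous_on simp: continuous_on_eq_continuous_at)
      (metis continuous_on_eq_continuous_at)
next
  case (Suc k)
  then show ?case by (metis Ck_on.simps(2))
qed

lemma Ck_on_const: "Ck_on k U (\<lambda>x. c)"
proof (induction k arbitrary: c)
  case (Suc k)
  have "grad (\<lambda>x::real^'a. c) x = 0" for x by (rule grad_eqI) simp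
  then show ?case using Suc by simp
qed simp

lemma Ck_on_nth: "Ck_on k U (\<lambda>x. x $ i)"
proof (cases k)
  case (Suc j)
  have *: "((\<lambda>x. x $ i) has_derivative (\<lambda>h. axis i 1 \<bullet> h)) (at x)" for x :: "real^'a"
    using bounded_linear_imp_has_derivative[OF bounded_linear_vec_nth, of i "at x"]
    by (simp add: inner_axis')
  have "(\<lambda>x::real^'a. x $ i) differentiable (at x)" for x
    using * differentiable_def by blast
  then show ?thesis using Suc Ck_on_const[of j U] by (simp add: grad_eqI[OF *])
qed (simp add: continuous_intros)

lemma Ck_on_add:
  fixes f g :: "real^'n \<Rightarrow> real"
  assumes "open U" "Ck_on k U f" "Ck_on k U g"
  shows "Ck_on k U (\<lambda>x. f x + g x)"
  using assms(2,3)
proof (induction k arbitrary: f g)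
  case 0 then show ?case by (auto intro: continuous_intros)
next
  case (Suc k)
  have "grad (\<lambda>x. f x + g x) x = grad f x + grad g x" if "x \<in> U" for x
    by (rule grad_eqI) (use Suc.prems that in \<open>auto intro!: derivative_eq_intros grad_has_derivative simp: inner_add_left\<close>)
  then have "Ck_on k U (\<lambda>x. grad (\<lambda>x. f x + g x) x $ i)" for i
    using Suc by (subst Ck_on_cong[OF assms(1), where g = "\<lambda>x. grad f x $ i + grad g x $ i"]) auto
  then show ?case using Suc.prems by auto
qed

lemma Ck_on_mult:
  fixes f g :: "real^'n \<Rightarrow> real"
  assumes "open U" "Ck_on k U f" "Ck_on k U g"
  shows "Ck_on k U (\<lambda>x. f x * g x)"
  using assms(2,3)
proof (induction k arbitrary: f g)
  case 0 then show ?case by (auto intro: continuous_intros)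
next
  case (Suc k)
  have "grad (\<lambda>x. f x * g x) x = f x *\<^sub>R grad g x + g x *\<^sub>R grad f x" if "x \<in> U" for x
    by (rule grad_eqI) (use Suc.prems that in \<open>auto intro!: derivative_eq_intros grad_has_derivative simp: inner_add_left\<close>)
  moreover have "Ck_on k U (\<lambda>x. f x * grad g x $ i + g x * grad f x $ i)" for i
    using Suc.IH Suc.prems Ck_on_Suc_D[OF Suc.prems(1)] Ck_on_Suc_D[OF Suc.prems(2)]
    by (intro Ck_on_add assms(1)) auto
  ultimately have "Ck_on k U (\<lambda>x. grad (\<lambda>x. f x * g x) x $ i)" for i
    by (subst Ck_on_cong[OF assms(1), where g = "\<lambda>x. f x * grad g x $ i + g x * grad f x $ i"]) auto
  then show ?case using Suc.prems by auto
qed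

lemma Ck_on_power: "open U \<Longrightarrow> Ck_on k U f \<Longrightarrow> Ck_on k U (\<lambda>x. f x ^ n)"
  by (induction n) (auto intro: Ck_on_mult Ck_on_const)

lemma Ck_on_diff:
  assumes "open U" "Ck_on k U f" "Ck_on k U g"
  shows "Ck_on k U (\<lambda>x. f x - g x)"
  using Ck_on_add[OF assms(1,2) Ck_on_mult[OF assms(1) Ck_on_const[of k U "-1"] assms(3)]] by simp

lemma Ck_on_sum:
  assumes "open U" "\<And>i. i \<in> I \<Longrightarrow> Ck_on k U (f i)"
  shows "Ck_on k U (\<lambda>x. \<Sum>i\<in>I. f i x)"
  using assms(2)
  by (induction I rule: infinite_finite_induct) (auto intro: Ck_on_const Ck_on_add[OF assms(1)])

lemma Ck_on_affine:
  fixes f :: "real^'n \<Rightarrow> real"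
  assumes "open V" "\<And>x. x \<in> V \<Longrightarrow> c *\<^sub>R (x - a) \<in> U" "Ck_on k U f"
  shows "Ck_on k V (\<lambda>x. f (c *\<^sub>R (x - a)))"
  using assms(3)
proof (induction k arbitrary: f)
  case 0
  then show ?case
    using assms(2) by (auto intro!: continuous_on_compose2[of U f] continuous_intros)
next
  case (Suc k)
  have D: "((\<lambda>x. f (c *\<^sub>R (x - a))) has_derivative (\<lambda>h. (c *\<^sub>R grad f (c *\<^sub>R (x - a))) \<bullet> h)) (at x)"
    if "x \<in> V" for x
  proof -
    have "(f has_derivative (\<lambda>h. grad f (c *\<^sub>R (x - a)) \<bullet> h)) (at (c *\<^sub>R (x - a)))"
      using Suc.prems assms(2)[OF that] grad_has_derivative by auto
    moreover have "((\<lambda>x. c *\<^sub>R (x - a)) has_derivative (\<lambda>h. c *\<^sub>R h)) (at x)"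
      by (auto intro!: derivative_eq_intros)
    ultimately show ?thesis using diff_chain_at by (fastforce simp: o_def)
  qed
  moreover have "Ck_on k V (\<lambda>x. c * grad f (c *\<^sub>R (x - a)) $ i)" for i
    using Suc by (intro Ck_on_mult[OF assms(1) Ck_on_const] Suc.IH) auto
  then have "Ck_on k V (\<lambda>x. grad (\<lambda>x. f (c *\<^sub>R (x - a))) x $ i)" for i
    by (subst Ck_on_cong[OF assms(1), where g = "\<lambda>x. c * grad f (c *\<^sub>R (x - a)) $ i"])
      (auto simp: grad_eqI[OF D])
  ultimately show ?case by (auto simp: differentiable_def)
qed

section \<open>Composition with smooth functions of one real variable\<close>

fun Ck_real_on :: "nat \<Rightarrow> real set \<Rightarrow> (real \<Rightarrow> real) \<Rightarrow> bool" where
  "Ck_real_on 0 I h \<longleftrightarrow> continuous_on I h"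
| "Ck_real_on (Suc k) I h \<longleftrightarrow>
     (\<exists>h'. (\<forall>t\<in>I. (h has_real_derivative h' t) (at t)) \<and> Ck_real_on k I h')"

lemma Ck_on_compose:
  fixes f :: "real^'n \<Rightarrow> real"
  assumes "open U" "Ck_real_on k I h" "Ck_on k U f" "f ` U \<subseteq> I"
  shows "Ck_on k U (\<lambda>x. h (f x))"
  using assms(2,3)
proof (induction k arbitrary: h)
  case 0
  then show ?case using assms(4) by (auto intro!: continuous_on_compose2[of I h U f])
next
  case (Suc k)
  from Suc.prems(1) obtain h'
    where h': "\<forall>t\<in>I. (h has_real_derivative h' t) (at t)" "Ck_real_on k I h'"
    by (subst (asm) Ck_real_on.simps(2)) (elim exE conjE)
  have D: "((\<lambda>x. h (f x)) has_derivative (\<lambda>v. (h' (f x) *\<^sub>R grad f x) \<bullet> v)) (at x)" if "x \<in> U" for x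
  proof -
    have "(f has_derivative (\<lambda>h. grad f x \<bullet> h)) (at x)" using Suc.prems that grad_has_derivative by auto
    moreover have "(h has_derivative (*) (h' (f x))) (at (f x))"
      using h'(1) that assms(4) by (auto simp: has_field_derivative_def)
    ultimately show ?thesis using diff_chain_at[of f _ x h "(*) (h' (f x))"] by (simp add: o_def)
  qed
  moreover have "Ck_on k U (\<lambda>x. h' (f x) * grad f x $ i)" for i
    using Suc.prems(2)
    by (intro Ck_on_mult[OF assms(1) Suc.IH[OF h'(2) Ck_on_Suc_D[OF Suc.prems(2)]]]) simp
  then have "Ck_on k U (\<lambda>x. grad (\<lambda>x. h (f x)) x $ i)" for i
    by (subst Ck_on_cong[OF assms(1), where g = "\<lambda>x. h' (f x) * grad f x $ i"]) (auto simp: grad_eqI[OF D])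
  ultimately show ?case by (auto simp: differentiable_def)
qed

text \<open>The constant factor is carried along so that the family is closed under
  differentiation.\<close>

lemma Ck_real_on_powr: "Ck_real_on k {0<..} (\<lambda>t. c * t powr s)"
proof (induction k arbitrary: c s)
  case 0 then show ?case by (auto intro!: continuous_intros)
next
  case (Suc k)
  have "((\<lambda>t. c * t powr s) has_real_derivative (c * s) * t powr (s - 1)) (at t)" if "0 < t" for t
    using that by (auto intro!: derivative_eq_intros)
  then show ?case
    by (subst Ck_real_on.simps(2)) (intro exI[of _ "\<lambda>t. (c * s) * t powr (s - 1)"], simp add: Suc[of "c * s" "s - 1"])
qed

text \<open>The family \<open>t^-n exp(-1/t)\<close> spans a space closed under differentiation.\<close>

definition flat_bump :: "nat \<Rightarrow> real \<Rightarrow> real" where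
  "flat_bump n t = (if 0 < t then inverse t ^ n * exp (- inverse t) else 0)"

lemma flat_bump_tendsto: "(flat_bump n \<longlongrightarrow> 0) (at 0)"
proof -
  have "((\<lambda>t. inverse t ^ n / exp (inverse t)) \<longlongrightarrow> (0::real)) (at_right 0)"
    by (rule filterlim_compose[OF tendsto_power_div_exp_0 filterlim_inverse_at_top_right])
  then have "(flat_bump n \<longlongrightarrow> 0) (at_right 0)"
    by (rule Lim_transform_eventually)
      (auto simp: flat_bump_def exp_minus divide_inverse eventually_at_right_field intro!: exI[of _ 1])
  moreover have "(flat_bump n \<longlongrightarrow> 0) (at_left 0)"
    by (rule tendsto_eventually) (auto simp: flat_bump_def eventually_at_left_field intro: exI[of _ "-1"])
  ultimately show ?thesis by (simp add: filterlim_split_at)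
qed

lemma flat_bump_deriv:
  "(flat_bump n has_real_derivative flat_bump (n + 2) t - n * flat_bump (n + 1) t) (at t)"
proof (cases t "0::real" rule: linorder_cases)
  case less
  have "(flat_bump n has_real_derivative 0) (at t)"
    by (rule has_field_derivative_transform_within_open[where f="\<lambda>_. 0" and S="{..<0}"])
      (use less in \<open>auto simp: flat_bump_def\<close>)
  then show ?thesis using less by (simp add: flat_bump_def)
next
  case equal
  \<comment> \<open>The difference quotient at 0 is \<open>flat_bump (Suc n)\<close> itself.\<close>
  have "((\<lambda>h. flat_bump n h / h) \<longlongrightarrow> 0) (at 0)"
    by (rule Lim_transform_eventually[OF flat_bump_tendsto[of "Suc n"]])
      (auto simp: flat_bump_def field_simps eventually_at_filter)
  then show ?thesis using equal by (simp add: DERIV_def flat_bump_def)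
next
  case greater
  have "((\<lambda>t. inverse t ^ n * exp (- inverse t)) has_real_derivative
     flat_bump (n + 2) t - n * flat_bump (n + 1) t) (at t)"
  proof -
    \<comment> \<open>The power rule leaves an exponent with truncated subtraction, hence the
      separate zero case.\<close>
    have "m = 0 \<or> inverse t * inverse t ^ (m - Suc 0) = inverse t ^ m" for m
      by (cases m) auto
    from this[of "n - 1"] have "n - 1 = 0 \<or> inverse t * inverse t ^ (n - 1 - Suc 0) = inverse t ^ (n - 1)" .
    then show ?thesis
      using greater
      by (cases n) (auto intro!: derivative_eq_intros simp: flat_bump_def algebra_simps power2_eq_square)
  qed
  then show ?thesis
    by (rule has_field_derivative_transform_within_open[where S="{0<..}"])
      (use greater in \<open>auto simp: flat_bump_def\<close>)
qed

lemma Ck_real_on_add: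
  "Ck_real_on k I f \<Longrightarrow> Ck_real_on k I g \<Longrightarrow> Ck_real_on k I (\<lambda>t. f t + g t)"
proof (induction k arbitrary: f g)
  case (Suc k)
  then obtain f' g' where "\<And>t. t \<in> I \<Longrightarrow> (f has_real_derivative f' t) (at t)" "Ck_real_on k I f'"
    "\<And>t. t \<in> I \<Longrightarrow> (g has_real_derivative g' t) (at t)" "Ck_real_on k I g'" unfolding Ck_real_on.simps by blast
  with Suc.IH show ?case unfolding Ck_real_on.simps
    by (intro exI[of _ "\<lambda>t. f' t + g' t"]) (blast intro: DERIV_add)
qed (auto intro: continuous_intros)

lemma Ck_real_on_cmult: "Ck_real_on k I f \<Longrightarrow> Ck_real_on k I (\<lambda>t. c * f t)" for c :: real
proof (induction k arbitrary: f)
  case (Suc k)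
  then obtain f' where "\<And>t. t \<in> I \<Longrightarrow> (f has_real_derivative f' t) (at t)" "Ck_real_on k I f'" unfolding Ck_real_on.simps by blast
  with Suc.IH show ?case unfolding Ck_real_on.simps
    by (intro exI[of _ "\<lambda>t. c * f' t"]) (blast intro: DERIV_cmult)
qed (auto intro: continuous_intros)

lemma Ck_real_on_flat_bump: "Ck_real_on k UNIV (flat_bump n)"
proof (induction k arbitrary: n)
  case 0
  show ?case
    by (auto intro!: continuous_at_imp_continuous_on DERIV_isCont[OF flat_bump_deriv])
next
  case (Suc k)
  have "Ck_real_on k UNIV (\<lambda>t. flat_bump (n + 2) t + (- real n) * flat_bump (n + 1) t)"
    by (intro Ck_real_on_add Ck_real_on_cmult Suc)
  then show ?case using flat_bump_deriv[of n]
    by (auto intro!: exI[of _ "\<lambda>t. flat_bump (n + 2) t - n * flat_bump (n + 1) t"])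
qed

section \<open>The Cartan cubic as a determinant\<close>

lemma exhaust_5:
  fixes x :: 5
  shows "x = 1 \<or> x = 2 \<or> x = 3 \<or> x = 4 \<or> x = 5"
proof (induct x)
  case (of_int z)
  then have "z = 0 \<or> z = 1 \<or> z = 2 \<or> z = 3 \<or> z = 4" by fastforce
  then show ?case by auto
qed

lemma forall_5: "(\<forall>i::5. P i) \<longleftrightarrow> P 1 \<and> P 2 \<and> P 3 \<and> P 4 \<and> P 5"
  by (metis exhaust_5)

lemma UNIV_5: "UNIV = {1, 2, 3, 4, 5::5}"
  using exhaust_5 by auto

lemma sum_5: "sum f (UNIV::5 set) = f 1 + f 2 + f 3 + f 4 + f 5"
  unfolding UNIV_5 by (simp add: ac_simps)

lemma inner_5: "x \<bullet> y = x$1 * y$1 + x$2 * y$2 + x$3 * y$3 + x$4 * y$4 + x$5 * y$5"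
  for x y :: "real^5"
  by (simp add: inner_vec_def sum_5)

lemma norm_5_sq: "(norm x)\<^sup>2 = (x$1)\<^sup>2 + (x$2)\<^sup>2 + (x$3)\<^sup>2 + (x$4)\<^sup>2 + (x$5)\<^sup>2"
  for x :: "real^5"
  using power2_norm_eq_inner[of x] by (simp only: inner_5 power2_eq_square)

definition vec5 :: "real \<Rightarrow> real \<Rightarrow> real \<Rightarrow> real \<Rightarrow> real \<Rightarrow> real^5" where
  "vec5 a b c d e = (\<chi> i. if i = 1 then a else if i = 2 then b else if i = 3 then c
     else if i = 4 then d else e)"

lemma vec5_nth [simp]:
  "vec5 a b c d e $ 1 = a" "vec5 a b c d e $ 2 = b" "vec5 a b c d e $ 3 = c"
  "vec5 a b c d e $ 4 = d" "vec5 a b c d e $ 5 = e"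
  by (simp_all add: vec5_def)

text \<open>The vector $D^2P(x)v$; it is bilinear because \<open>P\<close> is a cubic form.\<close>

definition cubic_hess :: "real^5 \<Rightarrow> real^5 \<Rightarrow> real^5" where
  "cubic_hess x v = vec5
    (6 * x$1 * v$1 + 3 * (x$3 * v$3 + x$4 * v$4 - 2 * x$5 * v$5 - 2 * x$2 * v$2))
    (- 6 * x$1 * v$2 - 6 * x$2 * v$1 + 3 * sqrt 3 * (x$3 * v$3 - x$4 * v$4))
    (3 * x$1 * v$3 + 3 * x$3 * v$1 + 3 * sqrt 3 * (x$2 * v$3 + x$3 * v$2 + x$4 * v$5 + x$5 * v$4))
    (3 * x$1 * v$4 + 3 * x$4 * v$1 + 3 * sqrt 3 * (x$3 * v$5 + x$5 * v$3 - x$2 * v$4 - x$4 * v$2))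
    (- 6 * x$1 * v$5 - 6 * x$5 * v$1 + 3 * sqrt 3 * (x$3 * v$4 + x$4 * v$3))"

lemma bilinear_cubic_hess: "bilinear cubic_hess"
  unfolding bilinear_def
  by (auto intro!: linearI simp: cubic_hess_def vec_eq_iff forall_5 algebra_simps)

lemmas bounded_bilinear_cubic_hess = bilinear_cubic_hess[THEN bilinear_conv_bounded_bilinear[THEN iffD1]]

lemma cubic_hess_sym: "cubic_hess x v = cubic_hess v x"
  by (simp add: cubic_hess_def vec_eq_iff forall_5 algebra_simps)

lemma cubic_hess_trilinear_sym: "cubic_hess x v \<bullet> h = cubic_hess x h \<bullet> v"
  by (simp add: cubic_hess_def inner_5 algebra_simps)

lemma cubic_hess_diag: "cubic_hess x x \<bullet> x = 6 * cartan_cubic x"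
  by (simp add: cubic_hess_def cartan_cubic_def inner_5 power2_eq_square power3_eq_cube field_simps)

text \<open>Euler's relation for the gradient, which is homogeneous of degree two.\<close>

definition cubic_grad :: "real^5 \<Rightarrow> real^5" where
  "cubic_grad x = (1/2) *\<^sub>R cubic_hess x x"

lemmas cubic_hess_simps = bounded_bilinear.add_left[OF bounded_bilinear_cubic_hess]
  bounded_bilinear.add_right[OF bounded_bilinear_cubic_hess]
  bounded_bilinear.diff_left[OF bounded_bilinear_cubic_hess]
  bounded_bilinear.diff_right[OF bounded_bilinear_cubic_hess]
  bounded_bilinear.scaleR_left[OF bounded_bilinear_cubic_hess]
  bounded_bilinear.scaleR_right[OF bounded_bilinear_cubic_hess]
  bounded_bilinear.minus_left[OF bounded_bilinear_cubic_hess]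
  bounded_bilinear.minus_right[OF bounded_bilinear_cubic_hess]
  bounded_bilinear.zero_left[OF bounded_bilinear_cubic_hess]
  bounded_bilinear.zero_right[OF bounded_bilinear_cubic_hess]

lemma cubic_eq: "cartan_cubic x = (1/6) * (cubic_hess x x \<bullet> x)"
  by (simp add: cubic_hess_diag)

lemma cubic_grad_inner_self: "cubic_grad x \<bullet> x = 3 * cartan_cubic x"
  by (simp add: cubic_grad_def cubic_hess_diag)

text \<open>The Taylor expansion of a cubic form is exact with remainder \<open>P(h)\<close>. This
  gives both the expansion at \<open>K\<close> and the splitting, near a centre, into a quadratic
  polynomial plus \<open>P(h)\<close>.\<close>

lemma cubic_add:
  "cartan_cubic (x + h) = cartan_cubic x + cubic_grad x \<bullet> h + 1/2 * (cubic_hess x h \<bullet> h) + cartan_cubic h"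
proof -
  have "cubic_hess (x + h) (x + h) \<bullet> (x + h) = (cubic_hess x x + cubic_hess x h + (cubic_hess x h + cubic_hess h h)) \<bullet> (x + h)"
    using cubic_hess_sym[of h x] by (simp only: cubic_hess_simps)
  then show ?thesis
    using cubic_hess_trilinear_sym[of x x h] cubic_hess_trilinear_sym[of h h x] cubic_hess_sym[of h x]
    unfolding cubic_eq cubic_grad_def inner_add_left inner_add_right by simp
qed

lemma cubic_minus: "cartan_cubic (- x) = - cartan_cubic x"
  by (simp add: cubic_eq cubic_hess_simps)

lemma cubic_scale: "cartan_cubic (c *\<^sub>R x) = c ^ 3 * cartan_cubic x"
  by (simp add: cubic_eq cubic_hess_simps power3_eq_cube)

lemma cubic_hess_self_has_derivative:
  "((\<lambda>x. cubic_hess x x) has_derivative (\<lambda>h. 2 *\<^sub>R cubic_hess x h)) (at x)"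
  using bounded_bilinear.FDERIV[OF bounded_bilinear_cubic_hess has_derivative_ident has_derivative_ident, of x UNIV]
  by (simp add: cubic_hess_sym[of _ x] flip: scaleR_2)

lemma cubic_has_derivative: "(cartan_cubic has_derivative (\<lambda>h. cubic_grad x \<bullet> h)) (at x)"
proof -
  have "((\<lambda>x. cubic_hess x x \<bullet> x) has_derivative (\<lambda>h. cubic_hess x x \<bullet> h + (2 *\<^sub>R cubic_hess x h) \<bullet> x)) (at x)"
    by (rule has_derivative_inner[OF cubic_hess_self_has_derivative has_derivative_ident])
  from has_derivative_mult_right[OF this, of "1/6"]
  show ?thesis
    using cubic_hess_trilinear_sym[of x x]
    by (simp add: cubic_eq[abs_def] cubic_grad_def field_simps)
qed

lemma cubic_grad_has_derivative: "(cubic_grad has_derivative cubic_hess x) (at x)"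
  using has_derivative_scaleR_right[OF cubic_hess_self_has_derivative, of "1/2" x]
  by (simp add: cubic_grad_def[abs_def])

lemma grad_cubic: "grad cartan_cubic = cubic_grad"
  using grad_eqI[OF cubic_has_derivative] by auto

lemma hessian_mult:
  assumes "(grad f has_derivative D) (at x)"
  shows "hessian f x *v v = D v"
  using frechet_derivative_at[OF assms] has_derivative_linear[OF assms]
  by (simp add: hessian_def matrix_works)

lemma hessian_cubic: "hessian cartan_cubic x *v v = cubic_hess x v"
  by (rule hessian_mult) (simp add: grad_cubic cubic_grad_has_derivative)

text \<open>The Cartan cubic is half the determinant of this matrix, so conjugation by orthogonal
  matrices acts on the five-dimensional space by isometries preserving it.\<close>

definition mat3 :: "real^5 \<Rightarrow> real^3^3" where
  "mat3 x = vector [vector [2 * x$1, sqrt 3 * x$4, sqrt 3 * x$3],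
     vector [sqrt 3 * x$4, - (x$1 + sqrt 3 * x$2), sqrt 3 * x$5],
     vector [sqrt 3 * x$3, sqrt 3 * x$5, - (x$1 - sqrt 3 * x$2)]]"

definition unmat3 :: "real^3^3 \<Rightarrow> real^5" where
  "unmat3 N = vec5 (N$1$1 / 2) ((N$3$3 - N$2$2) / (2 * sqrt 3)) (N$1$3 / sqrt 3) (N$1$2 / sqrt 3) (N$2$3 / sqrt 3)"

lemma sqrt3_times [simp]: "sqrt 3 * (sqrt 3 * x) = 3 * x"
  by (simp flip: mult.assoc)

lemma unmat3_mat3: "unmat3 (mat3 x) = x"
  by (simp add: vec_eq_iff forall_5 unmat3_def mat3_def field_simps)

lemma mat3_unmat3:
  assumes "transpose N = N" "trace N = 0"
  shows "mat3 (unmat3 N) = N"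
proof -
  have "N$2$1 = N$1$2" "N$3$1 = N$1$3" "N$3$2 = N$2$3"
    using assms(1) by (simp_all add: vec_eq_iff transpose_def)
  moreover have "N$1$1 + N$2$2 + N$3$3 = 0" using assms(2) by (simp add: trace_def sum_3)
  then have "sqrt 3 * (N$1$1 + N$2$2 + N$3$3) = 0" by simp
  ultimately show ?thesis
    by (simp add: vec_eq_iff forall_3 unmat3_def mat3_def field_simps)
qed

lemma mat3_sym: "transpose (mat3 x) = mat3 x"
  by (simp add: vec_eq_iff forall_3 mat3_def transpose_def)

lemma mat3_trace: "trace (mat3 x) = 0"
  by (simp add: trace_def sum_3 mat3_def)

lemma cubic_det: "cartan_cubic x = det (mat3 x) / 2"
  by (simp add: det_3 mat3_def cartan_cubic_def power2_eq_square power3_eq_cube algebra_simps)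

text \<open>The trace of the square is invariant under orthogonal conjugation, so conjugation acts
  on the vectors by isometries.\<close>

lemma norm_mat3: "(norm x)\<^sup>2 = trace (mat3 x ** mat3 x) / 6"
  unfolding norm_5_sq by (simp add: trace_def sum_3 matrix_matrix_mult_def mat3_def power2_eq_square algebra_simps)

lemma linear_mat3: "linear mat3"
  by (rule linearI) (simp_all add: vec_eq_iff forall_3 mat3_def algebra_simps)

lemma linear_unmat3: "linear unmat3"
  by (rule linearI) (simp_all add: vec_eq_iff forall_5 unmat3_def add_divide_distrib diff_divide_distrib right_diff_distrib)

definition conj5 :: "real^3^3 \<Rightarrow> real^5 \<Rightarrow> real^5" where
  "conj5 A x = unmat3 (A ** mat3 x ** transpose A)"

lemma mat3_conj5:
  assumes "orthogonal_matrix A"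
  shows "mat3 (conj5 A x) = A ** mat3 x ** transpose A"
  unfolding conj5_def
proof (rule mat3_unmat3)
  show "transpose (A ** mat3 x ** transpose A) = A ** mat3 x ** transpose A"
    by (simp add: matrix_transpose_mul mat3_sym matrix_mul_assoc)
  have "trace (A ** mat3 x ** transpose A) = trace (transpose A ** (A ** mat3 x))"
    by (rule trace_mul_sym)
  also have "\<dots> = trace (mat3 x)"
    using assms by (simp add: matrix_mul_assoc orthogonal_matrix_def)
  finally show "trace (A ** mat3 x ** transpose A) = 0" by (simp add: mat3_trace)
qed

lemma conj5_linear: "linear (conj5 A)"
proof -
  have "linear (\<lambda>N. A ** N ** transpose A)"
    by (rule linearI) (simp_all add: vec_eq_iff matrix_matrix_mult_def sum_3 algebra_simps)
  then show ?thesis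
    unfolding conj5_def using linear_compose[OF linear_compose[OF linear_mat3] linear_unmat3] by (simp add: o_def)
qed

lemma conj5_cubic:
  assumes "orthogonal_matrix A"
  shows "cartan_cubic (conj5 A x) = cartan_cubic x"
proof -
  have "det A * det (transpose A) = 1"
    using assms by (metis det_I det_mul orthogonal_matrix_def)
  then show ?thesis by (simp add: cubic_det mat3_conj5[OF assms] det_mul algebra_simps)
qed

lemma conj5_norm:
  assumes "orthogonal_matrix A"
  shows "norm (conj5 A x) = norm x"
proof -
  have "(A ** mat3 x ** transpose A) ** (A ** mat3 x ** transpose A)
     = A ** mat3 x ** (transpose A ** A) ** mat3 x ** transpose A"
    by (simp add: matrix_mul_assoc)
  also have "\<dots> = (A ** (mat3 x ** mat3 x)) ** transpose A"
    using assms by (simp add: orthogonal_matrix_def matrix_mul_assoc)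
  also have "trace \<dots> = trace (transpose A ** (A ** (mat3 x ** mat3 x)))" by (rule trace_mul_sym)
  also have "\<dots> = trace (mat3 x ** mat3 x)"
    using assms by (simp add: orthogonal_matrix_def matrix_mul_assoc)
  finally have "(norm (conj5 A x))\<^sup>2 = (norm x)\<^sup>2" by (simp add: norm_mat3 mat3_conj5[OF assms])
  then show ?thesis by simp
qed

lemma conj5_inverse:
  assumes "orthogonal_matrix A"
  shows "conj5 (transpose A) (conj5 A x) = x"
proof -
  have "transpose A ** (A ** mat3 x ** transpose A) ** A = (transpose A ** A) ** mat3 x ** (transpose A ** A)"
    by (simp add: matrix_mul_assoc)
  then show ?thesis
    using assms by (simp add: conj5_def[of "transpose A"] mat3_conj5 orthogonal_matrix_def unmat3_mat3)
qed

section \<open>Diagonalization of symmetric matrices by maximizing the Rayleigh quotient\<close>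

lemma rayleigh_max:
  fixes M :: "real^'n^'n"
  assumes "transpose M = M" "subspace S" "z \<in> S" "z \<noteq> 0"
  obtains e where "e \<in> S" "norm e = 1" "\<And>f. f \<in> S \<Longrightarrow> norm f = 1 \<Longrightarrow> f \<bullet> (M *v f) \<le> e \<bullet> (M *v e)"
    "\<And>f. f \<in> S \<Longrightarrow> f \<bullet> e = 0 \<Longrightarrow> f \<bullet> (M *v e) = 0"
proof -
  let ?K = "S \<inter> sphere 0 1"
  have "compact ?K" using closed_subspace[OF assms(2)] by (simp add: closed_Int_compact)
  moreover have "z /\<^sub>R norm z \<in> ?K" using assms by (simp add: subspace_scale)
  moreover have "continuous_on ?K (\<lambda>f. f \<bullet> (M *v f))"
    by (intro continuous_intros linear_continuous_on matrix_vector_mul_bounded_linear)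
  ultimately obtain e where e: "e \<in> ?K" "\<And>f. f \<in> ?K \<Longrightarrow> f \<bullet> (M *v f) \<le> e \<bullet> (M *v e)"
    using continuous_attains_sup[of ?K "\<lambda>f. f \<bullet> (M *v f)"] by blast
  define \<mu> where "\<mu> = e \<bullet> (M *v e)"
  have le: "g \<bullet> (M *v g) \<le> \<mu> * (g \<bullet> g)" if "g \<in> S" for g
  proof (cases "g = 0")
    case False
    have "(g /\<^sub>R norm g) \<bullet> (M *v (g /\<^sub>R norm g)) \<le> \<mu>"
      unfolding \<mu>_def using False that assms(2) by (intro e(2)) (simp add: subspace_scale)
    then have "(g \<bullet> (M *v g)) / (norm g)\<^sup>2 \<le> \<mu>"
      by (simp add: matrix_vector_mult_scaleR power2_eq_square field_simps)
    then show ?thesis using False by (simp add: pos_divide_le_eq power2_norm_eq_inner)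
  qed simp
  have "f \<bullet> (M *v e) = 0" if f: "f \<in> S" "f \<bullet> e = 0" for f
  proof -
    define b c where "b = f \<bullet> (M *v e)" and "c = \<mu> * (f \<bullet> f) - f \<bullet> (M *v f)"
    have sym: "e \<bullet> (M *v f) = b"
      unfolding b_def by (metis assms(1) dot_lmul_matrix inner_commute transpose_matrix_vector)
    have ee: "e \<bullet> e = 1" using e(1) by (simp add: dot_square_norm)
    \<comment> \<open>Maximality tested at \<open>e + s f\<close>. The left side is linear in
      \<open>s\<close> and the right side quadratic, which forces \<open>b = 0\<close>; below,
      \<open>s = b / k\<close> with a positive \<open>k \<ge> c\<close> extracts this.\<close>
    have *: "2 * s * b \<le> s\<^sup>2 * c" for s
    proof -
      have "e + s *\<^sub>R f \<in> S" using e(1) f(1) assms(2) by (simp add: subspace_add subspace_scale)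
      from le[OF this] show ?thesis
        using f(2) ee sym
        by (simp add: matrix_vector_right_distrib matrix_vector_mult_scaleR inner_add_left inner_add_right
          inner_commute[of e f] b_def c_def \<mu>_def power2_eq_square algebra_simps)
    qed
    define k where "k = \<bar>c\<bar> + 1"
    have k: "k > 0" "c \<le> k" by (auto simp: k_def)
    have "2 * (b / k) * b \<le> (b / k)\<^sup>2 * c" by (rule *)
    also have "\<dots> \<le> (b / k)\<^sup>2 * k" using k by (intro mult_left_mono) auto
    finally have "2 * (b * b / k) \<le> b * b / k" using k by (simp add: power2_eq_square)
    then have "b * b / k \<le> 0" by simp
    then have "b * b \<le> 0" using k by (simp add: divide_le_0_iff)
    then show ?thesis by (metis b_def mult_eq_0_iff order_antisym zero_le_square)
  qed
  then show ?thesis using that[of e] e by auto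
qed

text \<open>A maximizer, a maximizer on its orthogonal plane, and their cross product form an
  eigenbasis. It is listed with the middle eigenvalue first, then the smallest, then the largest: in
  \<open>mat3\<close> the first diagonal entry is \<open>2 * x$1\<close>, and making it the middle
  one keeps \<open>x$1\<close> small against \<open>x$2\<close>.\<close>

lemma symmetric3_diagonalize:
  fixes M :: "real^3^3"
  assumes "transpose M = M"
  obtains A where "orthogonal_matrix A" "(A ** M ** transpose A)$1$2 = 0" "(A ** M ** transpose A)$1$3 = 0"
    "(A ** M ** transpose A)$2$3 = 0" "(A ** M ** transpose A)$2$2 \<le> (A ** M ** transpose A)$1$1"
    "(A ** M ** transpose A)$1$1 \<le> (A ** M ** transpose A)$3$3"
proof -
  obtain f1 where f1: "norm f1 = 1" "\<And>f. norm f = 1 \<Longrightarrow> f \<bullet> (M *v f) \<le> f1 \<bullet> (M *v f1)"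
    "\<And>f. f \<bullet> f1 = 0 \<Longrightarrow> f \<bullet> (M *v f1) = 0"
    by (rule rayleigh_max[OF assms subspace_UNIV, of "axis 1 1"]) (auto simp: axis_eq_0_iff)
  let ?S = "{f. f1 \<bullet> f = 0}"
  have S: "subspace ?S" by (rule subspace_hyperplane)
  have "f1 \<noteq> 0" using f1(1) by auto
  then have "dim ?S = 2" using dim_hyperplane[of f1] by simp
  then obtain z where "z \<in> ?S" "z \<noteq> 0" by (metis dim_eq_0 subsetI singleton_iff zero_neq_numeral)
  then obtain f2 where f2: "f1 \<bullet> f2 = 0" "norm f2 = 1" "\<And>f. f1 \<bullet> f = 0 \<Longrightarrow> norm f = 1 \<Longrightarrow> f \<bullet> (M *v f) \<le> f2 \<bullet> (M *v f2)"
    "\<And>f. f1 \<bullet> f = 0 \<Longrightarrow> f \<bullet> f2 = 0 \<Longrightarrow> f \<bullet> (M *v f2) = 0"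
    by (rule rayleigh_max[OF assms S]) auto
  define f3 where "f3 = cross3 f1 f2"
  have "(norm f3)\<^sup>2 = 1" using norm_cross_dot[of f1 f2] f1(1) f2(1,2) by (simp add: f3_def)
  then have "norm f3 = 1" using norm_ge_zero[of f3] by (simp add: power2_eq_1_iff)
  then have f3: "f1 \<bullet> f3 = 0" "f2 \<bullet> f3 = 0" "f3 \<bullet> f1 = 0" "f3 \<bullet> f2 = 0" "norm f3 = 1"
    by (auto simp: f3_def dot_cross_self)
  define A :: "real^3^3" where "A = vector [f2, f3, f1]"
  have ent: "(A ** M ** transpose A)$i$j = A$i \<bullet> (M *v A$j)" for i j
    by (simp add: matrix_matrix_mult_def matrix_vector_mult_def transpose_def inner_vec_def sum_3 algebra_simps)
  have "(A ** transpose A)$i$j = A$i \<bullet> A$j" for i j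
    by (simp add: matrix_matrix_mult_def transpose_def inner_vec_def)
  then have "A ** transpose A = mat 1"
    using f1(1) f2(1,2) f3
    by (simp add: vec_eq_iff forall_3 mat_def A_def inner_commute dot_square_norm)
  then have "orthogonal_matrix A" by (simp add: orthogonal_matrix matrix_left_right_inverse)
  moreover have "A$1 = f2" "A$2 = f3" "A$3 = f1" by (simp_all add: A_def)
  moreover have "f2 \<bullet> (M *v f3) = f3 \<bullet> (M *v f2)"
    by (metis assms dot_lmul_matrix inner_commute transpose_matrix_vector)
  ultimately show ?thesis
    using that[of A] unfolding ent using f1(2)[OF f2(2)] f1(3)[of f2] f1(3)[of f3] f2(3)[of f3] f2(4)[of f3] f2(1) f3
    by (simp add: inner_commute)
qed

section \<open>The eigenvalues of the Hessian of $P + P/|x|$\<close>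

text \<open>The quadratic form of $D^2(P + P/|\<cdot>|)(x)$; division by zero makes it vanish at
  \<open>x = 0\<close>, which is the convention needed at the singular points.\<close>

definition singular_form :: "real^5 \<Rightarrow> real^5 \<Rightarrow> real" where
  "singular_form x v = (1 + 1 / norm x) * (cubic_hess x v \<bullet> v)
     - 2 * (x \<bullet> v) * (cubic_grad x \<bullet> v) / norm x ^ 3
     + cartan_cubic x * (3 * (x \<bullet> v)\<^sup>2 / norm x ^ 5 - (norm v)\<^sup>2 / norm x ^ 3)"

text \<open>Polarization expresses derivatives by values of \<open>P\<close> alone, so a linear map
  preserving \<open>P\<close> preserves them without any differentiation of the invariance.\<close>

lemma cubic_hess_polar: "cubic_hess x v \<bullet> v = cartan_cubic (x + v) + cartan_cubic (x - v) - 2 * cartan_cubic x"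
  using cubic_add[of x v] cubic_add[of x "-v"] by (simp add: cubic_minus cubic_hess_simps)

lemma cubic_grad_polar: "cubic_grad x \<bullet> v = (cartan_cubic (x + v) - cartan_cubic (x - v)) / 2 - cartan_cubic v"
  using cubic_add[of x v] cubic_add[of x "-v"] by (simp add: cubic_minus cubic_hess_simps field_simps)

lemma singular_form_invariant:
  assumes "orthogonal_transformation T" "\<And>y. cartan_cubic (T y) = cartan_cubic y"
  shows "singular_form (T x) (T v) = singular_form x v"
proof -
  have lin: "linear T" using assms(1) orthogonal_transformation_linear by blast
  have "T x \<bullet> T v = x \<bullet> v" using assms(1) by (simp add: orthogonal_transformation_def)
  then show ?thesis
    using orthogonal_transformation_norm[OF assms(1)] assms(2)
    by (simp add: singular_form_def cubic_hess_polar cubic_grad_polar flip: linear_add[OF lin] linear_diff[OF lin])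
qed

text \<open>The last two conditions say that the diagonal entries of \<open>mat3 y\<close> are
  ordered. They cut out of the plane of diagonal matrices a Weyl chamber, a sector of angle
  pi/3.\<close>

lemma cartan_cubic_diagonalize:
  obtains T y where "orthogonal_transformation T" "\<And>y. cartan_cubic (T y) = cartan_cubic y" "x = T y"
    "y$3 = 0" "y$4 = 0" "y$5 = 0" "0 \<le> y$2" "3 * (y$1)\<^sup>2 \<le> (y$2)\<^sup>2"
proof -
  obtain A where A: "orthogonal_matrix A" and z: "(A ** mat3 x ** transpose A)$1$2 = 0" "(A ** mat3 x ** transpose A)$1$3 = 0"
    "(A ** mat3 x ** transpose A)$2$3 = 0"
    and le: "(A ** mat3 x ** transpose A)$2$2 \<le> (A ** mat3 x ** transpose A)$1$1"
    "(A ** mat3 x ** transpose A)$1$1 \<le> (A ** mat3 x ** transpose A)$3$3"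
    by (rule symmetric3_diagonalize[OF mat3_sym])
  define y where "y = conj5 A x"
  have AT: "orthogonal_matrix (transpose A)" using A by simp
  have my: "mat3 y = A ** mat3 x ** transpose A" by (simp add: y_def mat3_conj5[OF A])
  have y: "y$3 = 0" "y$4 = 0" "y$5 = 0"
    using z by (simp_all flip: my) (simp_all add: mat3_def)
  have le': "- (y$1 + sqrt 3 * y$2) \<le> 2 * y$1" "2 * y$1 \<le> - (y$1 - sqrt 3 * y$2)"
    using le by (simp_all flip: my) (simp_all add: mat3_def)
  then have "0 \<le> sqrt 3 * y$2" by linarith
  then have "0 \<le> y$2" by (simp add: zero_le_mult_iff)
  have "\<bar>3 * y$1\<bar> \<le> \<bar>sqrt 3 * y$2\<bar>" using le' by linarith
  then have "(3 * y$1)\<^sup>2 \<le> (sqrt 3 * y$2)\<^sup>2" by (simp only: abs_le_square_iff)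
  then have "3 * (y$1)\<^sup>2 \<le> (y$2)\<^sup>2" by (simp add: power_mult_distrib)
  moreover have "x = conj5 (transpose A) y" by (simp add: y_def conj5_inverse[OF A])
  moreover have "orthogonal_transformation (conj5 (transpose A))"
    using conj5_linear conj5_norm[OF AT] orthogonal_transformation by blast
  ultimately show ?thesis
    using that[of "conj5 (transpose A)" y] y \<open>0 \<le> y$2\<close> conj5_cubic[OF AT] by auto
qed

text \<open>The rotation angle is half the argument of \<open>(a - c)/2 + i b\<close>, whose modulus
  is half the distance of the two eigenvalues.\<close>

lemma diagonalize_binary_form:
  fixes a b c :: real
  obtains \<theta> where "\<And>u w. a * (cos \<theta> * u - sin \<theta> * w)\<^sup>2 + 2 * b * (cos \<theta> * u - sin \<theta> * w) * (sin \<theta> * u + cos \<theta> * w)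
     + c * (sin \<theta> * u + cos \<theta> * w)\<^sup>2
     = ((a + c) / 2 + sqrt (((a - c) / 2)\<^sup>2 + b\<^sup>2)) * u\<^sup>2 + ((a + c) / 2 - sqrt (((a - c) / 2)\<^sup>2 + b\<^sup>2)) * w\<^sup>2"
proof -
  define S where "S = sqrt (((a - c) / 2)\<^sup>2 + b\<^sup>2)"
  define z where "z = Complex ((a - c) / 2) b"
  define C Z where "C = cos (Arg z / 2)" and "Z = sin (Arg z / 2)"
  have "cmod z = S" by (simp add: z_def S_def cmod_def)
  then have "z = rcis S (Arg z)" using rcis_cmod_Arg[of z] by simp
  then have "(a - c) / 2 = S * cos (Arg z)" "b = S * sin (Arg z)"
    by (simp_all add: z_def complex_eq_iff)
  moreover have "cos (Arg z) = C\<^sup>2 - Z\<^sup>2" "sin (Arg z) = 2 * Z * C"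
    using cos_double[of "Arg z / 2"] sin_double[of "Arg z / 2"] by (simp_all add: C_def Z_def)
  moreover have CZ: "C\<^sup>2 + Z\<^sup>2 = 1" by (simp add: C_def Z_def)
  moreover define m where "m = (a + c) / 2"
  ultimately have *: "a = m + S * (C\<^sup>2 - Z\<^sup>2)" "c = m - S * (C\<^sup>2 - Z\<^sup>2)" "b = S * (2 * Z * C)" by (simp_all add: field_simps)
  have "a * (C * u - Z * w)\<^sup>2 + 2 * b * (C * u - Z * w) * (Z * u + C * w) + c * (Z * u + C * w)\<^sup>2
     = (m + S) * u\<^sup>2 + (m - S) * w\<^sup>2" for u w
    unfolding * using CZ by algebra
  then show ?thesis using that[of "Arg z / 2"] unfolding S_def[symmetric] m_def[symmetric] C_def Z_def by blast
qed

text \<open>With \<open>t = sin \<phi>\<close> one has \<open>p = sin 3\<phi>\<close> and \<open>s = cos 3\<phi>\<close>; the coordinates \<open>a\<close> and \<open>b\<close> are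
  taken along \<open>y\<close> and along the tangential part of the gradient of \<open>P\<close>.\<close>

lemma singular_form_diag:
  assumes "0 < r" "t\<^sup>2 \<le> 1/4"
  assumes "y = vec5 (- r * t) (r * sqrt (1 - t\<^sup>2)) 0 0 0"
  defines "p \<equiv> 3 * t - 4 * t ^ 3"
  defines "s \<equiv> sqrt (1 - t\<^sup>2) * (1 - 4 * t\<^sup>2)"
  defines "q \<equiv> sqrt (1 - t\<^sup>2)"
  shows "cartan_cubic y = r ^ 3 * p" "norm y = r" "p\<^sup>2 + s\<^sup>2 = 1"
    "singular_form y (vec5 (- t * a - q * b) (q * a - t * b) v3 v4 v5) =
     (6 * r + 2) * p * a\<^sup>2 + 2 * (6 * r + 3) * s * a * b - (6 * r + 7) * p * b\<^sup>2 +
     ((r + 1) * (- 3 * t + 3 * sqrt 3 * q) - p) * v3\<^sup>2 + ((r + 1) * (- 3 * t - 3 * sqrt 3 * q) - p) * v4\<^sup>2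
     + ((r + 1) * (6 * t) - p) * v5\<^sup>2"
proof -
  have q2: "q\<^sup>2 = 1 - t\<^sup>2" using assms(2) by (simp add: q_def)
  show P: "cartan_cubic y = r ^ 3 * p"
    unfolding assms(3) cartan_cubic_def p_def using q2 unfolding q_def[symmetric]
    by (simp add: power_mult_distrib) (simp add: algebra_simps power2_eq_square power3_eq_cube)
  show n: "norm y = r"
  proof -
    have "(norm y)\<^sup>2 = r\<^sup>2" unfolding norm_5_sq assms(3) using q2 unfolding q_def[symmetric]
      by (simp add: power_mult_distrib) (simp add: algebra_simps)
    then show ?thesis using assms(1) by simp
  qed
  show "p\<^sup>2 + s\<^sup>2 = 1"
    unfolding p_def s_def q_def[symmetric] using q2 by algebra
  let ?v = "vec5 (- t * a - q * b) (q * a - t * b) v3 v4 v5"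
  have i: "y \<bullet> ?v = r * a"
    unfolding assms(3) inner_5 using q2 unfolding q_def[symmetric] by simp algebra
  have nv: "(norm ?v)\<^sup>2 = a\<^sup>2 + b\<^sup>2 + v3\<^sup>2 + v4\<^sup>2 + v5\<^sup>2"
    unfolding norm_5_sq using q2 unfolding q_def[symmetric] by simp algebra
  have g: "cubic_grad y \<bullet> ?v = 3 * r\<^sup>2 * (p * a + s * b)"
    unfolding assms(3) inner_5 cubic_grad_def cubic_hess_def p_def s_def using q2 unfolding q_def[symmetric] by simp algebra
  have h: "cubic_hess y ?v \<bullet> ?v = r * (6 * p * a\<^sup>2 + 12 * s * a * b - 6 * p * b\<^sup>2 + (- 3 * t + 3 * sqrt 3 * q) * v3\<^sup>2
     + (- 3 * t - 3 * sqrt 3 * q) * v4\<^sup>2 + 6 * t * v5\<^sup>2)"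
    unfolding assms(3) inner_5 cubic_hess_def p_def s_def using q2 unfolding q_def[symmetric] by simp algebra
  show "singular_form y ?v = (6 * r + 2) * p * a\<^sup>2 + 2 * (6 * r + 3) * s * a * b - (6 * r + 7) * p * b\<^sup>2 +
     ((r + 1) * (- 3 * t + 3 * sqrt 3 * q) - p) * v3\<^sup>2 + ((r + 1) * (- 3 * t - 3 * sqrt 3 * q) - p) * v4\<^sup>2
     + ((r + 1) * (6 * t) - p) * v5\<^sup>2"
    unfolding singular_form_def i nv g h P n using assms(1)
    by (simp add: field_simps power2_eq_square power3_eq_cube eval_nat_numeral)
qed

text \<open>Entries 1 and 2 belong to the block spanned by the radial and the tangential gradient
  direction; putting \<open>1 - p^2\<close> for \<open>s^2\<close> in the discriminant makes them
  depend on \<open>r\<close> and \<open>p\<close> only. Entries 3 to 5 belong to the three remaining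
  axes, on which the form is already diagonal.\<close>

definition singular_eigs :: "real \<Rightarrow> real \<Rightarrow> real^5" where
  "singular_eigs r t = (let p = 3 * t - 4 * t ^ 3; S = sqrt ((6 * r + 3)\<^sup>2 + p\<^sup>2 * (18 * r + 45/4)) in
     vec5 (- (5/2) * p + S) (- (5/2) * p - S)
       ((r + 1) * (- 3 * t + 3 * sqrt 3 * sqrt (1 - t\<^sup>2)) - p)
       ((r + 1) * (- 3 * t - 3 * sqrt 3 * sqrt (1 - t\<^sup>2)) - p)
       ((r + 1) * (6 * t) - p))"

lemma singular_form_eigs:
  assumes "x \<noteq> 0"
  obtains T t where "orthogonal_transformation T" "\<bar>t\<bar> \<le> 1/2" "cartan_cubic x = norm x ^ 3 * (3 * t - 4 * t ^ 3)"
    "\<And>v. singular_form x (T v) = (\<Sum>i\<in>UNIV. singular_eigs (norm x) t $ i * (v $ i)\<^sup>2)"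
proof -
  obtain T y where T: "orthogonal_transformation T" "\<And>y. cartan_cubic (T y) = cartan_cubic y" "x = T y"
    and y: "y$3 = 0" "y$4 = 0" "y$5 = 0" "0 \<le> y$2" "3 * (y$1)\<^sup>2 \<le> (y$2)\<^sup>2"
    by (rule cartan_cubic_diagonalize[of x]) blast
  define r where "r = norm y"
  have r: "r = norm x" using T by (simp add: r_def orthogonal_transformation_norm)
  then have "r > 0" using assms by simp
  have r2: "r\<^sup>2 = (y$1)\<^sup>2 + (y$2)\<^sup>2" using y by (simp add: r_def norm_5_sq)
  define t where "t = - y$1 / r"
  define q where "q = sqrt (1 - t\<^sup>2)"
  \<comment> \<open>The chamber condition becomes \<open>|t| \<le> 1/2\<close>, an angle of at most
    pi/6 in absolute value.\<close>
  have "4 * (y$1)\<^sup>2 \<le> r\<^sup>2" using y(5) r2 by simp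
  then have t2: "t\<^sup>2 \<le> 1/4" using \<open>r > 0\<close> by (simp add: t_def power_divide pos_divide_le_eq)
  then have "\<bar>t\<bar> \<le> 1/2" using abs_le_square_iff[of t "1/2"] by (simp add: power2_eq_square)
  have "r * q = sqrt (r\<^sup>2 * (1 - t\<^sup>2))" using \<open>r > 0\<close> by (simp add: q_def real_sqrt_mult)
  also have "r\<^sup>2 * (1 - t\<^sup>2) = (y$2)\<^sup>2"
    using r2 \<open>r > 0\<close> by (simp add: t_def power_divide right_diff_distrib)
  finally have "y$2 = r * q" using y(4) by simp
  then have y_eq: "y = vec5 (- r * t) (r * sqrt (1 - t\<^sup>2)) 0 0 0"
    using y \<open>r > 0\<close> by (simp add: vec_eq_iff forall_5 t_def q_def)
  note D = singular_form_diag[OF \<open>r > 0\<close> t2 y_eq, folded q_def]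
  define p where "p = 3 * t - 4 * t ^ 3"
  define s where "s = q * (1 - 4 * t\<^sup>2)"
  define S where "S = sqrt ((6 * r + 3)\<^sup>2 + p\<^sup>2 * (18 * r + 45/4))"
  obtain \<theta> where \<theta>: "\<And>u w. (6 * r + 2) * p * (cos \<theta> * u - sin \<theta> * w)\<^sup>2
     + 2 * ((6 * r + 3) * s) * (cos \<theta> * u - sin \<theta> * w) * (sin \<theta> * u + cos \<theta> * w)
     + (- (6 * r + 7) * p) * (sin \<theta> * u + cos \<theta> * w)\<^sup>2
     = (((6 * r + 2) * p + (- (6 * r + 7) * p)) / 2 + sqrt ((((6 * r + 2) * p - (- (6 * r + 7) * p)) / 2)\<^sup>2 + ((6 * r + 3) * s)\<^sup>2)) * u\<^sup>2
     + (((6 * r + 2) * p + (- (6 * r + 7) * p)) / 2 - sqrt ((((6 * r + 2) * p - (- (6 * r + 7) * p)) / 2)\<^sup>2 + ((6 * r + 3) * s)\<^sup>2)) * w\<^sup>2"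
    by (rule diagonalize_binary_form[of "(6 * r + 2) * p" "(6 * r + 3) * s" "- (6 * r + 7) * p"]) blast
  have ps: "p\<^sup>2 + s\<^sup>2 = 1" using D(3) by (simp add: p_def s_def)
  have "(((6 * r + 2) * p - (- (6 * r + 7) * p)) / 2)\<^sup>2 + ((6 * r + 3) * s)\<^sup>2 = (6 * r + 3)\<^sup>2 + p\<^sup>2 * (18 * r + 45/4)"
  proof -
    have "s\<^sup>2 = 1 - p\<^sup>2" using ps by simp
    then show ?thesis by (simp add: power_mult_distrib) (simp add: power2_eq_square field_simps)
  qed
  moreover have "((6 * r + 2) * p + (- (6 * r + 7) * p)) / 2 = - (5/2) * p" by (simp add: algebra_simps)
  moreover have "(6 * r + 2) * p * X\<^sup>2 + 2 * (6 * r + 3) * s * X * Y - (6 * r + 7) * p * Y\<^sup>2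
      = (6 * r + 2) * p * X\<^sup>2 + 2 * ((6 * r + 3) * s) * X * Y + (- (6 * r + 7) * p) * Y\<^sup>2" for X Y
      by (simp add: algebra_simps)
  ultimately have \<theta>': "(6 * r + 2) * p * (cos \<theta> * u - sin \<theta> * w)\<^sup>2
     + 2 * (6 * r + 3) * s * (cos \<theta> * u - sin \<theta> * w) * (sin \<theta> * u + cos \<theta> * w)
     - (6 * r + 7) * p * (sin \<theta> * u + cos \<theta> * w)\<^sup>2
     = (- (5/2) * p + S) * u\<^sup>2 + (- (5/2) * p - S) * w\<^sup>2" for u w
    using \<theta>[of u w] by (simp only: S_def)
  \<comment> \<open>The eigenbasis: a rotation by \<open>\<theta>\<close> inside the block, followed
    by passage from the frame (radial, tangential) of \<open>y\<close> to coordinates.\<close>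
  define R where "R v = vec5 (- t * (cos \<theta> * v$1 - sin \<theta> * v$2) - q * (sin \<theta> * v$1 + cos \<theta> * v$2))
     (q * (cos \<theta> * v$1 - sin \<theta> * v$2) - t * (sin \<theta> * v$1 + cos \<theta> * v$2)) (v$3) (v$4) (v$5)" for v :: "real^5"
  have q2: "q\<^sup>2 = 1 - t\<^sup>2" using t2 by (simp add: q_def)
  have "orthogonal_transformation R"
    unfolding orthogonal_transformation
  proof (intro conjI allI)
    show "linear R" by (rule linearI) (simp_all add: R_def vec_eq_iff forall_5 algebra_simps)
    show "norm (R v) = norm v" for v
    proof -
      define C Z where "C = cos \<theta>" and "Z = sin \<theta>"
      have "C\<^sup>2 + Z\<^sup>2 = 1" by (simp add: C_def Z_def)
      then have "(norm (R v))\<^sup>2 = (norm v)\<^sup>2"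
        unfolding norm_5_sq R_def C_def[symmetric] Z_def[symmetric] using q2 by simp algebra
      then show ?thesis by simp
    qed
  qed
  then have "orthogonal_transformation (T \<circ> R)" using T(1) orthogonal_transformation_compose by blast
  moreover have "singular_form x ((T \<circ> R) v) = (\<Sum>i\<in>UNIV. singular_eigs (norm x) t $ i * (v $ i)\<^sup>2)" for v
  proof -
    have "singular_form x ((T \<circ> R) v) = singular_form y (R v)"
      unfolding T(3) o_def by (rule singular_form_invariant[OF T(1,2)])
    also have "\<dots> = (\<Sum>i\<in>UNIV. singular_eigs r t $ i * (v $ i)\<^sup>2)"
      unfolding R_def D(4) p_def[symmetric] s_def[symmetric] \<theta>' sum_5 singular_eigs_def Let_def S_def[symmetric] q_def[symmetric]
      by simp
    finally show ?thesis by (simp add: r)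
  qed
  moreover have "cartan_cubic x = norm x ^ 3 * (3 * t - 4 * t ^ 3)"
    using D(1) T(2)[of y] T(3) r by simp
  ultimately show ?thesis using that \<open>\<bar>t\<bar> \<le> 1/2\<close> by blast
qed

text \<open>Weyl's inequality: the two spans of axes have dimensions adding up to more than five.\<close>

lemma diag_forms_compare:
  fixes T T' :: "real^5 \<Rightarrow> real^5"
  assumes T: "orthogonal_transformation T" "\<And>v. A (T v) = (\<Sum>i\<in>UNIV. a $ i * (v $ i)\<^sup>2)"
    and T': "orthogonal_transformation T'" "\<And>v. B (T' v) = (\<Sum>i\<in>UNIV. b $ i * (v $ i)\<^sup>2)"
    and IJ: "card I + card J > 5" "\<And>i. i \<in> I \<Longrightarrow> m \<le> a $ i" "\<And>i. i \<in> J \<Longrightarrow> b $ i \<le> (m' :: real)"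
  obtains v where "norm v = 1" "m - m' \<le> A v - B v"
proof -
  define E :: "5 set \<Rightarrow> (real^5) set" where "E I = span ((\<lambda>i. axis i 1) ` I)" for I
  have off: "v $ i = 0" if "v \<in> E I" "i \<notin> I" for v i I
    using that(1) unfolding E_def
    by (induction rule: span_induct_alt) (use that(2) in \<open>auto simp: axis_def split: if_splits\<close>)
  have dimE: "dim (E I) = card I" for I
  proof -
    have "independent ((\<lambda>i. axis i (1::real)) ` I)"
      by (rule independent_mono[OF independent_Basis]) (auto simp: axis_in_Basis_iff)
    then show ?thesis
      unfolding E_def by (simp add: dim_eq_card_independent card_image inj_on_def axis_eq_axis)
  qed
  have sub: "subspace (T ` E I)" "dim (T ` E I) = card I" if "orthogonal_transformation T" for T :: "real^5 \<Rightarrow> real^5" and I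
  proof -
    have lin: "linear T" and inj: "inj T" using that orthogonal_transformation_linear orthogonal_transformation_inj by blast+
    show "subspace (T ` E I)" unfolding E_def by (intro linear_subspace_image lin subspace_span)
    show "dim (T ` E I) = card I" using dim_image_eq[OF lin, of "E I"] inj dimE by (metis inj_on_subset subset_UNIV)
  qed
  let ?U = "T ` E I" and ?W = "T' ` E J"
  have "dim {x + y |x y. x \<in> ?U \<and> y \<in> ?W} + dim (?U \<inter> ?W) = card I + card J"
    using dim_sums_Int[OF sub(1)[OF T(1)] sub(1)[OF T'(1)]] sub(2)[OF T(1)] sub(2)[OF T'(1)] by simp
  moreover have "dim {x + y |x y. x \<in> ?U \<and> y \<in> ?W} \<le> 5"
    using dim_subset_UNIV[of "{x + y |x y. x \<in> ?U \<and> y \<in> ?W}"] by simp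
  ultimately have "dim (?U \<inter> ?W) \<noteq> 0" using IJ(1) by linarith
  then obtain w where w: "w \<in> ?U \<inter> ?W" "w \<noteq> 0" by (metis dim_eq_0 subsetI singleton_iff)
  define v where "v = w /\<^sub>R norm w"
  have "v \<in> ?U \<inter> ?W" unfolding v_def
    using w sub(1)[OF T(1)] sub(1)[OF T'(1)] by (intro subspace_scale subspace_inter) auto
  then obtain v1 v2 where v1: "v = T v1" "v1 \<in> E I" and v2: "v = T' v2" "v2 \<in> E J" by blast
  have nv: "norm v = 1" using w by (simp add: v_def)
  have n1: "norm v1 = 1" "norm v2 = 1"
    using nv v1 v2 orthogonal_transformation_norm[OF T(1)] orthogonal_transformation_norm[OF T'(1)] by metis+
  then have n2: "(\<Sum>i\<in>UNIV. (v1$i)\<^sup>2) = 1" "(\<Sum>i\<in>UNIV. (v2$i)\<^sup>2) = 1"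
    using norm_5_sq[of v1] norm_5_sq[of v2] by (simp_all add: sum_5)
  have "m = (\<Sum>i\<in>UNIV. m * (v1$i)\<^sup>2)" using n2 by (simp flip: sum_distrib_left)
  also have "\<dots> \<le> (\<Sum>i\<in>UNIV. a$i * (v1$i)\<^sup>2)"
    by (rule sum_mono) (metis IJ(2) off v1(2) mult_right_mono mult_zero_right order_refl power_zero_numeral zero_le_power2)
  finally have "m \<le> A v" by (simp add: v1(1) T(2))
  moreover have "(\<Sum>i\<in>UNIV. b$i * (v2$i)\<^sup>2) \<le> (\<Sum>i\<in>UNIV. m' * (v2$i)\<^sup>2)"
    by (rule sum_mono) (metis IJ(3) off v2(2) mult_right_mono mult_zero_right order_refl power_zero_numeral zero_le_power2)
  then have "B v \<le> m'" using n2 by (simp add: v2(1) T'(2) flip: sum_distrib_left)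
  ultimately show ?thesis using that nv by simp
qed

text \<open>The triple-angle polynomial, \<open>cheb (sin phi) = sin (3 phi)\<close>: minus the
  third Chebyshev polynomial.\<close>

definition cheb :: "real \<Rightarrow> real" where "cheb t = 3 * t - 4 * t ^ 3"

text \<open>Both sides are the square of \<open>cos (3 phi)\<close> when
  \<open>t = sin phi\<close>.\<close>

lemma cheb_sq: "1 - (cheb t)\<^sup>2 = (1 - t\<^sup>2) * (1 - 4 * t\<^sup>2)\<^sup>2"
  unfolding cheb_def by algebra

lemma cheb_le_1: assumes "\<bar>t\<bar> \<le> 1/2" shows "\<bar>cheb t\<bar> \<le> 1"
proof -
  have "t\<^sup>2 \<le> 1" using assms by (simp add: abs_square_le_1)
  then have "(cheb t)\<^sup>2 \<le> 1" using cheb_sq[of t] by (smt (verit) mult_nonneg_nonneg zero_le_power2)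
  then show ?thesis by (simp add: abs_square_le_1)
qed

lemma cheb_diff: "cheb a - cheb b = (a - b) * (3 - 4 * (a\<^sup>2 + a * b + b\<^sup>2))"
  unfolding cheb_def by (simp add: power2_eq_square power3_eq_cube algebra_simps)

lemma cheb_mono:
  assumes "\<bar>a\<bar> \<le> 1/2" "\<bar>b\<bar> \<le> 1/2" "b \<le> a" shows "cheb b \<le> cheb a"
proof -
  have "a\<^sup>2 \<le> (1/2)\<^sup>2" "b\<^sup>2 \<le> (1/2)\<^sup>2" using assms(1,2) by (simp_all add: abs_le_square_iff[symmetric])
  moreover have "2 * (a * b) \<le> a\<^sup>2 + b\<^sup>2" using sum_squares_bound[of a b] by simp
  ultimately have "0 \<le> 3 - 4 * (a\<^sup>2 + a * b + b\<^sup>2)" by (simp add: power_divide)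
  then have "0 \<le> cheb a - cheb b" unfolding cheb_diff using assms(3) by (intro mult_nonneg_nonneg) auto
  then show ?thesis by simp
qed

abbreviation eigS :: "real \<Rightarrow> real \<Rightarrow> real" where
  "eigS r t \<equiv> sqrt ((6 * r + 3)\<^sup>2 + (cheb t)\<^sup>2 * (18 * r + 45/4))"

lemma singular_eigs_nth:
  "singular_eigs r t $ 1 = - (5/2) * cheb t + eigS r t"
  "singular_eigs r t $ 2 = - (5/2) * cheb t - eigS r t"
  "singular_eigs r t $ 3 = (r + 1) * (- 3 * t + 3 * sqrt 3 * sqrt (1 - t\<^sup>2)) - cheb t"
  "singular_eigs r t $ 4 = (r + 1) * (- 3 * t - 3 * sqrt 3 * sqrt (1 - t\<^sup>2)) - cheb t"
  "singular_eigs r t $ 5 = (r + 1) * (6 * t) - cheb t"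
  by (simp_all add: singular_eigs_def Let_def cheb_def)

text \<open>Entry 5 is the middle eigenvalue. Which of entries 2 and 4 is the lowest depends on
  \<open>r\<close>: at \<open>t = 0\<close> it is entry 4 for small \<open>r\<close> and entry 2 for
  large \<open>r\<close>. Hence both have to be tracked later.\<close>

lemma singular_eigs_middle:
  assumes "0 \<le> r" "\<bar>t\<bar> \<le> 1/2"
  shows "singular_eigs r t $ 5 \<le> singular_eigs r t $ 1" "singular_eigs r t $ 5 \<le> singular_eigs r t $ 3"
    "singular_eigs r t $ 2 \<le> singular_eigs r t $ 5" "singular_eigs r t $ 4 \<le> singular_eigs r t $ 5"
proof -
  have t2: "t\<^sup>2 \<le> 1/4" using assms(2) abs_le_square_iff[of t "1/2"] by (simp add: power2_eq_square)
  have "\<bar>3 * t\<bar> = sqrt (9 * t\<^sup>2)" by (simp add: real_sqrt_mult)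
  also have "\<dots> \<le> sqrt (3 * (1 - t\<^sup>2))" using t2 by simp
  also have "\<dots> = sqrt 3 * sqrt (1 - t\<^sup>2)" by (rule real_sqrt_mult)
  finally have *: "\<bar>3 * t\<bar> \<le> sqrt 3 * sqrt (1 - t\<^sup>2)" .
  have "(r + 1) * (6 * t) \<le> (r + 1) * (- 3 * t + 3 * sqrt 3 * sqrt (1 - t\<^sup>2))"
    using assms(1) * by (intro mult_left_mono) linarith+
  then show "singular_eigs r t $ 5 \<le> singular_eigs r t $ 3" by (simp add: singular_eigs_nth)
  have "(r + 1) * (- 3 * t - 3 * sqrt 3 * sqrt (1 - t\<^sup>2)) \<le> (r + 1) * (6 * t)"
    using assms(1) * by (intro mult_left_mono) linarith+
  then show "singular_eigs r t $ 4 \<le> singular_eigs r t $ 5" by (simp add: singular_eigs_nth)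
  let ?p = "cheb t"
  have "?p = t * (3 - 4 * t\<^sup>2)" by (simp add: cheb_def power2_eq_square power3_eq_cube algebra_simps)
  then have "\<bar>?p\<bar> = \<bar>t\<bar> * (3 - 4 * t\<^sup>2)" using t2 by (simp add: abs_mult)
  moreover have "\<bar>t\<bar> * 2 \<le> \<bar>t\<bar> * (3 - 4 * t\<^sup>2)" using t2 by (intro mult_left_mono) auto
  ultimately have tp: "2 * \<bar>t\<bar> \<le> \<bar>?p\<bar>" by simp
  have "\<bar>6 * (r + 1) * t + 3/2 * ?p\<bar> \<le> 6 * (r + 1) * \<bar>t\<bar> + 3/2 * \<bar>?p\<bar>"
    using assms(1) by (intro order.trans[OF abs_triangle_ineq]) (simp add: abs_mult)
  also have "\<dots> \<le> 3 * (r + 1) * \<bar>?p\<bar> + 3/2 * \<bar>?p\<bar>"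
    using mult_left_mono[OF tp, of "3 * (r + 1)"] assms(1) by (simp add: algebra_simps)
  also have "\<dots> \<le> (6 * r + 9/2) * \<bar>?p\<bar>" using assms(1) by (simp add: algebra_simps)
  \<comment> \<open>The square of the left side exceeds \<open>p^2 * (18 * r + 45/4)\<close> by
    exactly \<open>(6 * r + 3)^2 * p^2\<close>, and \<open>p^2 \<le> 1\<close>.\<close>
  also have "\<dots> \<le> eigS r t"
  proof (rule real_le_rsqrt)
    have "?p\<^sup>2 \<le> 1" using cheb_le_1[OF assms(2)] by (simp add: abs_square_le_1)
    then have "(6 * r + 3)\<^sup>2 * ?p\<^sup>2 \<le> (6 * r + 3)\<^sup>2 * 1" by (intro mult_left_mono) auto
    then show "((6 * r + 9/2) * \<bar>?p\<bar>)\<^sup>2 \<le> (6 * r + 3)\<^sup>2 + ?p\<^sup>2 * (18 * r + 45/4)"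
      by (simp add: power_mult_distrib) (simp add: power2_eq_square algebra_simps)
  qed
  finally show "singular_eigs r t $ 5 \<le> singular_eigs r t $ 1" "singular_eigs r t $ 2 \<le> singular_eigs r t $ 5"
    by (simp_all add: singular_eigs_nth abs_le_iff algebra_simps)
qed

text \<open>What remains of the comparison of entries 2 once everything is bounded through the sum
  \<open>k\<close> of the two angle parameters. The margin \<open>1/50\<close> enters through
  \<open>3/50\<close> and \<open>51/50\<close>.\<close>

lemma gap_polynomial:
  fixes k :: real
  assumes "0 \<le> k" "k \<le> 1"
  shows "3/2 * k * (1 - k\<^sup>2) * (5 + 5 * (3 * k - k ^ 3) + 3/50) \<le> 12 - 6 * (51/50) * (1 - k\<^sup>2)"
proof -
  \<comment> \<open>The concave function \<open>3 k - k^3\<close> lies below its tangent at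
    \<open>k = 0.56\<close>; the coefficients of the tangent are then rounded up.\<close>
  have "0 \<le> (k - 56/100)\<^sup>2 * (k + 112/100)" using assms by simp
  also have "(k - 56/100)\<^sup>2 * (k + 112/100) = k ^ 3 - 9408/10000 * k + 351232/1000000"
    by (simp add: power2_eq_square power3_eq_cube field_simps)
  finally have "3 * k - k ^ 3 \<le> 36/100 + 206/100 * k" using assms by simp
  then have "5 + 5 * (3 * k - k ^ 3) + 3/50 \<le> 686/100 + 1030/100 * k" by simp
  moreover have "0 \<le> 3/2 * k * (1 - k\<^sup>2)" using assms by (simp add: power_le_one)
  ultimately have "3/2 * k * (1 - k\<^sup>2) * (5 + 5 * (3 * k - k ^ 3) + 3/50)
    \<le> 3/2 * k * (1 - k\<^sup>2) * (686/100 + 1030/100 * k)" by (rule mult_left_mono)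
  also have "\<dots> \<le> 12 - 6 * (51/50) * (1 - k\<^sup>2)"
  proof -
    \<comment> \<open>A certificate for the remaining quartic: it is this square plus a multiple of
      the square of \<open>k - 557/1000\<close>, up to terms that are nonnegative on
      \<open>[0, 1]\<close>.\<close>
    have "0 \<le> (392/100 * k\<^sup>2 + 131/100 * k - 199/100)\<^sup>2" by simp
    also have "\<dots> = 153664/10000 * k ^ 4 + 102704/10000 * k ^ 3 - 138855/10000 * k\<^sup>2 - 52138/10000 * k + 39601/10000"
      by (simp add: power2_eq_square power3_eq_cube eval_nat_numeral field_simps)
    finally have 1: "0 \<le> 153664/10000 * k ^ 4 + 102704/10000 * k ^ 3 - 138855/10000 * k\<^sup>2 - 52138/10000 * k + 39601/10000" .
    have "0 \<le> (k - 557/1000)\<^sup>2" by simp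
    also have "\<dots> = k\<^sup>2 - 1114/1000 * k + 310249/1000000" by (simp add: power2_eq_square field_simps)
    finally have 2: "0 \<le> k\<^sup>2 - 1114/1000 * k + 310249/1000000" .
    have 3: "3/2 * k * (1 - k\<^sup>2) * (686/100 + 1030/100 * k)
      = 1029/100 * k + 1545/100 * k\<^sup>2 - 1029/100 * k ^ 3 - 1545/100 * k ^ 4"
      by (simp add: power2_eq_square power3_eq_cube eval_nat_numeral field_simps)
    have 4: "0 \<le> k ^ 3" "0 \<le> k ^ 4" using assms by simp_all
    have 5: "12 - 6 * (51/50) * (1 - k\<^sup>2) = 588/100 + 612/100 * k\<^sup>2" by (simp add: field_simps)
    show ?thesis unfolding 3 5 using 1 2 4 assms by linarith
  qed
  finally show ?thesis .
qed

text \<open>If the middle eigenvalues do not decide, then \<open>s\<close> exceeds \<open>r\<close> so much that both candidates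
  for the lowest eigenvalue decide.\<close>

lemma singular_eigs_gap:
  assumes "0 \<le> r" "0 \<le> s" "0 \<le> b" "b < a" "a \<le> 1/2"
  assumes middle: "singular_eigs r a $ 5 - singular_eigs s b $ 5 < 1/50 * (cheb a - cheb b)"
  shows "1/50 * (cheb a - cheb b) \<le> singular_eigs r a $ 2 - singular_eigs s b $ 2"
    "1/50 * (cheb a - cheb b) \<le> singular_eigs r a $ 4 - singular_eigs s b $ 4"
proof -
  define D \<tau> \<kappa> \<delta> where "D = cheb a - cheb b" and "\<tau> = a - b" and "\<kappa> = 3 - 4 * (a\<^sup>2 + a * b + b\<^sup>2)"
    and "\<delta> = s - r"
  have D: "D = \<tau> * \<kappa>" unfolding D_def \<tau>_def \<kappa>_def by (rule cheb_diff)
  have "\<tau> > 0" using assms by (simp add: \<tau>_def)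
  have sq: "b\<^sup>2 \<le> a\<^sup>2" "b\<^sup>2 \<le> a * b" "a\<^sup>2 \<le> 1/4" "0 \<le> b\<^sup>2" "a * b \<le> a\<^sup>2"
    using assms mult_mono[of b a b b] mult_mono[of a "1/2" a "1/2"] mult_mono[of b a b a] mult_mono[of a a b a]
    by (auto simp: power2_eq_square)
  have "\<kappa> = 3 - 4 * a\<^sup>2 - 4 * (a * b) - 4 * b\<^sup>2" by (simp add: \<kappa>_def)
  then have \<kappa>: "0 \<le> \<kappa>" "\<kappa> \<le> 3 - 12 * b\<^sup>2" "\<kappa> \<le> 3"
    using sq by (simp_all only:)
  \<comment> \<open>The hypothesis \<open>middle\<close>, split into the change
    \<open>\<tau>\<close> of the angle parameter and the change \<open>\<delta>\<close> of the
    radius. The factor \<open>51/50\<close> collects the margin and the term \<open>- cheb t\<close>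
    of entry 5. As \<open>\<kappa> \<le> 3\<close>, the bracket on the left is positive, which
    forces \<open>b\<close> and \<open>\<delta>\<close> to be positive.\<close>
  have m: "\<tau> * (6 * (r + 1) - 51/50 * \<kappa>) < 6 * b * \<delta>"
  proof -
    have "(r + 1) * (6 * a) - (s + 1) * (6 * b) < 51/50 * D"
      using middle by (simp add: singular_eigs_nth D_def)
    moreover have "\<tau> * (6 * (r + 1) - 51/50 * \<kappa>) - 6 * b * \<delta> = (r + 1) * (6 * a) - (s + 1) * (6 * b) - 51/50 * (\<tau> * \<kappa>)"
      by (simp add: \<tau>_def \<delta>_def algebra_simps)
    ultimately show ?thesis using D by linarith
  qed
  have "0 < 6 * (r + 1) - 51/50 * \<kappa>" using \<kappa> assms by simp
  then have "0 < 6 * b * \<delta>" using m \<open>\<tau> > 0\<close> by (meson mult_pos_pos order.strict_trans)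
  then have "b > 0" "\<delta> > 0" using assms(3) by (auto simp: zero_less_mult_iff)
  show "1/50 * (cheb a - cheb b) \<le> singular_eigs r a $ 4 - singular_eigs s b $ 4"
  proof -
    \<comment> \<open>For \<open>t = sin phi\<close> this is \<open>6 sin (phi + pi/3)\<close>, and
      entry 4 equals \<open>- (r + 1) * N t - cheb t\<close>.\<close>
    define N where "N t = 3 * t + 3 * sqrt 3 * sqrt (1 - t\<^sup>2)" for t
    have "sqrt (1 - a\<^sup>2) \<le> sqrt (1 - b\<^sup>2)" using sq by simp
    then have "3 * sqrt 3 * sqrt (1 - a\<^sup>2) \<le> 3 * sqrt 3 * sqrt (1 - b\<^sup>2)" by (intro mult_left_mono) auto
    then have N1: "N a - N b \<le> 3 * \<tau>" by (simp add: N_def \<tau>_def)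
    have "5/3 \<le> sqrt 3" by (rule real_le_rsqrt) (simp add: power2_eq_square)
    moreover have "1 - b\<^sup>2 \<le> sqrt (1 - b\<^sup>2)"
    proof (rule real_le_rsqrt)
      have "(1 - b\<^sup>2) * (1 - b\<^sup>2) \<le> 1 * (1 - b\<^sup>2)" using sq by (intro mult_right_mono) auto
      then show "(1 - b\<^sup>2)\<^sup>2 \<le> 1 - b\<^sup>2" by (simp add: power2_eq_square)
    qed
    ultimately have "5/3 * (1 - b\<^sup>2) \<le> sqrt 3 * sqrt (1 - b\<^sup>2)" using sq by (intro mult_mono) auto
    moreover have "b\<^sup>2 \<le> b * (1/2)" unfolding power2_eq_square using assms by (intro mult_left_mono) auto
    ultimately have N2: "5 \<le> N b" using \<open>b > 0\<close> by (simp add: N_def)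
    \<comment> \<open>A crude maximum suffices: after \<open>18 * b \<le> 9\<close> all that is used
      is \<open>51/50 * 17 \<le> 21\<close>.\<close>
    have "\<kappa> * (5 + 6 * b) \<le> (3 - 12 * b\<^sup>2) * (5 + 6 * b)" using \<kappa> assms by (intro mult_right_mono) auto
    also have "\<dots> \<le> 17"
    proof -
      have "0 \<le> (b - 15/100)\<^sup>2" "0 \<le> b ^ 3" using assms by simp_all
      then show ?thesis by (simp add: power2_eq_square power3_eq_cube algebra_simps)
    qed
    finally have k17: "\<kappa> * (5 + 6 * b) \<le> 17" .
    have "18 * b * (r + 1) \<le> 9 * (r + 1)" using assms by (intro mult_right_mono) auto
    then have "18 * b * (r + 1) + 6 * b * (51/50 * \<kappa>) \<le> 5 * (6 * (r + 1) - 51/50 * \<kappa>)"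
      using k17 assms(1) by (simp add: algebra_simps)
    then have "\<tau> * (18 * b * (r + 1) + 6 * b * (51/50 * \<kappa>)) \<le> \<tau> * (5 * (6 * (r + 1) - 51/50 * \<kappa>))"
      using \<open>\<tau> > 0\<close> by (intro mult_left_mono) auto
    also have "\<dots> = 5 * (\<tau> * (6 * (r + 1) - 51/50 * \<kappa>))" by (rule mult.left_commute)
    also have "\<dots> \<le> 5 * (6 * b * \<delta>)" using m by (intro mult_left_mono) auto
    finally have "6 * b * (3 * (r + 1) * \<tau> + 51/50 * D) \<le> 6 * b * (5 * \<delta>)" by (simp add: D algebra_simps)
    then have "3 * (r + 1) * \<tau> + 51/50 * D \<le> 5 * \<delta>" using \<open>b > 0\<close> by simp
    moreover have "5 * \<delta> \<le> N b * \<delta>" using N2 \<open>\<delta> > 0\<close> by (intro mult_right_mono) auto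
    moreover have "(r + 1) * (N a - N b) \<le> (r + 1) * (3 * \<tau>)" using N1 assms(1) by (intro mult_left_mono) auto
    moreover have "(r + 1) * (3 * \<tau>) = 3 * (r + 1) * \<tau>" by simp
    ultimately have "51/50 * D \<le> N b * \<delta> - (r + 1) * (N a - N b)" by linarith
    then show ?thesis by (simp add: singular_eigs_nth N_def[symmetric] D_def \<delta>_def) (simp add: N_def algebra_simps)
  qed
  show "1/50 * (cheb a - cheb b) \<le> singular_eigs r a $ 2 - singular_eigs s b $ 2"
  proof -
    \<comment> \<open>In terms of \<open>k\<close>, the quantities \<open>b\<close>,
      \<open>\<kappa>\<close> and \<open>pq\<close> are at most \<open>k / 2\<close>,
      \<open>3 * (1 - k^2)\<close> and \<open>3 * k - k^3\<close>, so that a polynomial in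
      \<open>k\<close> alone remains.\<close>
    define k pq \<sigma> where "k = a + b" and "pq = cheb a + cheb b" and "\<sigma> = r + s"
    have p: "0 \<le> cheb b" "0 \<le> cheb a" "cheb a \<le> 1" "cheb b \<le> 1"
      using cheb_mono[of b 0] cheb_mono[of a 0] cheb_le_1[of a] cheb_le_1[of b] assms by (auto simp: cheb_def)
    have k: "0 \<le> k" "k \<le> 1" "b \<le> k / 2" using assms by (auto simp: k_def)
    have k1: "\<kappa> \<le> 3 * (1 - k\<^sup>2)"
      unfolding \<kappa>_def k_def using zero_le_power2[of "a - b"] by (simp add: power2_eq_square algebra_simps)
    have "0 \<le> 3 * (a - b)\<^sup>2 * (a + b)" using assms by simp
    then have P1: "pq \<le> 3 * k - k ^ 3"
      unfolding pq_def k_def cheb_def by (simp add: power2_eq_square power3_eq_cube algebra_simps)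
    have P0: "0 \<le> pq" "pq \<le> 2" using p by (auto simp: pq_def)
    have "b * \<kappa> * (5 + 5 * pq + 3/50) \<le> (k / 2) * (3 * (1 - k\<^sup>2)) * (5 + 5 * (3 * k - k ^ 3) + 3/50)"
      using k k1 P0 P1 \<kappa> assms by (intro mult_mono) (auto simp: power_le_one)
    also have "(k / 2) * (3 * (1 - k\<^sup>2)) * (5 + 5 * (3 * k - k ^ 3) + 3/50)
      = 3/2 * k * (1 - k\<^sup>2) * (5 + 5 * (3 * k - k ^ 3) + 3/50)" by simp
    also have "\<dots> \<le> 12 - 6 * (51/50) * (1 - k\<^sup>2)" by (rule gap_polynomial[OF k(1,2)])
    also have "\<dots> \<le> 2 * (6 * (r + 1) - 51/50 * \<kappa>)" using k1 assms(1) by (simp add: field_simps)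
    finally have "\<tau> * (b * \<kappa> * (5 + 5 * pq + 3/50)) \<le> \<tau> * (2 * (6 * (r + 1) - 51/50 * \<kappa>))"
      using \<open>\<tau> > 0\<close> by (intro mult_left_mono) auto
    also have "\<dots> = 2 * (\<tau> * (6 * (r + 1) - 51/50 * \<kappa>))" by (rule mult.left_commute)
    also have "\<dots> \<le> 2 * (6 * b * \<delta>)" using m by (intro mult_left_mono) auto
    finally have "b * (D * (5 + 5 * pq + 3/50)) \<le> b * (12 * \<delta>)" by (simp add: D algebra_simps)
    then have d: "D * (5 + 5 * pq + 3/50) \<le> 12 * \<delta>" using \<open>b > 0\<close> by simp
    have D0: "0 \<le> D" using D \<open>\<tau> > 0\<close> \<kappa> by simp
    have \<sigma>0: "0 \<le> \<sigma>" "r \<le> \<sigma> / 2" using assms \<open>\<delta> > 0\<close> by (auto simp: \<sigma>_def \<delta>_def)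
    \<comment> \<open>On \<open>[0, 1]\<close> one has \<open>p^2 \<le> p\<close>; the part
      \<open>9/4\<close> of \<open>45/4\<close> is the square of \<open>3/2\<close> and is kept
      exactly.\<close>
    have Sle: "eigS r' t \<le> 6 * r' + 3 + 3/2 * cheb t" if "0 \<le> r'" "0 \<le> cheb t" "cheb t \<le> 1" for r' t
    proof (rule real_le_lsqrt)
      have "(cheb t)\<^sup>2 \<le> cheb t" using that by (simp add: power2_eq_square mult_left_le)
      then have "(cheb t)\<^sup>2 * (18 * r' + 9) \<le> cheb t * (18 * r' + 9)" using that by (intro mult_right_mono) auto
      then show "(6 * r' + 3)\<^sup>2 + (cheb t)\<^sup>2 * (18 * r' + 45/4) \<le> (6 * r' + 3 + 3/2 * cheb t)\<^sup>2"
        by (simp add: power2_eq_square algebra_simps)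
    qed (use that in auto)
    have SS: "eigS r a + eigS s b \<le> 6 * \<sigma> + 6 + 3/2 * pq"
      using Sle[OF assms(1) p(2,3)] Sle[OF assms(2) p(1,4)] unfolding \<sigma>_def pq_def distrib_left by linarith
    have "(5/2 + 1/50) * D * (eigS r a + eigS s b) \<le> (5/2 + 1/50) * D * (6 * \<sigma> + 6 + 3/2 * pq)"
      using SS D0 by (intro mult_left_mono) auto
    also have "\<dots> \<le> D * (15 * (\<sigma> + 1) + 15/4 * pq + 9/50 * (\<sigma> + 1))"
    proof -
      have "(5/2 + 1/50) * (6 * \<sigma> + 6 + 3/2 * pq) \<le> 15 * (\<sigma> + 1) + 15/4 * pq + 9/50 * (\<sigma> + 1)"
        using P0 \<sigma>0 by (simp add: field_simps)
      from mult_left_mono[OF this D0] show ?thesis by (simp only: mult.assoc mult.left_commute[of D])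
    qed
    finally have 1: "(5/2 + 1/50) * D * (eigS r a + eigS s b) \<le> D * (15 * (\<sigma> + 1) + 15/4 * pq + 9/50 * (\<sigma> + 1))" .
    have "(15 * (\<sigma> + 1) + 15/4 * pq + 9/50 * (\<sigma> + 1)) + (18 * r + 45/4) * pq \<le> 3 * (\<sigma> + 1) * (5 + 5 * pq + 3/50)"
    proof -
      have "r * pq \<le> \<sigma> / 2 * pq" using \<sigma>0 P0 by (intro mult_right_mono) auto
      moreover have "0 \<le> \<sigma> * pq" using \<sigma>0 P0 by simp
      ultimately show ?thesis by (simp add: field_simps)
    qed
    from mult_left_mono[OF this D0]
    have 2: "D * (15 * (\<sigma> + 1) + 15/4 * pq + 9/50 * (\<sigma> + 1)) + (18 * r + 45/4) * pq * D \<le> 3 * (\<sigma> + 1) * (D * (5 + 5 * pq + 3/50))"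
      by (simp add: algebra_simps)
    also have "\<dots> \<le> 3 * (\<sigma> + 1) * (12 * \<delta>)" using d \<sigma>0 by (intro mult_left_mono) auto
    also have "3 * (\<sigma> + 1) * (12 * \<delta>) = 36 * \<delta> * (\<sigma> + 1)" by simp
    finally have 3: "D * (15 * (\<sigma> + 1) + 15/4 * pq + 9/50 * (\<sigma> + 1)) \<le> 36 * \<delta> * (\<sigma> + 1) - (18 * r + 45/4) * pq * D" by (simp only: le_diff_eq)
    \<comment> \<open>The two roots are compared through the difference of their squares; the sum of
      the roots, bounded above by \<open>SS\<close>, is cancelled at the end.\<close>
    have "(eigS s b)\<^sup>2 - (eigS r a)\<^sup>2 = 36 * \<delta> * (\<sigma> + 1) + 18 * \<delta> * (cheb b)\<^sup>2 - (18 * r + 45/4) * pq * D"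
      using assms by (simp add: \<delta>_def \<sigma>_def pq_def D_def power2_eq_square field_simps)
    moreover have "(eigS s b)\<^sup>2 - (eigS r a)\<^sup>2 = (eigS s b - eigS r a) * (eigS r a + eigS s b)"
      by (simp only: power2_eq_square square_diff_square_factored mult.commute add.commute)
    moreover have "0 \<le> 18 * \<delta> * (cheb b)\<^sup>2" using \<open>\<delta> > 0\<close> by simp
    ultimately have "(5/2 + 1/50) * D * (eigS r a + eigS s b) \<le> (eigS s b - eigS r a) * (eigS r a + eigS s b)"
      using order.trans[OF 1 3] by linarith
    moreover have "0 < eigS r a + eigS s b"
    proof -
      have "0 < eigS r a" using assms(1) by (intro real_sqrt_gt_zero add_pos_nonneg) auto
      moreover have "0 \<le> eigS s b" using assms(2) by (intro real_sqrt_ge_zero add_nonneg_nonneg) auto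
      ultimately show ?thesis by (rule add_pos_nonneg)
    qed
    ultimately have "(5/2 + 1/50) * D \<le> eigS s b - eigS r a" by (simp only: mult_le_cancel_right_pos)
    then show ?thesis by (simp add: singular_eigs_nth D_def)
  qed
qed

definition cubic_ratio :: "real^5 \<Rightarrow> real" where
  "cubic_ratio x = cartan_cubic x / norm x ^ 3"

lemma singular_form_minus: "singular_form (- x) v = - singular_form x v"
  by (simp add: singular_form_def cubic_hess_simps cubic_grad_def cubic_minus algebra_simps)

lemma cheb_neg: assumes "\<bar>t\<bar> \<le> 1/2" "t < 0" shows "cheb t < 0"
proof -
  have "t\<^sup>2 \<le> 1/4" using assms(1) abs_le_square_iff[of t "1/2"] by (simp add: power2_eq_square)
  then have "t * (3 - 4 * t\<^sup>2) < 0" using assms(2) by (intro mult_neg_pos) auto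
  then show ?thesis by (simp add: cheb_def power2_eq_square power3_eq_cube algebra_simps)
qed

text \<open>Weyl's inequality is used with two dimension counts: the three upper eigenvalues at
  \<open>x\<close> against the three lower ones at \<open>y\<close>, where 3 + 3 > 5, or all five at
  \<open>x\<close> against the single lowest one at \<open>y\<close>, where 5 + 1 > 5.\<close>

lemma singular_form_gap_nonneg:
  assumes "x \<noteq> 0" "y \<noteq> 0" "cubic_ratio y < cubic_ratio x" "0 \<le> cubic_ratio x"
  obtains v where "norm v = 1" "1/50 * (cubic_ratio x - cubic_ratio y) \<le> singular_form x v - singular_form y v"
proof -
  obtain T a where T: "orthogonal_transformation T" "\<bar>a\<bar> \<le> 1/2" "cartan_cubic x = norm x ^ 3 * (3 * a - 4 * a ^ 3)"
    "\<And>v. singular_form x (T v) = (\<Sum>i\<in>UNIV. singular_eigs (norm x) a $ i * (v $ i)\<^sup>2)"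
    by (rule singular_form_eigs[OF assms(1)]) blast
  obtain T' b where T': "orthogonal_transformation T'" "\<bar>b\<bar> \<le> 1/2" "cartan_cubic y = norm y ^ 3 * (3 * b - 4 * b ^ 3)"
    "\<And>v. singular_form y (T' v) = (\<Sum>i\<in>UNIV. singular_eigs (norm y) b $ i * (v $ i)\<^sup>2)"
    by (rule singular_form_eigs[OF assms(2)]) blast
  define r s where "r = norm x" and "s = norm y"
  have rs: "0 \<le> r" "0 \<le> s" by (auto simp: r_def s_def)
  have pr: "cubic_ratio x = cheb a" "cubic_ratio y = cheb b"
    using assms(1,2) T(3) T'(3) by (simp_all add: cubic_ratio_def cheb_def)
  have "b < a" using cheb_mono[OF T'(2) T(2)] cheb_mono[OF T(2) T'(2)] assms(3) unfolding pr by linarith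
  have "0 \<le> a" using cheb_neg[OF T(2)] assms(4) pr by force
  note m1 = singular_eigs_middle[OF rs(1) T(2)] and m2 = singular_eigs_middle[OF rs(2) T'(2)]
  show ?thesis
  proof (cases "1/50 * (cheb a - cheb b) \<le> singular_eigs r a $ 5 - singular_eigs s b $ 5")
    case True
    obtain v where "norm v = 1" "singular_eigs r a $ 5 - singular_eigs s b $ 5 \<le> singular_form x v - singular_form y v"
      by (rule diag_forms_compare[OF T(1) T(4) T'(1) T'(4), of "{1,3,5}" "{2,4,5}" "singular_eigs r a $ 5" "singular_eigs s b $ 5"])
        (use m1 m2 in \<open>auto simp: r_def s_def\<close>)
    then show ?thesis using that True pr by force
  next
    case False
    \<comment> \<open>With opposite signs the middle eigenvalues would decide:
      \<open>6 * a - 6 * b\<close> is at least twice the difference of the values of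
      \<open>cheb\<close>, of which the terms \<open>- cheb\<close> take away only one.\<close>
    have "0 \<le> b"
    proof (rule ccontr)
      assume "\<not> 0 \<le> b"
      have a2: "a\<^sup>2 \<le> 1/4" "b\<^sup>2 \<le> 1/4" using T(2) T'(2) abs_le_square_iff[of a "1/2"] abs_le_square_iff[of b "1/2"] by (simp_all add: power2_eq_square)
      have "cheb a \<le> 3 * a" "3 * b \<le> cheb b"
        using \<open>0 \<le> a\<close> \<open>\<not> 0 \<le> b\<close> by (simp_all add: cheb_def power3_eq_cube mult_le_0_iff zero_le_mult_iff)
      moreover have "6 * a \<le> (r + 1) * (6 * a)" "(s + 1) * (6 * b) \<le> 6 * b"
        using rs \<open>0 \<le> a\<close> \<open>\<not> 0 \<le> b\<close> by (simp_all add: algebra_simps mult_nonneg_nonneg mult_nonpos_nonneg)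
      ultimately show False using False \<open>b < a\<close> assms(3) unfolding pr by (simp add: singular_eigs_nth)
    qed
    have g: "1/50 * (cheb a - cheb b) \<le> singular_eigs r a $ 2 - singular_eigs s b $ 2"
      "1/50 * (cheb a - cheb b) \<le> singular_eigs r a $ 4 - singular_eigs s b $ 4"
      using singular_eigs_gap[OF rs \<open>0 \<le> b\<close> \<open>b < a\<close>] T(2) False by auto
    define m m' where "m = min (singular_eigs r a $ 2) (singular_eigs r a $ 4)"
      and "m' = min (singular_eigs s b $ 2) (singular_eigs s b $ 4)"
    obtain j where j: "singular_eigs s b $ j = m'"
      unfolding m'_def by (metis min_def)
    have all: "m \<le> singular_eigs r a $ i" for i
      using exhaust_5[of i] m1 by (auto simp: m_def)
    obtain v where "norm v = 1" "m - m' \<le> singular_form x v - singular_form y v"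
      by (rule diag_forms_compare[OF T(1) T(4) T'(1) T'(4), of UNIV "{j}" m m'])
        (use all j in \<open>auto simp: r_def s_def\<close>)
    moreover have "1/50 * (cheb a - cheb b) \<le> m - m'" using g by (auto simp: m_def m'_def min_def)
    ultimately show ?thesis using that pr by force
  qed
qed

lemma cubic_ratio_minus: "cubic_ratio (- x) = - cubic_ratio x"
  by (simp add: cubic_ratio_def cubic_minus)

text \<open>The form is odd in the point, so the pair \<open>(x, y)\<close> may be replaced by
  \<open>(- y, - x)\<close>; one of the two pairs satisfies the sign condition.\<close>

lemma singular_form_gap:
  assumes "x \<noteq> 0" "y \<noteq> 0" "cubic_ratio y < cubic_ratio x"
  obtains v where "norm v = 1" "1/50 * (cubic_ratio x - cubic_ratio y) \<le> singular_form x v - singular_form y v"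
proof (cases "0 \<le> cubic_ratio x")
  case True
  then show ?thesis using singular_form_gap_nonneg[OF assms] that by blast
next
  case False
  have "- y \<noteq> 0" "- x \<noteq> 0" "cubic_ratio (- x) < cubic_ratio (- y)" "0 \<le> cubic_ratio (- y)"
    using assms False by (auto simp: cubic_ratio_minus)
  then obtain v where "norm v = 1"
    "1/50 * (cubic_ratio (- y) - cubic_ratio (- x)) \<le> singular_form (- y) v - singular_form (- x) v"
    using singular_form_gap_nonneg by blast
  then show ?thesis using that by (simp add: cubic_ratio_minus singular_form_minus)
qed

text \<open>Needed when the other point is a centre, where the form is zero by convention. The
  middle eigenvalue alone is at least \<open>p\<close>, because
  \<open>cheb a \<le> 3 * a\<close>.\<close>

lemma singular_form_pos:
  assumes "x \<noteq> 0" "0 < cubic_ratio x"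
  obtains v where "norm v = 1" "1/50 * cubic_ratio x \<le> singular_form x v"
proof -
  obtain T a where T: "orthogonal_transformation T" "\<bar>a\<bar> \<le> 1/2" "cartan_cubic x = norm x ^ 3 * (3 * a - 4 * a ^ 3)"
    "\<And>v. singular_form x (T v) = (\<Sum>i\<in>UNIV. singular_eigs (norm x) a $ i * (v $ i)\<^sup>2)"
    by (rule singular_form_eigs[OF assms(1)]) blast
  have pr: "cubic_ratio x = cheb a" using assms(1) T(3) by (simp add: cubic_ratio_def cheb_def)
  have "0 \<le> a" using cheb_neg[OF T(2)] assms(2) pr by force
  have "cheb a \<le> 3 * a" using \<open>0 \<le> a\<close> by (simp add: cheb_def)
  moreover have "6 * a \<le> (norm x + 1) * (6 * a)" using \<open>0 \<le> a\<close> by (simp add: algebra_simps)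
  moreover have "singular_form x (T (axis 5 1)) = singular_eigs (norm x) a $ 5"
    unfolding T(4) sum_5 by (simp add: axis_def)
  ultimately have "1/50 * cubic_ratio x \<le> singular_form x (T (axis 5 1))"
    using assms(2) unfolding pr singular_eigs_nth by linarith
  moreover have "norm (T (axis 5 1)) = 1" using orthogonal_transformation_norm[OF T(1)] by (simp add: norm_axis_1)
  ultimately show ?thesis using that by blast
qed

section \<open>The model singularity\<close>

lemma differentiable_bound_grad:
  fixes f :: "real^'n \<Rightarrow> real"
  assumes "convex S" "\<And>x. x \<in> S \<Longrightarrow> f differentiable (at x)" "\<And>x. x \<in> S \<Longrightarrow> norm (grad f x) \<le> B" "x \<in> S" "y \<in> S"
  shows "\<bar>f x - f y\<bar> \<le> B * norm (x - y)"
proof -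
  have "norm (f x - f y) \<le> B * norm (x - y)"
  proof (rule differentiable_bound[OF assms(1) _ _ assms(4,5)])
    show "(f has_derivative (\<lambda>h. grad f x \<bullet> h)) (at x within S)" if "x \<in> S" for x
      using grad_has_derivative[OF assms(2)[OF that]] has_derivative_at_withinI by blast
    show "onorm (\<lambda>h. grad f x \<bullet> h) \<le> B" if "x \<in> S" for x
      using assms(3)[OF that]
      by (intro onorm_le) (smt (verit) Cauchy_Schwarz_ineq2 mult_right_mono norm_ge_zero real_norm_def)
  qed
  then show ?thesis by simp
qed

lemma hessian_entry:
  assumes "grad f differentiable (at x)"
  shows "hessian f x $ i $ j = grad (\<lambda>y. grad f y $ i) x $ j"
proof -
  obtain D where D: "(grad f has_derivative D) (at x)" using assms differentiable_def by blast
  have "((\<lambda>y. grad f y $ i) has_derivative (\<lambda>h. D h $ i)) (at x)"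
    by (rule bounded_linear.has_derivative[OF bounded_linear_vec_nth D])
  then have "frechet_derivative (\<lambda>y. grad f y $ i) (at x) = (\<lambda>h. D h $ i)"
    using frechet_derivative_at by metis
  then show ?thesis
    using frechet_derivative_at[OF D] by (simp add: hessian_def matrix_def grad_def[of "\<lambda>y. grad f y $ i"])
qed

lemma Ck_2_imp_grad_differentiable:
  assumes "Ck_on (Suc (Suc k)) U f" "x \<in> U"
  shows "grad f differentiable (at x)"
proof -
  have "(\<lambda>y. grad f y $ i) differentiable (at x)" for i using assms by simp
  then show ?thesis by (subst differentiable_componentwise_within) (auto simp: Basis_vec_def inner_axis)
qed

lemma Ck_grad_continuous:
  assumes "Ck_on (Suc k) U f"
  shows "continuous_on U (grad f)"
proof -
  have "continuous_on U (\<lambda>x. grad f x $ i)" for i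
  proof -
    have "Ck_on k U (\<lambda>x. grad f x $ i)" using assms by simp
    moreover have "Ck_on k U g \<Longrightarrow> continuous_on U g" for g
      by (induction k) (simp, blast dest: Ck_on_Suc_D)
    ultimately show ?thesis by blast
  qed
  then have "continuous_on U (\<lambda>x. \<chi> i. grad f x $ i)" by (intro continuous_on_vec_lambda)
  then show ?thesis by simp
qed

text \<open>A pair with only one point away from the origin is included: if that pair is not close, then
  boundedness suffices.\<close>

lemma lipschitz_away_from_center:
  fixes f :: "real^'n \<Rightarrow> real"
  assumes C1: "Ck_on 1 (- {0}) f" and C: "\<And>x. \<bar>f x\<bar> \<le> C" and supp: "\<And>x. 3/4 < norm x \<Longrightarrow> f x = 0"
  obtains L where "\<And>x y. 1/2 \<le> norm x \<or> 1/2 \<le> norm y \<Longrightarrow> \<bar>f x - f y\<bar> \<le> L * norm (x - y)"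
proof -
  let ?A = "cball 0 1 - ball 0 (1/4) :: (real^'n) set"
  have "compact ?A" by (simp add: compact_diff)
  moreover have "continuous_on ?A (grad f)"
    using Ck_grad_continuous[of 0 "- {0}" f] C1 by (auto intro: continuous_on_subset)
  ultimately have "bounded (grad f ` ?A)" using compact_continuous_image compact_imp_bounded by blast
  then obtain B where B: "\<And>x. x \<in> ?A \<Longrightarrow> norm (grad f x) \<le> B"
    unfolding bounded_iff by blast
  have B': "norm (grad f x) \<le> max B 0" if "1/4 \<le> norm x" for x
  proof (cases "norm x \<le> 1")
    case True then show ?thesis using B[of x] that by (simp add: le_max_iff_disj)
  next
    case False
    have "open (- cball 0 (3/4) :: (real^'n) set)" by (simp add: open_Compl)
    then have "grad f x = grad (\<lambda>_. 0) x"
      by (rule grad_cong) (use False supp in auto)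
    also have "\<dots> = 0" by (rule grad_eqI) simp
    finally show ?thesis by simp
  qed
  \<comment> \<open>The summand \<open>8 * C\<close> covers pairs at distance at least
    \<open>1/4\<close>, where the difference is at most \<open>2 * C\<close>. Closer pairs stay
    outside \<open>ball 0 (1/4)\<close>, where the gradient is bounded.\<close>
  define L where "L = max B 0 + 8 * C"
  have C0: "0 \<le> C" using C[of 0] by simp
  have main: "\<bar>f x - f y\<bar> \<le> L * norm (x - y)" if x: "1/2 \<le> norm x" for x y
  proof (cases "norm (x - y) < 1/4")
    case True
    have *: "1/4 \<le> norm z" if "z \<in> ball x (1/4)" for z
      using that x norm_triangle_ineq2[of x "x - z"] by (simp add: dist_norm)
    have "\<bar>f x - f y\<bar> \<le> max B 0 * norm (x - y)"
    proof (rule differentiable_bound_grad[of "ball x (1/4)"])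
      show "f differentiable (at z)" if "z \<in> ball x (1/4)" for z
        using C1 *[OF that] by force
      show "norm (grad f z) \<le> max B 0" if "z \<in> ball x (1/4)" for z using B' * that by blast
    qed (use True in \<open>auto simp: dist_norm\<close>)
    also have "\<dots> \<le> L * norm (x - y)" using C0 by (intro mult_right_mono) (auto simp: L_def)
    finally show ?thesis .
  next
    case False
    have "\<bar>f x - f y\<bar> \<le> 2 * C" using C[of x] C[of y] by linarith
    also have "\<dots> \<le> 8 * C * norm (x - y)" using mult_left_mono[of "1/4" "norm (x - y)" "8 * C"] False C0 by simp
    also have "\<dots> \<le> L * norm (x - y)" by (intro mult_right_mono) (auto simp: L_def)
    finally show ?thesis .
  qed
  show ?thesis
    by (rule that[of L]) (metis main abs_minus_commute norm_minus_commute)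
qed

text \<open>The mean value inequality applies on segments avoiding the origin. A segment ending at
  the origin is a limit of such segments, by continuity, and one passing through it splits into two
  without loss.\<close>

lemma lipschitz_through_center:
  fixes f :: "real^'n \<Rightarrow> real"
  assumes diff: "\<And>x. x \<noteq> 0 \<Longrightarrow> f differentiable (at x)" and B: "\<And>x. x \<noteq> 0 \<Longrightarrow> norm (grad f x) \<le> B"
    and cont: "isCont f 0"
  shows "\<bar>f x - f y\<bar> \<le> B * norm (x - y)"
proof -
  have seg: "\<bar>f x - f y\<bar> \<le> B * norm (x - y)" if "0 \<notin> closed_segment x y" for x y
    by (rule differentiable_bound_grad[of "closed_segment x y"]) (use that diff B in \<open>metis convex_closed_segment ends_in_segment\<close>)+
  have zero: "\<bar>f x - f 0\<bar> \<le> B * norm x" for x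
  proof (cases "x = 0")
    case False
    have "((\<lambda>e. \<bar>f x - f (e *\<^sub>R x)\<bar>) \<longlongrightarrow> \<bar>f x - f (0 *\<^sub>R x)\<bar>) (at_right 0)"
      using cont by (intro tendsto_intros isCont_tendsto_compose[of _ f]) auto
    moreover have "((\<lambda>e. B * norm (x - e *\<^sub>R x)) \<longlongrightarrow> B * norm (x - 0 *\<^sub>R x)) (at_right 0)"
      by (intro tendsto_intros)
    moreover have "\<forall>\<^sub>F e in at_right (0::real). \<bar>f x - f (e *\<^sub>R x)\<bar> \<le> B * norm (x - e *\<^sub>R x)"
    proof (rule eventually_at_rightI[of 0 1])
      fix e :: real assume e: "e \<in> {0<..<1}"
      have "0 \<notin> closed_segment x (e *\<^sub>R x)"
      proof
        assume "0 \<in> closed_segment x (e *\<^sub>R x)"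
        then obtain u where u: "0 \<le> u" "u \<le> 1" "0 = ((1 - u) + u * e) *\<^sub>R x"
          by (auto simp: closed_segment_def scaleR_left_distrib)
        then have "(1 - u) + u * e = 0" using False by simp
        moreover have "0 \<le> u * e" "0 \<le> 1 - u" using u e by auto
        ultimately have "1 - u = 0" "u * e = 0" by linarith+
        then show False using e by auto
      qed
      then show "\<bar>f x - f (e *\<^sub>R x)\<bar> \<le> B * norm (x - e *\<^sub>R x)" by (rule seg)
    qed simp
    ultimately show ?thesis using tendsto_le[OF trivial_limit_at_right_real] by fastforce
  qed simp
  show ?thesis
  proof (cases "0 \<in> closed_segment x y")
    case True
    then have "dist x y = dist x 0 + dist 0 y" by (metis between between_mem_segment)
    then have "norm (x - y) = norm x + norm y" by (simp add: dist_norm)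
    then have "B * norm (x - y) = B * norm x + B * norm y" by (simp add: distrib_left)
    then show ?thesis using zero[of x] zero[of y] by linarith
  qed (rule seg)
qed

text \<open>The argument is a squared norm: the thresholds \<open>1/4\<close> and \<open>1/2\<close>
  are the norms 1/2 and 1/sqrt 2, the latter below \<open>3/4\<close>. The reciprocal is written as
  a real power so that \<open>Ck_on_powr\<close> applies to it.\<close>

definition cutoff :: "real \<Rightarrow> real" where
  "cutoff s = flat_bump 0 (1/2 - s) * (flat_bump 0 (1/2 - s) + flat_bump 0 (s - 1/4)) powr (- 1)"

lemma cutoff_eq_1: "s \<le> 1/4 \<Longrightarrow> cutoff s = 1"
  by (simp add: cutoff_def flat_bump_def powr_minus)

lemma cutoff_eq_0: "1/2 \<le> s \<Longrightarrow> cutoff s = 0"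
  by (simp add: cutoff_def flat_bump_def)

definition model :: "real^5 \<Rightarrow> real" where
  "model x = cutoff (x \<bullet> x) * (cartan_cubic x * (x \<bullet> x) powr (- 1/2))"

lemma Ck_on_inner_self: "open U \<Longrightarrow> Ck_on k U (\<lambda>x :: real^'n. x \<bullet> x)"
  unfolding inner_vec_def by (auto intro!: Ck_on_sum Ck_on_mult Ck_on_nth)

lemma Ck_on_divide_const: "open U \<Longrightarrow> Ck_on k U f \<Longrightarrow> Ck_on k U (\<lambda>x. f x / c)"
  unfolding divide_inverse by (intro Ck_on_mult Ck_on_const)

lemma Ck_on_cubic: "open U \<Longrightarrow> Ck_on k U cartan_cubic"
  unfolding cartan_cubic_def[abs_def]
  by (intro Ck_on_add Ck_on_mult Ck_on_diff Ck_on_power Ck_on_divide_const Ck_on_const Ck_on_nth)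

lemma Ck_on_powr:
  assumes "open U" "Ck_on k U f" "\<And>x. x \<in> U \<Longrightarrow> 0 < f x"
  shows "Ck_on k U (\<lambda>x. f x powr s)"
proof -
  have "Ck_on k U (\<lambda>x. 1 * f x powr s)"
    by (rule Ck_on_compose[OF assms(1) Ck_real_on_powr assms(2)]) (use assms(3) in auto)
  then show ?thesis by simp
qed

lemma Ck_on_flat_bump: "open U \<Longrightarrow> Ck_on k U f \<Longrightarrow> Ck_on k U (\<lambda>x. flat_bump n (f x))"
  by (rule Ck_on_compose[OF _ Ck_real_on_flat_bump]) auto

lemma Ck_on_model: "Ck_on k (- {0}) model"
proof -
  have o: "open (- {0 :: real^5})" by (simp add: open_Compl)
  have "0 < flat_bump 0 (1/2 - s) + flat_bump 0 (s - 1/4)" for s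
    by (auto simp: flat_bump_def intro: add_pos_pos)
  then show ?thesis
    unfolding model_def[abs_def] cutoff_def
    by (intro Ck_on_mult Ck_on_flat_bump Ck_on_add Ck_on_diff Ck_on_const Ck_on_inner_self Ck_on_powr Ck_on_cubic o)
      auto
qed

lemma model_zero: "3/4 < norm x \<Longrightarrow> model x = 0"
proof -
  assume "3/4 < norm x"
  then have "(3/4)\<^sup>2 \<le> (norm x)\<^sup>2" by (intro power_mono) auto
  then have "1/2 \<le> x \<bullet> x" by (simp add: power2_norm_eq_inner power_divide)
  then show ?thesis by (simp add: model_def cutoff_eq_0)
qed

lemma model_near_0: "norm x < 1/2 \<Longrightarrow> model x = cartan_cubic x / norm x"
proof -
  assume "norm x < 1/2"
  then have "(norm x)\<^sup>2 \<le> (1/2)\<^sup>2" by (intro power_mono) auto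
  then have "cutoff (x \<bullet> x) = 1" by (intro cutoff_eq_1) (simp add: power2_norm_eq_inner power_divide)
  moreover have "(x \<bullet> x) powr (- 1/2) = 1 / norm x"
    by (simp add: powr_minus powr_half_sqrt norm_eq_sqrt_inner inverse_eq_divide flip: minus_divide_left)
  ultimately show ?thesis by (simp add: model_def)
qed

lemma model_minus: "model (- x) = - model x"
  by (simp add: model_def cubic_minus)

text \<open>The gradient of \<open>P/|x|\<close>; \<open>model_hess\<close> is the corresponding
  Hessian, applied to a vector.\<close>

definition model_grad :: "real^5 \<Rightarrow> real^5" where
  "model_grad x = (1 / norm x) *\<^sub>R cubic_grad x - (cartan_cubic x / norm x ^ 3) *\<^sub>R x"

definition model_hess :: "real^5 \<Rightarrow> real^5 \<Rightarrow> real^5" where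
  "model_hess x v = (1 / norm x) *\<^sub>R cubic_hess x v - ((x \<bullet> v) / norm x ^ 3) *\<^sub>R cubic_grad x
     - ((cubic_grad x \<bullet> v) / norm x ^ 3) *\<^sub>R x + (3 * cartan_cubic x * (x \<bullet> v) / norm x ^ 5) *\<^sub>R x
     - (cartan_cubic x / norm x ^ 3) *\<^sub>R v"

lemma model_hess_form: "(cubic_hess x v + model_hess x v) \<bullet> v = singular_form x v"
  unfolding model_hess_def singular_form_def power2_norm_eq_inner
  by (simp add: inner_add_left inner_diff_left power2_eq_square algebra_simps add_divide_distrib)

lemma inverse_norm_has_derivative:
  fixes x :: "'a::real_inner"
  assumes "x \<noteq> 0"
  shows "((\<lambda>x. inverse (norm x)) has_derivative (\<lambda>h. - ((x \<bullet> h) / norm x ^ 3))) (at x)"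
  by (rule derivative_eq_intros has_derivative_norm refl assms ext | simp add: assms)+
    (use assms in \<open>simp add: sgn_div_norm inner_commute field_simps eval_nat_numeral\<close>)

lemma quotient_has_derivative:
  assumes "x \<noteq> 0"
  shows "((\<lambda>x. cartan_cubic x / norm x) has_derivative (\<lambda>h. model_grad x \<bullet> h)) (at x)"
  unfolding divide_inverse
  by (rule has_derivative_eq_rhs[OF has_derivative_mult[OF cubic_has_derivative inverse_norm_has_derivative[OF assms]]])
    (simp add: model_grad_def fun_eq_iff inner_diff_left divide_inverse algebra_simps)

lemma model_grad_has_derivative:
  assumes "x \<noteq> 0"
  shows "(model_grad has_derivative model_hess x) (at x)"
proof -
  note i = inverse_norm_has_derivative[OF assms]
  have c: "((\<lambda>x. cartan_cubic x * inverse (norm x) ^ 3) has_derivative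
    (\<lambda>h. (cubic_grad x \<bullet> h) / norm x ^ 3 - 3 * cartan_cubic x * (x \<bullet> h) / norm x ^ 5)) (at x)"
    by (rule has_derivative_eq_rhs[OF has_derivative_mult[OF cubic_has_derivative has_derivative_power[OF i]]])
      (use assms in \<open>simp add: fun_eq_iff field_simps eval_nat_numeral\<close>)
  have "((\<lambda>x. inverse (norm x) *\<^sub>R cubic_grad x - (cartan_cubic x * inverse (norm x) ^ 3) *\<^sub>R x) has_derivative model_hess x) (at x)"
    by (rule has_derivative_eq_rhs[OF has_derivative_diff[OF has_derivative_scaleR[OF i cubic_grad_has_derivative]
      has_derivative_scaleR[OF c has_derivative_ident]]])
      (simp add: model_hess_def fun_eq_iff algebra_simps divide_inverse power_inverse)
  moreover have "(\<lambda>x. inverse (norm x) *\<^sub>R cubic_grad x - (cartan_cubic x * inverse (norm x) ^ 3) *\<^sub>R x) = model_grad"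
    by (rule ext) (simp only: model_grad_def divide_inverse power_inverse mult_1_left)
  ultimately show ?thesis by simp
qed

lemma cubic_hess_bound:
  obtains C where "0 < C" "\<And>x v. norm (cubic_hess x v) \<le> C * norm x * norm v"
  using bounded_bilinear.pos_bounded[OF bounded_bilinear_cubic_hess]
  by (metis mult.assoc mult.commute)

lemma model_derivative_near_0:
  assumes "norm x < 1/2" "x \<noteq> 0"
  shows "grad model x = model_grad x" and "(grad model has_derivative model_hess x) (at x)"
proof -
  let ?U = "ball 0 (1/2) - {0 :: real^5}"
  have U: "open ?U" "x \<in> ?U" using assms by (auto simp: open_delete)
  have g: "grad model y = model_grad y" if "y \<in> ?U" for y
  proof -
    have "grad model y = grad (\<lambda>x. cartan_cubic x / norm x) y"
      by (rule grad_cong[OF U(1) that]) (simp add: model_near_0)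
    also have "\<dots> = model_grad y" using that by (intro grad_eqI quotient_has_derivative) auto
    finally show ?thesis .
  qed
  then show "grad model x = model_grad x" using U by blast
  show "(grad model has_derivative model_hess x) (at x)"
    by (rule has_derivative_transform_within_open[OF model_grad_has_derivative[OF assms(2)] U]) (simp add: g)
qed

text \<open>At the origin the Hessian does not exist. The value 0 agrees with
  \<open>model_hess 0 v = 0\<close> and with the vanishing second differences of the odd function
  \<open>model\<close>.\<close>

definition model_hessian :: "real^5 \<Rightarrow> real^5^5" where
  "model_hessian x = (if x = 0 then 0 else hessian model x)"

lemma model_grad_differentiable: "x \<noteq> 0 \<Longrightarrow> grad model differentiable (at x)"
  by (rule Ck_2_imp_grad_differentiable[OF Ck_on_model]) auto

lemma model_hessian_derivative:
  assumes "x \<noteq> 0"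
  shows "(grad model has_derivative (\<lambda>v. model_hessian x *v v)) (at x)"
proof -
  obtain D where D: "(grad model has_derivative D) (at x)"
    using model_grad_differentiable[OF assms] differentiable_def by blast
  moreover have "D = (\<lambda>v. model_hessian x *v v)"
    using hessian_mult[OF D] assms by (simp add: model_hessian_def)
  ultimately show ?thesis by simp
qed

lemma model_hessian_near_0:
  assumes "norm x < 1/2"
  shows "model_hessian x *v v = model_hess x v"
proof (cases "x = 0")
  case False
  then show ?thesis using hessian_mult[OF model_derivative_near_0(2)[OF assms False]] by (simp add: model_hessian_def)
qed (simp add: model_hessian_def model_hess_def)

text \<open>Each of the five terms is homogeneous of degree zero in \<open>x\<close>, so one
  constant serves all points.\<close>

lemma model_hess_bound:
  obtains C where "\<And>x v. norm (model_hess x v) \<le> C * norm v"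
proof -
  obtain C where C: "0 < C" "\<And>x v. norm (cubic_hess x v) \<le> C * norm x * norm v"
    by (rule cubic_hess_bound) blast
  have g: "norm (cubic_grad x) \<le> C / 2 * norm x ^ 2" for x
    using C(2)[of x x] by (simp add: cubic_grad_def power2_eq_square)
  have p: "\<bar>cartan_cubic x\<bar> \<le> C / 6 * norm x ^ 3" for x
  proof -
    have "\<bar>cubic_grad x \<bullet> x\<bar> \<le> norm (cubic_grad x) * norm x" by (rule Cauchy_Schwarz_ineq2)
    also have "\<dots> \<le> C / 2 * norm x ^ 2 * norm x" by (intro mult_right_mono g) auto
    finally show ?thesis by (simp add: cubic_grad_inner_self power2_eq_square power3_eq_cube)
  qed
  have "norm (model_hess x v) \<le> 3 * C * norm v" for x v
  proof (cases "x = 0")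
    case False
    define r where "r = norm x"
    have r: "r > 0" using False by (simp add: r_def)
    have 1: "norm ((1 / norm x) *\<^sub>R cubic_hess x v) \<le> C * norm v"
      using C(2)[of x v] r by (simp add: r_def field_simps)
    have xv: "\<bar>x \<bullet> v\<bar> \<le> r * norm v" unfolding r_def by (rule Cauchy_Schwarz_ineq2)
    have gv: "\<bar>cubic_grad x \<bullet> v\<bar> \<le> C / 2 * r ^ 2 * norm v"
      using Cauchy_Schwarz_ineq2[of "cubic_grad x" v] mult_right_mono[OF g[of x] norm_ge_zero[of v]] by (simp add: r_def)
    have "\<bar>x \<bullet> v\<bar> * norm (cubic_grad x) \<le> (r * norm v) * (C / 2 * r ^ 2)"
      using xv g[of x] r C(1) by (intro mult_mono) (auto simp: r_def)
    then have 2: "norm (((x \<bullet> v) / norm x ^ 3) *\<^sub>R cubic_grad x) \<le> C / 2 * norm v"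
      using r by (simp add: r_def[symmetric] field_simps eval_nat_numeral)
    have 3: "norm (((cubic_grad x \<bullet> v) / norm x ^ 3) *\<^sub>R x) \<le> C / 2 * norm v"
      using gv r by (simp add: r_def[symmetric] field_simps eval_nat_numeral)
    have "\<bar>cartan_cubic x\<bar> * \<bar>x \<bullet> v\<bar> \<le> (C / 6 * r ^ 3) * (r * norm v)"
      using xv p[of x] r C(1) by (intro mult_mono) (auto simp: r_def)
    then have 4: "norm ((3 * cartan_cubic x * (x \<bullet> v) / norm x ^ 5) *\<^sub>R x) \<le> C / 2 * norm v"
      using r by (simp add: r_def[symmetric] abs_mult field_simps eval_nat_numeral)
    have 5: "norm ((cartan_cubic x / norm x ^ 3) *\<^sub>R v) \<le> C / 6 * norm v"
      using mult_right_mono[OF p[of x] norm_ge_zero[of v]] r by (simp add: r_def[symmetric] field_simps)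
    have "norm (a - b - c + d - e) \<le> norm a + norm b + norm c + norm d + norm e" for a b c d e :: "real^5"
      by (smt (verit) norm_triangle_ineq norm_triangle_ineq4)
    from order.trans[OF this add_mono[OF add_mono[OF add_mono[OF add_mono[OF 1 2] 3] 4] 5]]
    have "norm (model_hess x v) \<le> C * norm v + C / 2 * norm v + C / 2 * norm v + C / 2 * norm v + C / 6 * norm v"
      unfolding model_hess_def .
    also have "\<dots> = 8/3 * (C * norm v)" by simp
    also have "\<dots> \<le> 3 * (C * norm v)" using C(1) by (intro mult_right_mono) auto
    finally show ?thesis by (simp add: mult.assoc)
  qed (use C in \<open>simp add: model_hess_def\<close>)
  then show ?thesis using that by blast
qed

lemma model_hessian_entry_Ck: "Ck_on k (- {0}) (\<lambda>x. model_hessian x $ i $ j)"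
proof -
  have "Ck_on k (- {0}) (\<lambda>x. grad (\<lambda>y. grad model y $ i) x $ j)"
    using Ck_on_model[of "Suc (Suc k)"] by simp
  then show ?thesis
    by (subst Ck_on_cong) (auto simp: open_Compl model_hessian_def hessian_entry model_grad_differentiable)
qed

lemma model_far_derivatives:
  assumes "3/4 < norm x"
  shows "grad model x = 0" "model_hessian x = 0" "model differentiable (at x)"
proof -
  let ?U = "- cball 0 (3/4) :: (real^5) set"
  have U: "open ?U" "x \<in> ?U" using assms by (auto simp: open_Compl)
  have g0: "grad (\<lambda>_. 0) y = 0" for y :: "real^5" by (rule grad_eqI) simp
  have g: "grad model y = 0" if "y \<in> ?U" for y
    using grad_cong(1)[OF U(1) that, of model "\<lambda>_. 0"] g0 that by (simp add: model_zero)
  then show "grad model x = 0" using U by blast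
  show "model differentiable (at x)"
    using grad_cong(2)[OF U, of model "\<lambda>_. 0"] by (simp add: model_zero)
  have "(grad model has_derivative (\<lambda>_. 0)) (at x)"
    by (rule has_derivative_transform_within_open[OF has_derivative_const U]) (simp add: g)
  from hessian_mult[OF this] have "hessian model x *v v = 0" for v .
  then have "hessian model x = 0" by (metis matrix_eq matrix_vector_mult_0)
  then show "model_hessian x = 0" by (simp add: model_hessian_def)
qed

text \<open>Homogeneity near the origin, compactness on an annulus, and vanishing beyond it.\<close>

lemma model_hessian_bounded:
  obtains C where "\<And>x i j. \<bar>model_hessian x $ i $ j\<bar> \<le> C"
proof -
  obtain C where C: "\<And>x v. norm (model_hess x v) \<le> C * norm v" by (rule model_hess_bound) blast
  have C0: "0 \<le> C" using C[of 0 "axis 1 1"] by (simp add: norm_axis_1) (meson norm_ge_zero order_trans)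
  let ?A = "cball 0 1 - ball 0 (1/4) :: (real^5) set"
  have "compact ?A" by (simp add: compact_diff)
  have "\<exists>B. \<forall>x\<in>?A. \<bar>model_hessian x $ i $ j\<bar> \<le> B" for i j
  proof -
    have "continuous_on ?A (\<lambda>x. model_hessian x $ i $ j)"
      using model_hessian_entry_Ck[of 0 i j] by (auto intro: continuous_on_subset)
    then have "bounded ((\<lambda>x. model_hessian x $ i $ j) ` ?A)"
      using \<open>compact ?A\<close> compact_continuous_image compact_imp_bounded by blast
    then show ?thesis unfolding bounded_iff by auto
  qed
  then obtain B where B: "\<And>i j x. x \<in> ?A \<Longrightarrow> \<bar>model_hessian x $ i $ j\<bar> \<le> B i j" by metis
  define K where "K = C + (\<Sum>i\<in>UNIV. \<Sum>j\<in>UNIV. \<bar>B i j\<bar>)"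
  have K: "\<bar>B i j\<bar> \<le> K" "C \<le> K" for i j
  proof -
    have "\<bar>B i j\<bar> \<le> (\<Sum>j\<in>UNIV. \<bar>B i j\<bar>)" by (rule member_le_sum) auto
    also have "\<dots> \<le> (\<Sum>i\<in>UNIV. \<Sum>j\<in>UNIV. \<bar>B i j\<bar>)"
      by (rule member_le_sum[where f = "\<lambda>i. \<Sum>j\<in>UNIV. \<bar>B i j\<bar>"]) (auto intro: sum_nonneg)
    finally show "\<bar>B i j\<bar> \<le> K" using C0 by (simp add: K_def)
    show "C \<le> K" by (auto simp: K_def intro!: sum_nonneg)
  qed
  have "\<bar>model_hessian x $ i $ j\<bar> \<le> K" for x i j
  proof -
    consider "norm x < 1/2" | "x \<in> ?A" | "3/4 < norm x" by (fastforce simp: not_less)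
    then show ?thesis
    proof cases
      case 1
      have "\<bar>model_hessian x $ i $ j\<bar> = \<bar>(model_hessian x *v axis j 1) $ i\<bar>"
        by (simp add: matrix_vector_mul_component inner_axis)
      also have "\<dots> \<le> norm (model_hessian x *v axis j 1)" by (rule component_le_norm_cart)
      also have "\<dots> \<le> C" using C[of x "axis j 1"] model_hessian_near_0[OF 1] by (simp add: norm_axis_1)
      finally show ?thesis using K(2) by simp
    next
      case 2 then show ?thesis using B K(1)[of i j] by (meson abs_ge_self order_trans)
    next
      case 3 then show ?thesis using model_far_derivatives(2) K(2) C0 by simp
    qed
  qed
  then show ?thesis using that by blast
qed

text \<open>Being homogeneous of degree zero near the origin, the Hessian jumps there, and no such
  bound can hold for two points close to it. Those pairs are the ones left to the eigenvalue
  gap.\<close>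

lemma model_hessian_lipschitz:
  obtains L where "0 < L"
    "\<And>x y i j. 1/2 \<le> norm x \<or> 1/2 \<le> norm y \<Longrightarrow> \<bar>model_hessian x $ i $ j - model_hessian y $ i $ j\<bar> \<le> L * norm (x - y)"
proof -
  obtain C where C: "\<And>x i j. \<bar>model_hessian x $ i $ j\<bar> \<le> C" by (rule model_hessian_bounded) blast
  have "\<exists>L. \<forall>x y. 1/2 \<le> norm x \<or> 1/2 \<le> norm y \<longrightarrow>
     \<bar>model_hessian x $ i $ j - model_hessian y $ i $ j\<bar> \<le> L * norm (x - y)" for i j
    using lipschitz_away_from_center[OF model_hessian_entry_Ck C, of i j] model_far_derivatives(2)
    by (metis zero_index)
  then obtain L where L: "\<And>i j x y. 1/2 \<le> norm x \<or> 1/2 \<le> norm y \<Longrightarrow>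
     \<bar>model_hessian x $ i $ j - model_hessian y $ i $ j\<bar> \<le> L i j * norm (x - y)" by metis
  define K where "K = 1 + (\<Sum>i\<in>UNIV. \<Sum>j\<in>UNIV. \<bar>L i j\<bar>)"
  have K: "L i j \<le> K" for i j
  proof -
    have "L i j \<le> \<bar>L i j\<bar>" by simp
    also have "\<dots> \<le> (\<Sum>j\<in>UNIV. \<bar>L i j\<bar>)" by (rule member_le_sum) auto
    also have "\<dots> \<le> (\<Sum>i\<in>UNIV. \<Sum>j\<in>UNIV. \<bar>L i j\<bar>)"
      by (rule member_le_sum[where f = "\<lambda>i. \<Sum>j\<in>UNIV. \<bar>L i j\<bar>"]) (auto intro: sum_nonneg)
    finally show "L i j \<le> K" by (simp add: K_def)
  qed
  show ?thesis
  proof (rule that[of K])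
    show "0 < K" unfolding K_def by (intro add_pos_nonneg sum_nonneg) auto
    show "\<bar>model_hessian x $ i $ j - model_hessian y $ i $ j\<bar> \<le> K * norm (x - y)"
      if "1/2 \<le> norm x \<or> 1/2 \<le> norm y" for x y i j
      using L[OF that, of i j] mult_right_mono[OF K norm_ge_zero, of i j "x - y"] by linarith
  qed
qed

lemma cubic_bound:
  obtains C where "0 < C" "\<And>x. \<bar>cartan_cubic x\<bar> \<le> C * norm x ^ 3" "\<And>x. norm (cubic_grad x) \<le> C * (norm x)\<^sup>2"
proof -
  obtain C where C: "0 < C" "\<And>x v. norm (cubic_hess x v) \<le> C * norm x * norm v"
    by (rule cubic_hess_bound) blast
  have g: "norm (cubic_grad x) \<le> C * (norm x)\<^sup>2" for x
  proof -
    have "norm (cubic_grad x) \<le> C / 2 * (norm x)\<^sup>2"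
      using C(2)[of x x] by (simp add: cubic_grad_def power2_eq_square)
    also have "\<dots> \<le> C * (norm x)\<^sup>2" using C(1) by (intro mult_right_mono) auto
    finally show ?thesis .
  qed
  have "\<bar>cartan_cubic x\<bar> \<le> C * norm x ^ 3" for x
  proof -
    have "\<bar>cartan_cubic x\<bar> \<le> \<bar>cubic_grad x \<bullet> x\<bar>" by (simp add: cubic_grad_inner_self abs_mult)
    also have "\<dots> \<le> norm (cubic_grad x) * norm x" by (rule Cauchy_Schwarz_ineq2)
    also have "\<dots> \<le> C * (norm x)\<^sup>2 * norm x" by (intro mult_right_mono g) auto
    finally show ?thesis by (simp add: power2_eq_square power3_eq_cube mult.assoc)
  qed
  with g C(1) show ?thesis using that by blast
qed

section \<open>The model and its gradient at the origin\<close>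

lemma model_differentiable_0: "(model has_derivative (\<lambda>_. 0)) (at 0)"
proof -
  obtain C where C: "0 < C" "\<And>x. \<bar>cartan_cubic x\<bar> \<le> C * norm x ^ 3" by (rule cubic_bound) blast
  have m0: "model 0 = 0" by (simp add: model_def)
  have "((\<lambda>h. model h / norm h) \<longlongrightarrow> 0) (at 0)"
  proof (rule Lim_null_comparison)
    show "\<forall>\<^sub>F h in at 0. norm (model h / norm h) \<le> C * norm h"
      unfolding eventually_at
    proof (intro exI[of _ "1/2"] conjI ballI impI)
      fix h :: "real^5" assume "h \<noteq> 0 \<and> dist h 0 < 1/2"
      then have "norm (model h / norm h) = \<bar>cartan_cubic h\<bar> / (norm h * norm h)"
        by (simp add: model_near_0)
      also have "\<dots> \<le> C * norm h" using C(2)[of h] \<open>h \<noteq> 0 \<and> dist h 0 < 1/2\<close>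
        by (simp add: field_simps power3_eq_cube)
      finally show "norm (model h / norm h) \<le> C * norm h" .
    qed simp
    show "((\<lambda>h :: real^5. C * norm h) \<longlongrightarrow> 0) (at 0)" by (auto intro!: tendsto_eq_intros)
  qed
  then have "((\<lambda>h. norm (model h / norm h)) \<longlongrightarrow> 0) (at 0)" by (rule tendsto_norm_zero)
  then show ?thesis by (simp add: has_derivative_at m0)
qed

lemma model_differentiable: "model differentiable (at x)"
  using model_differentiable_0 Ck_on_model[of 1] by (cases "x = 0") (auto simp: differentiable_def)

lemma model_grad_0: "grad model 0 = 0"
  by (rule grad_eqI) (simp add: model_differentiable_0)

lemma model_grad_bound_near_0:
  obtains C where "\<And>x. norm x < 1/2 \<Longrightarrow> norm (grad model x) \<le> C * norm x"
proof -
  obtain C where C: "0 < C" "\<And>x. \<bar>cartan_cubic x\<bar> \<le> C * norm x ^ 3" "\<And>x. norm (cubic_grad x) \<le> C * (norm x)\<^sup>2"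
    by (rule cubic_bound) blast
  have "norm (grad model x) \<le> 2 * C * norm x" if "norm x < 1/2" for x
  proof (cases "x = 0")
    case False
    have "norm (grad model x) \<le> norm ((1 / norm x) *\<^sub>R cubic_grad x) + norm ((cartan_cubic x / norm x ^ 3) *\<^sub>R x)"
      unfolding model_derivative_near_0(1)[OF that False] model_grad_def by (rule norm_triangle_ineq4)
    also have "norm ((1 / norm x) *\<^sub>R cubic_grad x) \<le> C * norm x"
      using C(3)[of x] False by (simp add: field_simps power2_eq_square)
    also have "norm ((cartan_cubic x / norm x ^ 3) *\<^sub>R x) \<le> C * norm x"
      using mult_right_mono[OF C(2)[of x] norm_ge_zero[of x]] False by (simp add: field_simps)
    finally show ?thesis by simp
  qed (simp add: model_grad_0)
  then show ?thesis using that by blast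
qed

lemma model_grad_lipschitz:
  obtains L where "0 < L" "\<And>x y. norm (grad model x - grad model y) \<le> L * norm (x - y)"
proof -
  obtain C where C: "\<And>x i j. \<bar>model_hessian x $ i $ j\<bar> \<le> C" by (rule model_hessian_bounded) blast
  obtain D where D: "\<And>x. norm x < 1/2 \<Longrightarrow> norm (grad model x) \<le> D * norm x" by (rule model_grad_bound_near_0) blast
  have "isCont (grad model) 0"
  proof -
    have "(grad model \<longlongrightarrow> 0) (at 0)"
    proof (rule Lim_null_comparison)
      show "\<forall>\<^sub>F h in at 0. norm (grad model h) \<le> D * norm h"
        unfolding eventually_at using D by (intro exI[of _ "1/2"]) auto
      show "((\<lambda>h :: real^5. D * norm h) \<longlongrightarrow> 0) (at 0)" by (auto intro!: tendsto_eq_intros)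
    qed
    then show ?thesis by (simp add: isCont_def model_grad_0)
  qed
  then have cont: "isCont (\<lambda>x. grad model x $ i) 0" for i by (intro continuous_intros)
  have comp: "\<bar>grad model x $ i - grad model y $ i\<bar> \<le> (5 * C) * norm (x - y)" for x y i
  proof (rule lipschitz_through_center[OF _ _ cont])
    show "(\<lambda>x. grad model x $ i) differentiable at x" if "x \<noteq> 0" for x
      using Ck_on_model[of 2] that by (auto simp: numeral_2_eq_2)
    show "norm (grad (\<lambda>x. grad model x $ i) x) \<le> 5 * C" if "x \<noteq> 0" for x
    proof -
      have "norm (grad (\<lambda>x. grad model x $ i) x) \<le> (\<Sum>j\<in>UNIV. \<bar>grad (\<lambda>x. grad model x $ i) x $ j\<bar>)"
        by (rule norm_le_l1_cart)
      also have "\<dots> \<le> (\<Sum>j\<in>(UNIV :: 5 set). C)"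
        using C[of x i] that by (intro sum_mono) (simp add: model_hessian_def hessian_entry model_grad_differentiable)
      finally show ?thesis by simp
    qed
  qed
  have "norm (grad model x - grad model y) \<le> (25 * C + 1) * norm (x - y)" for x y
  proof -
    have "norm (grad model x - grad model y) \<le> (\<Sum>i\<in>UNIV. \<bar>(grad model x - grad model y) $ i\<bar>)" by (rule norm_le_l1_cart)
    also have "\<dots> \<le> (\<Sum>i\<in>(UNIV :: 5 set). 5 * C * norm (x - y))" using comp by (intro sum_mono) simp
    also have "\<dots> \<le> (25 * C + 1) * norm (x - y)" by (simp add: algebra_simps)
    finally show ?thesis .
  qed
  moreover have "0 < 25 * C + 1" using C[of 0 1 1] by simp
  ultimately show ?thesis using that by blast
qed

lemma model_bounds:
  obtains C where "0 < C" "\<And>x. \<bar>model x\<bar> \<le> C" "\<And>x. norm (grad model x) \<le> C"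
proof -
  obtain L where L: "0 < L" "\<And>x y. norm (grad model x - grad model y) \<le> L * norm (x - y)"
    by (rule model_grad_lipschitz) blast
  have g: "norm (grad model x) \<le> L" for x
  proof (cases "norm x \<le> 1")
    case True
    have "norm (grad model x) \<le> L * norm x" using L(2)[of x 0] by (simp add: model_grad_0)
    also have "\<dots> \<le> L" using True L(1) by simp
    finally show ?thesis .
  next
    case False then show ?thesis using model_far_derivatives(1)[of x] L(1) by simp
  qed
  have "\<bar>model x\<bar> \<le> L" for x
  proof (cases "norm x \<le> 1")
    case True
    have "\<bar>model x - model 0\<bar> \<le> L * norm (x - 0)"
      by (rule differentiable_bound_grad[of UNIV]) (auto simp: g model_differentiable)
    also have "\<dots> \<le> L" using True L(1) by simp
    finally show ?thesis by (simp add: model_def)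
  next
    case False then show ?thesis using model_zero[of x] L(1) by simp
  qed
  then show ?thesis using that L(1) g by blast
qed

text \<open>The gradient is even, so a linear approximation at the origin would have to vanish; but
  Euler's relation gives \<open>grad model x \<bullet> x = 2 * model x\<close>.\<close>

lemma model_grad_not_differentiable_0: "\<not> grad model differentiable (at 0)"
proof
  assume "grad model differentiable (at 0)"
  then obtain D where D: "(grad model has_derivative D) (at 0)" by (auto simp: differentiable_def)
  let ?e = "axis 1 1 :: real^5"
  have lin: "linear D" using D has_derivative_linear by blast
  \<comment> \<open>On the first axis \<open>P\<close> is \<open>t^3\<close>, so the model is
    \<open>t * |t|\<close> there, with derivative \<open>2 * |t|\<close>.\<close>
  have g: "grad model (t *\<^sub>R ?e) = \<bar>t\<bar> *\<^sub>R (2 *\<^sub>R ?e)" if "\<bar>t\<bar> < 1/2" for t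
  proof (cases "t = 0")
    case False
    have 1: "cubic_grad (t *\<^sub>R ?e) = (3 * t\<^sup>2) *\<^sub>R ?e"
      by (simp add: cubic_grad_def cubic_hess_def vec_eq_iff forall_5 axis_def power2_eq_square)
    have 2: "cartan_cubic (t *\<^sub>R ?e) = t ^ 3" by (simp add: cartan_cubic_def axis_def)
    have "grad model (t *\<^sub>R ?e) = model_grad (t *\<^sub>R ?e)"
      using that False by (intro model_derivative_near_0) (auto simp: norm_axis_1 axis_eq_0_iff)
    also have "\<dots> = (3 * t\<^sup>2 / \<bar>t\<bar> - t ^ 3 * t / \<bar>t\<bar> ^ 3) *\<^sub>R ?e"
      unfolding model_grad_def 1 2 by (simp add: norm_axis_1 scaleR_left_diff_distrib)
    also have "3 * t\<^sup>2 / \<bar>t\<bar> - t ^ 3 * t / \<bar>t\<bar> ^ 3 = 2 * \<bar>t\<bar>"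
      using False by (simp add: abs_if power2_eq_square power3_eq_cube field_simps)
    finally show ?thesis by simp
  qed (simp add: model_grad_0)
  have "((\<lambda>t::real. t *\<^sub>R ?e) has_derivative (\<lambda>h. h *\<^sub>R ?e)) (at 0)" by (auto intro!: derivative_eq_intros)
  from has_derivative_compose[OF this] D
  have "((\<lambda>t. grad model (t *\<^sub>R ?e)) has_derivative (\<lambda>h. D (h *\<^sub>R ?e))) (at 0)" by simp
  then have "((\<lambda>t. grad model (t *\<^sub>R ?e)) has_vector_derivative D ?e) (at 0)"
    by (simp add: has_vector_derivative_def linear_scale[OF lin])
  then have "((\<lambda>t. \<bar>t\<bar> *\<^sub>R (2 *\<^sub>R ?e)) has_vector_derivative D ?e) (at 0)"
    by (rule has_vector_derivative_transform_within_open[where S = "{-1/2<..<1/2}"]) (auto simp: g abs_less_iff)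
  then have "((\<lambda>t. (\<bar>t\<bar> *\<^sub>R (2 *\<^sub>R ?e)) $ 1) has_vector_derivative D ?e $ 1) (at 0)"
    by (rule bounded_linear.has_vector_derivative[OF bounded_linear_vec_nth])
  then have "((\<lambda>t. 2 * \<bar>t\<bar>) has_real_derivative D ?e $ 1) (at 0)"
    by (simp add: has_real_derivative_iff_has_vector_derivative axis_def mult.commute)
  from DERIV_cmult[OF this, of "1/2"] obtain d where "(abs has_real_derivative d) (at 0)" by auto
  then have "((\<lambda>h :: real. \<bar>h\<bar> / h) \<longlongrightarrow> d) (at 0)" by (simp add: DERIV_def)
  then have lr: "((\<lambda>h :: real. \<bar>h\<bar> / h) \<longlongrightarrow> d) (at_right 0)" "((\<lambda>h :: real. \<bar>h\<bar> / h) \<longlongrightarrow> d) (at_left 0)"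
    by (auto simp: filterlim_at_split)
  have "((\<lambda>h :: real. \<bar>h\<bar> / h) \<longlongrightarrow> 1) (at_right 0)"
    by (rule tendsto_eventually) (auto simp: eventually_at_right_field intro: exI[of _ 1])
  moreover have "((\<lambda>h :: real. \<bar>h\<bar> / h) \<longlongrightarrow> -1) (at_left 0)"
    by (rule tendsto_eventually) (auto simp: eventually_at_left_field intro: exI[of _ "-1"])
  ultimately have "d = 1" "d = -1"
    using tendsto_unique[OF trivial_limit_at_right_real lr(1)] tendsto_unique[OF trivial_limit_at_left_real lr(2)] by blast+
  then show False by simp
qed

section \<open>Elliptic operators vanishing on a family of matrices\<close>

lemma axis_form: "axis i 1 \<bullet> (M *v axis j 1) = M $ i $ j" for M :: "real^'n^'n"
  by (simp add: inner_axis' matrix_vector_mul_component inner_axis)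

lemma form_sum: "v \<bullet> (M *v v) = (\<Sum>i\<in>UNIV. \<Sum>j\<in>UNIV. v$i * v$j * M$i$j)" for M :: "real^'n^'n"
  by (simp add: inner_vec_def matrix_vector_mult_def sum_distrib_left mult_ac)

lemma trace_eq_sum_form: "trace M = (\<Sum>i\<in>UNIV. axis i 1 \<bullet> (M *v axis i 1))" for M :: "real^'n^'n"
  by (simp add: trace_def axis_form)

text \<open>Testing with the sum and the difference of two axis vectors bounds every entry by the
  mean of two diagonal ones. The dimension factor is the price for avoiding eigenvalues, and the
  origin of the factor 5 in \<open>2001 = 1 + 400 * 5\<close>.\<close>

lemma psd_form_le_trace:
  fixes N :: "real^'n^'n"
  assumes "psd N" "norm v = 1"
  shows "v \<bullet> (N *v v) \<le> CARD('n) * trace N"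
proof -
  have sym: "N$i$j = N$j$i" for i j
    using assms(1) by (metis (mono_tags, lifting) Sym_def mem_Collect_eq psd_def transpose_def vec_lambda_beta)
  have ent: "\<bar>N$i$j\<bar> \<le> (N$i$i + N$j$j) / 2" for i j
  proof -
    have "0 \<le> (axis i 1 + axis j 1) \<bullet> (N *v (axis i 1 + axis j 1))"
      "0 \<le> (axis i 1 - axis j 1) \<bullet> (N *v (axis i 1 - axis j 1))"
      using assms(1) by (auto simp: psd_def)
    then show ?thesis
      using sym[of i j]
      by (simp add: matrix_vector_right_distrib matrix_vector_mult_diff_distrib inner_add_left inner_add_right
        inner_diff_left inner_diff_right axis_form)
  qed
  have v: "\<bar>v$i\<bar> \<le> 1" for i using component_le_norm_cart[of v i] assms(2) by simp
  have "v \<bullet> (N *v v) \<le> (\<Sum>i\<in>UNIV. \<Sum>j\<in>UNIV. (N$i$i + N$j$j) / 2)"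
    unfolding form_sum
  proof (intro sum_mono)
    fix i j
    have "v$i * v$j * N$i$j \<le> \<bar>v$i * v$j\<bar> * \<bar>N$i$j\<bar>" by (metis abs_ge_self abs_mult)
    also have "\<dots> \<le> 1 * \<bar>N$i$j\<bar>" using mult_mono[OF v v, of j i] by (intro mult_right_mono) (auto simp: abs_mult)
    also have "\<dots> \<le> (N$i$i + N$j$j) / 2" using ent by simp
    finally show "v$i * v$j * N$i$j \<le> (N$i$i + N$j$j) / 2" .
  qed
  also have "\<dots> = CARD('n) * trace N"
    by (simp add: trace_def sum.distrib add_divide_distrib flip: sum_divide_distrib sum_distrib_left)
  finally show ?thesis .
qed

text \<open>The largest eigenvalue when \<open>M\<close> is symmetric; the supremum makes sense for
  every matrix.\<close>

definition max_form :: "real^'n^'n \<Rightarrow> real" where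
  "max_form M = (SUP v\<in>sphere 0 1. v \<bullet> (M *v v))"

lemma sphere_nonempty: "sphere (0 :: real^'n) 1 \<noteq> {}"
  by (auto intro!: exI[of _ "axis undefined 1"] simp: norm_axis_1)

lemma max_form_ge: "norm v = 1 \<Longrightarrow> v \<bullet> (M *v v) \<le> max_form M" for M :: "real^'n^'n"
proof -
  assume "norm v = 1"
  have "continuous_on (sphere 0 1) (\<lambda>v. v \<bullet> (M *v v))"
    by (intro continuous_intros linear_continuous_on matrix_vector_mul_bounded_linear)
  then have "bdd_above ((\<lambda>v. v \<bullet> (M *v v)) ` sphere 0 1)"
    by (intro bounded_imp_bdd_above compact_imp_bounded compact_continuous_image) auto
  then show ?thesis unfolding max_form_def by (rule cSUP_upper2) (use \<open>norm v = 1\<close> in auto)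
qed

lemma max_form_le: "(\<And>v. norm v = 1 \<Longrightarrow> v \<bullet> (M *v v) \<le> c) \<Longrightarrow> max_form M \<le> c" for M :: "real^'n^'n"
  unfolding max_form_def by (rule cSUP_least[OF sphere_nonempty]) auto

text \<open>The third property involves quadratic forms only, so that the symmetry of the Hessians of
  test functions is never needed.\<close>

lemma elliptic_operator_exists:
  fixes S :: "(real^'n^'n) set"
  assumes "S \<noteq> {}" "0 \<le> \<kappa>"
    and pair: "\<And>A B. A \<in> S \<Longrightarrow> B \<in> S \<Longrightarrow> \<exists>v. norm v = 1 \<and> 0 \<le> trace (A - B) + \<kappa> * (v \<bullet> ((A - B) *v v))"
  obtains F where "uniformly_elliptic 1 (1 + \<kappa> * CARD('n)) F" "\<And>A. A \<in> S \<Longrightarrow> F A = 0"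
    "\<And>M N. (\<And>v. 0 \<le> v \<bullet> ((M - N) *v v)) \<Longrightarrow> F N \<le> F M"
proof -
  define G where "G D = trace D + \<kappa> * max_form D" for D :: "real^'n^'n"
  define F where "F M = (INF B\<in>S. G (M - B))" for M
  have Gge: "trace D + \<kappa> * (v \<bullet> (D *v v)) \<le> G D" if "norm v = 1" for D v
    using mult_left_mono[OF max_form_ge[OF that, of D] assms(2)] by (simp add: G_def)
  obtain B0 where B0: "B0 \<in> S" using assms(1) by blast
  \<comment> \<open>Keeps the infimum in \<open>F\<close> finite: the pair hypothesis for the fixed
    matrix \<open>B0\<close> and \<open>B\<close> supplies a direction in which \<open>M - B\<close>
    is bounded below by a quantity independent of \<open>B\<close>.\<close>
  have low: "trace (M - B0) - \<kappa> * max_form (B0 - M) \<le> G (M - B)" if B: "B \<in> S" for M B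
  proof -
    obtain v where v: "norm v = 1" "0 \<le> trace (B0 - B) + \<kappa> * (v \<bullet> ((B0 - B) *v v))" using pair[OF B0 B] by blast
    have "M - B = (M - B0) + (B0 - B)" by simp
    then have "trace (M - B) + \<kappa> * (v \<bullet> ((M - B) *v v)) = (trace (M - B0) + \<kappa> * (v \<bullet> ((M - B0) *v v)))
       + (trace (B0 - B) + \<kappa> * (v \<bullet> ((B0 - B) *v v)))"
      by (simp only: trace_add matrix_vector_mult_add_rdistrib inner_add_right) (simp add: algebra_simps)
    moreover have "v \<bullet> ((M - B0) *v v) = - (v \<bullet> ((B0 - M) *v v))"
      by (simp add: matrix_vector_mult_diff_rdistrib inner_diff_right)
    moreover have "\<kappa> * (v \<bullet> ((B0 - M) *v v)) \<le> \<kappa> * max_form (B0 - M)"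
      by (rule mult_left_mono[OF max_form_ge[OF v(1)] assms(2)])
    ultimately show ?thesis using Gge[OF v(1), of "M - B"] v(2) by simp
  qed
  have bdd: "bdd_below ((\<lambda>B. G (M - B)) ` S)" for M
    by (rule bdd_belowI2) (rule low)
  have Fle: "F M \<le> G (M - B)" if "B \<in> S" for M B
    unfolding F_def by (rule cINF_lower[OF bdd that])
  have Fge: "c \<le> F M" if "\<And>B. B \<in> S \<Longrightarrow> c \<le> G (M - B)" for c M
    unfolding F_def by (rule cINF_greatest[OF assms(1) that])
  have mono: "F N \<le> F M" if "\<And>v. 0 \<le> v \<bullet> ((M - N) *v v)" for M N
  proof (rule Fge)
    fix B assume B: "B \<in> S"
    have le: "v \<bullet> ((N - B) *v v) \<le> v \<bullet> ((M - B) *v v)" for v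
      using that[of v] by (simp add: matrix_vector_mult_diff_rdistrib inner_diff_right)
    have "trace (N - B) \<le> trace (M - B)" unfolding trace_eq_sum_form by (intro sum_mono le)
    moreover have "max_form (N - B) \<le> max_form (M - B)"
      by (rule max_form_le) (use le max_form_ge order_trans in blast)
    ultimately have "G (N - B) \<le> G (M - B)" unfolding G_def by (intro add_mono mult_left_mono assms(2))
    then show "F N \<le> G (M - B)" using Fle[OF B, of N] by simp
  qed
  have F0: "F A = 0" if A: "A \<in> S" for A
  proof (rule antisym)
    have "max_form (0 :: real^'n^'n) \<le> 0" by (rule max_form_le) simp
    then have "G 0 \<le> 0" using assms(2) by (simp add: G_def trace_def mult_nonneg_nonpos)
    then show "F A \<le> 0" using Fle[OF A, of A] by simp
    show "0 \<le> F A"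
    proof (rule Fge)
      fix B assume "B \<in> S"
      then show "0 \<le> G (A - B)" using pair[OF A] Gge by (meson order_trans)
    qed
  qed
  have "uniformly_elliptic 1 (1 + \<kappa> * CARD('n)) F"
    unfolding uniformly_elliptic_def
  proof (intro conjI ballI allI impI)
    show "1 \<le> 1 + \<kappa> * real CARD('n)" using assms(2) by simp
    fix M N :: "real^'n^'n" assume N: "psd N"
    have eq: "M + N - B = (M - B) + N" for B by simp
    have f0: "0 \<le> v \<bullet> (N *v v)" for v using N by (simp add: psd_def)
    have "F M + trace N \<le> F (M + N)"
    proof (rule Fge)
      fix B assume B: "B \<in> S"
      have "max_form (M - B) \<le> max_form (M + N - B)"
      proof (rule max_form_le)
        fix v :: "real^'n" assume "norm v = 1"
        then have "v \<bullet> ((M + N - B) *v v) \<le> max_form (M + N - B)" by (rule max_form_ge)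
        then show "v \<bullet> ((M - B) *v v) \<le> max_form (M + N - B)"
          using f0[of v] unfolding eq by (simp add: matrix_vector_mult_add_rdistrib inner_add_right)
      qed
      then have "G (M - B) + trace N \<le> G (M + N - B)"
        using mult_left_mono[OF _ assms(2)] unfolding G_def eq trace_add by fastforce
      then show "F M + trace N \<le> G (M + N - B)" using Fle[OF B, of M] by simp
    qed
    then show "1 * trace N \<le> F (M + N) - F M" by simp
    have "F (M + N) - (1 + \<kappa> * CARD('n)) * trace N \<le> F M"
    proof (rule Fge)
      fix B assume B: "B \<in> S"
      have "max_form (M + N - B) \<le> max_form (M - B) + CARD('n) * trace N"
      proof (rule max_form_le)
        fix v :: "real^'n" assume v: "norm v = 1"
        show "v \<bullet> ((M + N - B) *v v) \<le> max_form (M - B) + CARD('n) * trace N"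
          using max_form_ge[OF v, of "M - B"] psd_form_le_trace[OF N v] unfolding eq
          by (simp add: matrix_vector_mult_add_rdistrib inner_add_right)
      qed
      from mult_left_mono[OF this assms(2)]
      have "G (M + N - B) \<le> G (M - B) + (1 + \<kappa> * CARD('n)) * trace N"
        unfolding G_def eq trace_add by (simp add: algebra_simps)
      then show "F (M + N) - (1 + \<kappa> * CARD('n)) * trace N \<le> G (M - B)" using Fle[OF B, of "M + N"] by simp
    qed
    then show "F (M + N) - F M \<le> (1 + \<kappa> * CARD('n)) * trace N" by simp
  qed simp
  then show ?thesis using that F0 mono by blast
qed

section \<open>The second-derivative test\<close>

lemma twice_differentiable_imp_derivative:
  assumes "twice_differentiable_at f x"
  shows "(grad f has_derivative (\<lambda>v. hessian f x *v v)) (at x)"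
proof -
  obtain D where D: "(grad f has_derivative D) (at x)"
    using assms unfolding twice_differentiable_at_def differentiable_def by blast
  then have "D = (\<lambda>v. hessian f x *v v)" using hessian_mult[OF D] by auto
  then show ?thesis using D by simp
qed

lemma twice_differentiableI:
  assumes "\<forall>\<^sub>F y in nhds x. f differentiable (at y)" "(grad f has_derivative (\<lambda>v. H *v v)) (at x)"
  shows "twice_differentiable_at f x" "hessian f x = H"
  using assms hessian_mult[OF assms(2)] by (auto simp: twice_differentiable_at_def differentiable_def matrix_eq)

lemma twice_differentiable_diff:
  assumes "twice_differentiable_at f x" "twice_differentiable_at g x"
  shows "twice_differentiable_at (\<lambda>y. f y - g y) x" "hessian (\<lambda>y. f y - g y) x = hessian f x - hessian g x"
proof -
  have ev: "\<forall>\<^sub>F y in nhds x. f differentiable (at y) \<and> g differentiable (at y)"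
    using assms by (auto simp: twice_differentiable_at_def eventually_conj_iff)
  then obtain U where U: "open U" "x \<in> U" "\<And>y. y \<in> U \<Longrightarrow> f differentiable (at y) \<and> g differentiable (at y)"
    unfolding eventually_nhds by blast
  have g: "grad (\<lambda>y. f y - g y) y = grad f y - grad g y" if "y \<in> U" for y
    by (rule grad_eqI) (use U(3)[OF that] in \<open>auto intro!: derivative_eq_intros grad_has_derivative simp: inner_diff_left\<close>)
  have "((\<lambda>y. grad f y - grad g y) has_derivative (\<lambda>v. hessian f x *v v - hessian g x *v v)) (at x)"
    by (intro has_derivative_diff twice_differentiable_imp_derivative assms)
  from has_derivative_transform_within_open[OF this U(1,2)]
  have "(grad (\<lambda>y. f y - g y) has_derivative (\<lambda>v. (hessian f x - hessian g x) *v v)) (at x)"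
    by (simp add: g matrix_vector_mult_diff_rdistrib)
  moreover have "\<forall>\<^sub>F y in nhds x. (\<lambda>y. f y - g y) differentiable (at y)"
    using ev by eventually_elim (auto intro: differentiable_diff)
  ultimately show "twice_differentiable_at (\<lambda>y. f y - g y) x" "hessian (\<lambda>y. f y - g y) x = hessian f x - hessian g x"
    using twice_differentiableI by blast+
qed

lemma C2_near_twice_differentiable:
  assumes "C2_near f x"
  shows "twice_differentiable_at f x"
proof -
  obtain U where U: "open U" "x \<in> U" "Ck_on (Suc (Suc 0)) U f"
    using assms by (auto simp: C2_near_def numeral_2_eq_2)
  then have "\<forall>\<^sub>F y in nhds x. f differentiable (at y)"
    unfolding eventually_nhds by (intro exI[of _ U]) auto
  then show ?thesis
    using Ck_2_imp_grad_differentiable[OF U(3,2)] by (simp add: twice_differentiable_at_def)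
qed

text \<open>Testing with second differences also covers the singular points, where the solution is an
  odd function up to a quadratic polynomial.\<close>

lemma second_difference_test:
  fixes f :: "real^'n \<Rightarrow> real"
  assumes "twice_differentiable_at f x" "\<forall>\<^sub>F h in nhds 0. 2 * f x \<le> f (x + h) + f (x - h)"
  shows "0 \<le> v \<bullet> (hessian f x *v v)"
proof (rule ccontr)
  assume "\<not> ?thesis"
  then have neg: "v \<bullet> (hessian f x *v v) < 0" by simp
  \<comment> \<open>The derivative of the function \<open>t -> f (x + t v) + f (x - t v)\<close>. It
    vanishes at 0, where its slope is twice the value of the form; a negative slope would make that
    function decrease to the right of 0.\<close>
  define q where "q t = (grad f (x + t *\<^sub>R v) - grad f (x - t *\<^sub>R v)) \<bullet> v" for t :: real
  note D = twice_differentiable_imp_derivative[OF assms(1)]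
  have "((\<lambda>t. grad f (x + t *\<^sub>R v)) has_derivative (\<lambda>t. hessian f x *v (t *\<^sub>R v))) (at 0)"
    by (rule has_derivative_compose[of "\<lambda>t. x + t *\<^sub>R v" "\<lambda>t. t *\<^sub>R v" 0 UNIV "grad f"])
      (auto intro!: derivative_eq_intros simp: D)
  moreover have "((\<lambda>t. grad f (x - t *\<^sub>R v)) has_derivative (\<lambda>t. hessian f x *v (- (t *\<^sub>R v)))) (at 0)"
    by (rule has_derivative_compose[of "\<lambda>t. x - t *\<^sub>R v" "\<lambda>t. - (t *\<^sub>R v)" 0 UNIV "grad f"])
      (auto intro!: derivative_eq_intros simp: D)
  ultimately have "(q has_derivative (\<lambda>t. (hessian f x *v (t *\<^sub>R v) - hessian f x *v (- (t *\<^sub>R v))) \<bullet> v)) (at 0)"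
    unfolding q_def by (intro has_derivative_inner_left has_derivative_diff)
  moreover have "(hessian f x *v (t *\<^sub>R v) - hessian f x *v (- (t *\<^sub>R v))) \<bullet> v = (2 * (v \<bullet> (hessian f x *v v))) * t" for t
  proof -
    have "hessian f x *v (- (t *\<^sub>R v)) = - (t *\<^sub>R (hessian f x *v v))"
      using matrix_vector_mult_scaleR[of "hessian f x" "- t" v] by simp
    then show ?thesis
      by (simp only: matrix_vector_mult_scaleR diff_minus_eq_add inner_add_left inner_scaleR_left inner_commute[of v]) simp
  qed
  ultimately have "(q has_real_derivative 2 * (v \<bullet> (hessian f x *v v))) (at 0)"
    by (simp add: has_field_derivative_def)
  then obtain d where d: "d > 0" "\<And>h. 0 < h \<Longrightarrow> h < d \<Longrightarrow> q h < 0"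
    using DERIV_neg_dec_right[of q _ 0] neg by (force simp: q_def)
  obtain e where e: "e > 0" "\<And>y. dist y x < e \<Longrightarrow> f differentiable (at y)"
    using assms(1) unfolding twice_differentiable_at_def eventually_nhds_metric by blast
  obtain e' where e': "e' > 0" "\<And>h. norm h < e' \<Longrightarrow> 2 * f x \<le> f (x + h) + f (x - h)"
    using assms(2) unfolding eventually_nhds_metric by (auto simp: dist_norm)
  have "v \<noteq> 0" using neg by auto
  define a b where "a = e / norm v" and "b = e' / norm v"
  define t where "t = min d (min a b) / 2"
  have t: "0 < t" "t < d" "t * norm v < e" "t * norm v < e'"
  proof -
    have p: "0 < a" "0 < b" using e(1) e'(1) \<open>v \<noteq> 0\<close> by (auto simp: a_def b_def)
    then show "0 < t" "t < d" using d(1) by (auto simp: t_def)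
    have "t < a" "t < b" using p d(1) by (auto simp: t_def min_def)
    then show "t * norm v < e" "t * norm v < e'" using \<open>v \<noteq> 0\<close> by (auto simp: a_def b_def field_simps)
  qed
  define k where "k s = f (x + s *\<^sub>R v) + f (x - s *\<^sub>R v)" for s :: real
  have k: "(k has_real_derivative q s) (at s)" if "0 \<le> s" "s \<le> t" for s
  proof -
    have "s * norm v \<le> t * norm v" using that by (intro mult_right_mono) auto
    then have b: "dist (x + s *\<^sub>R v) x < e" "dist (x - s *\<^sub>R v) x < e" using t(3) that by (auto simp: dist_norm)
    have "((\<lambda>s. f (x + s *\<^sub>R v)) has_derivative (\<lambda>h. grad f (x + s *\<^sub>R v) \<bullet> (h *\<^sub>R v))) (at s)"
      by (rule has_derivative_compose[of "\<lambda>s. x + s *\<^sub>R v" "\<lambda>h. h *\<^sub>R v" s UNIV f])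
        (auto intro!: derivative_eq_intros grad_has_derivative e(2) b)
    moreover have "((\<lambda>s. f (x - s *\<^sub>R v)) has_derivative (\<lambda>h. grad f (x - s *\<^sub>R v) \<bullet> (- (h *\<^sub>R v)))) (at s)"
      by (rule has_derivative_compose[of "\<lambda>s. x - s *\<^sub>R v" "\<lambda>h. - (h *\<^sub>R v)" s UNIV f])
        (auto intro!: derivative_eq_intros grad_has_derivative e(2) b)
    ultimately have "(k has_derivative (\<lambda>h. grad f (x + s *\<^sub>R v) \<bullet> (h *\<^sub>R v) + grad f (x - s *\<^sub>R v) \<bullet> (- (h *\<^sub>R v)))) (at s)"
      unfolding k_def by (rule has_derivative_add)
    then show ?thesis
      unfolding has_field_derivative_def
      by (rule has_derivative_eq_rhs) (simp add: fun_eq_iff q_def inner_diff_left algebra_simps)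
  qed
  obtain s where "0 < s" "s < t" "k t - k 0 = (t - 0) * q s" using MVT2[OF t(1), of k q] k by auto
  moreover have "q s < 0" using d(2)[of s] \<open>0 < s\<close> \<open>s < t\<close> t(2) by simp
  moreover have "k 0 \<le> k t" using e'(2)[of "t *\<^sub>R v"] t by (simp add: k_def)
  ultimately show False using mult_pos_neg[OF t(1)] by force
qed

text \<open>\<open>s\<close> is a twice differentiable substitute for \<open>u\<close>: at a regular
  point \<open>u\<close> itself, at a centre the cubic. Only second differences of \<open>u\<close>
  enter, so the touching inequality passes to \<open>\<phi> - s\<close> or
  \<open>s - \<phi>\<close>.\<close>

lemma touching_hessian:
  assumes s: "twice_differentiable_at s x"
    and us: "\<forall>\<^sub>F h in nhds 0. u (x + h) + u (x - h) - 2 * u x = s (x + h) + s (x - h) - 2 * s x"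
    and \<phi>: "C2_near \<phi> x"
  shows "touches_above \<phi> u x \<Longrightarrow> 0 \<le> v \<bullet> ((hessian \<phi> x - hessian s x) *v v)"
    and "touches_below \<phi> u x \<Longrightarrow> 0 \<le> v \<bullet> ((hessian s x - hessian \<phi> x) *v v)"
proof -
  note \<phi>2 = C2_near_twice_differentiable[OF \<phi>]
  have ev: "\<forall>\<^sub>F h in nhds 0. P (x + h) \<and> P (x - h)" if "\<forall>\<^sub>F y in nhds x. P y" for P
  proof -
    have "((\<lambda>h. x + h) \<longlongrightarrow> x + 0) (nhds 0)" "((\<lambda>h. x - h) \<longlongrightarrow> x - 0) (nhds 0)"
      by (intro tendsto_intros filterlim_ident)+
    then show ?thesis using that by (simp add: filterlim_iff eventually_conj_iff)
  qed
  show "0 \<le> v \<bullet> ((hessian \<phi> x - hessian s x) *v v)" if "touches_above \<phi> u x"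
  proof -
    have "\<forall>\<^sub>F h in nhds 0. 2 * (\<phi> x - s x) \<le> (\<phi> (x + h) - s (x + h)) + (\<phi> (x - h) - s (x - h))"
    proof -
      have "\<forall>\<^sub>F h in nhds 0. u (x + h) \<le> \<phi>(x + h) \<and> u(x - h) \<le> \<phi>(x - h)" and "\<phi> x = u x"
        using ev[of "\<lambda>y. u y \<le> \<phi> y"] that by (auto simp: touches_above_def)
      from this(1) us show ?thesis by eventually_elim (use \<open>\<phi> x = u x\<close> in auto)
    qed
    from second_difference_test[OF twice_differentiable_diff(1)[OF \<phi>2 s] this]
    show ?thesis by (simp add: twice_differentiable_diff(2)[OF \<phi>2 s])
  qed
  show "0 \<le> v \<bullet> ((hessian s x - hessian \<phi> x) *v v)" if "touches_below \<phi> u x"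
  proof -
    have "\<forall>\<^sub>F h in nhds 0. 2 * (s x - \<phi> x) \<le> (s (x + h) - \<phi> (x + h)) + (s (x - h) - \<phi> (x - h))"
    proof -
      have "\<forall>\<^sub>F h in nhds 0. \<phi>(x + h) \<le> u (x + h) \<and> \<phi>(x - h) \<le> u(x - h)" and "\<phi> x = u x"
        using ev[of "\<lambda>y. \<phi> y \<le> u y"] that by (auto simp: touches_below_def)
      from this(1) us show ?thesis by eventually_elim (use \<open>\<phi> x = u x\<close> in auto)
    qed
    from second_difference_test[OF twice_differentiable_diff(1)[OF s \<phi>2] this]
    show ?thesis by (simp add: twice_differentiable_diff(2)[OF s \<phi>2])
  qed
qed

section \<open>A discrete set accumulating exactly at a compact nowhere dense set\<close>

text \<open>Stage \<open>n\<close> covers \<open>K\<close> by finitely many balls of radius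
  \<open>1 / Suc n\<close> and picks in each a point off \<open>K\<close>, which exists because
  \<open>K\<close> has empty interior. The last clause is the uniform form of discreteness away from
  \<open>K\<close>.\<close>

lemma accumulating_set_exists:
  fixes K :: "'a::euclidean_space set"
  assumes K: "compact K" "K \<noteq> {}" "interior K = {}" and U: "open U" "K \<subseteq> U"
  obtains A where "countable A" "A \<subseteq> U - K" "{x. x islimpt A} = K"
    "\<forall>d>0. finite {a\<in>A. d \<le> infdist a K}"
proof -
  have "\<exists>B. finite B \<and> B \<subseteq> U - K \<and> (\<forall>a\<in>B. \<exists>k\<in>K. dist a k < 1 / Suc n) \<and> (\<forall>k\<in>K. \<exists>a\<in>B. dist a k < 2 / Suc n)" for n
  proof -
    let ?e = "1 / Suc n :: real"
    have "K \<subseteq> (\<Union>k\<in>K. ball k ?e)" by force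
    then obtain C where C: "C \<subseteq> K" "finite C" "K \<subseteq> (\<Union>k\<in>C. ball k ?e)"
      using compactE_image[OF K(1), of K "\<lambda>k. ball k ?e"] by auto
    have "\<exists>a. a \<in> ball k ?e \<inter> U - K" if "k \<in> C" for k
    proof (rule ccontr)
      assume "\<nexists>a. a \<in> ball k ?e \<inter> U - K"
      then have "ball k ?e \<inter> U \<subseteq> interior K" using U(1) by (intro interior_maximal) auto
      moreover have "k \<in> ball k ?e \<inter> U" using that C(1) U(2) by auto
      ultimately show False using K(3) by auto
    qed
    then obtain f where f: "\<And>k. k \<in> C \<Longrightarrow> f k \<in> ball k ?e \<inter> U - K" by metis
    have "\<exists>a\<in>f ` C. dist a k < 2 / Suc n" if kK: "k \<in> K" for k
    proof -
      obtain c where c: "c \<in> C" "dist c k < ?e" using C(3) kK by auto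
      then have "dist (f c) k < ?e + ?e" using f[OF c(1)] dist_triangle_less_add[of "f c" c ?e k ?e] by (auto simp: dist_commute)
      then show ?thesis using c(1) by auto
    qed
    moreover have "\<exists>k\<in>K. dist a k < ?e" if "a \<in> f ` C" for a
      using that f C(1) by (auto simp: dist_commute)
    ultimately show ?thesis using f C(2) by (intro exI[of _ "f ` C"]) auto
  qed
  then obtain B where B: "\<And>n. finite (B n)" "\<And>n. B n \<subseteq> U - K" "\<And>n a. a \<in> B n \<Longrightarrow> \<exists>k\<in>K. dist a k < 1 / Suc n"
    "\<And>n k. k \<in> K \<Longrightarrow> \<exists>a\<in>B n. dist a k < 2 / Suc n" by metis
  define A where "A = (\<Union>n. B n)"
  have fin: "finite {a\<in>A. d \<le> infdist a K}" if d: "0 < d" for d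
  proof -
    obtain N where N: "1 / Suc N < d" using reals_Archimedean[OF d] by (auto simp: inverse_eq_divide)
    \<comment> \<open>Stage \<open>n\<close> stays within \<open>1 / Suc n\<close> of
      \<open>K\<close>, so only finitely many stages reach distance \<open>d\<close>.\<close>
    have "{a\<in>A. d \<le> infdist a K} \<subseteq> (\<Union>n<N. B n)"
    proof
      fix a assume a: "a \<in> {a\<in>A. d \<le> infdist a K}"
      then obtain n where n: "a \<in> B n" by (auto simp: A_def)
      obtain k where "k \<in> K" "dist a k < 1 / Suc n" using B(3)[OF n] by blast
      then have "infdist a K < 1 / Suc n" using infdist_le[of k K a] by simp
      then have "1 / Suc N < 1 / Suc n" using a N by simp
      then have "n < N" by (simp add: field_simps)
      then show "a \<in> (\<Union>n<N. B n)" using n by blast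
    qed
    then show ?thesis using B(1) finite_subset by blast
  qed
  have "x \<in> K" if "x islimpt A" for x
  proof (rule ccontr)
    assume x: "x \<notin> K"
    define d where "d = infdist x K"
    have d: "d > 0" unfolding d_def using infdist_pos_not_in_closed[OF compact_imp_closed[OF K(1)] K(2) x] .
    have "ball x (d/2) \<inter> A \<subseteq> {a\<in>A. d/2 \<le> infdist a K}"
    proof
      fix a assume a: "a \<in> ball x (d/2) \<inter> A"
      have "d \<le> infdist a K + dist x a" unfolding d_def by (rule infdist_triangle)
      then show "a \<in> {a\<in>A. d/2 \<le> infdist a K}" using a by auto
    qed
    then have "finite (ball x (d/2) \<inter> A)" using fin[of "d/2"] d finite_subset by auto
    moreover have "infinite (ball x (d/2) \<inter> A)" using that d by (simp add: islimpt_eq_acc_point)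
    ultimately show False by blast
  qed
  moreover have "k islimpt A" if k: "k \<in> K" for k
    unfolding islimpt_approachable
  proof (intro allI impI)
    fix e :: real assume "0 < e"
    then obtain n where n: "1 / Suc n < e / 2" using reals_Archimedean[of "e/2"] by (auto simp: inverse_eq_divide)
    obtain a where a: "a \<in> B n" "dist a k < 2 / Suc n" using B(4)[OF k] by blast
    moreover have "2 / Suc n < e" using n by (simp add: field_simps)
    moreover have "a \<noteq> k" using a(1) B(2) k by blast
    ultimately show "\<exists>x'\<in>A. x' \<noteq> k \<and> dist x' k < e" unfolding A_def by force
  qed
  ultimately have "{x. x islimpt A} = K" by blast
  moreover have "countable A" using B(1) by (auto simp: A_def intro: countable_finite)
  moreover have "A \<subseteq> U - K" using B(2) by (auto simp: A_def)
  ultimately show ?thesis using that fin by blast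
qed

section \<open>Planting rescaled copies of the model\<close>

locale planted_singularities =
  fixes K A :: "(real^5) set" and M :: real
  assumes compact_K: "compact K" and K_nonempty: "K \<noteq> {}" and K_ball: "K \<subseteq> ball 0 1"
    and A_subset: "A \<subseteq> ball 0 1 - K" and A_limpt: "{x. x islimpt A} = K"
    and A_finite: "\<And>d. 0 < d \<Longrightarrow> finite {a\<in>A. d \<le> infdist a K}"
    and M_pos: "0 < M"
begin

definition rest :: "real^5 \<Rightarrow> (real^5) set" where
  "rest a = K \<union> (A - {a}) \<union> - ball 0 1"

text \<open>Halving the distance to \<open>rest a\<close> makes the balls of different centres
  disjoint and keeps each ball at distance at least its own radius from \<open>K\<close>.\<close>

definition rad :: "real^5 \<Rightarrow> real" where
  "rad a = infdist a (rest a) / 2"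

text \<open>The centres accumulate only at \<open>K\<close>, which belongs to the set.\<close>

lemma closed_rest: "closed (rest a)"
proof -
  have "x \<in> rest a" if "x islimpt rest a" for x
  proof -
    have "x islimpt K \<or> x islimpt (A - {a}) \<or> x islimpt (- ball 0 1)"
      using that by (auto simp: rest_def islimpt_Un)
    moreover have "x islimpt K \<Longrightarrow> x \<in> K" using compact_imp_closed[OF compact_K] closed_limpt by blast
    moreover have "x islimpt (A - {a}) \<Longrightarrow> x \<in> K" using A_limpt islimpt_subset[of x "A - {a}" A] by auto
    moreover have "x islimpt (- ball 0 1) \<Longrightarrow> x \<in> - ball 0 1"
      using closed_limpt[of "- ball (0 :: real^5) 1"] by (simp add: closed_Compl)
    ultimately show ?thesis by (auto simp: rest_def)
  qed
  then show ?thesis by (simp add: closed_limpt)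
qed

lemma rad_le_dist: "y \<in> rest a \<Longrightarrow> 2 * rad a \<le> dist a y"
  using infdist_le[of y "rest a" a] by (simp add: rad_def)

lemma rad_pos: "a \<in> A \<Longrightarrow> 0 < rad a"
proof -
  assume "a \<in> A"
  then have "a \<notin> rest a" using A_subset by (auto simp: rest_def)
  then show ?thesis
    using infdist_pos_not_in_closed[OF closed_rest] K_nonempty by (auto simp: rad_def rest_def)
qed

lemma rad_K: "k \<in> K \<Longrightarrow> 2 * rad a \<le> dist a k"
  by (rule rad_le_dist) (simp add: rest_def)

lemma rad_le_1: "a \<in> A \<Longrightarrow> rad a \<le> 1"
proof -
  assume a: "a \<in> A"
  obtain k where k: "k \<in> K" using K_nonempty by blast
  have "dist a k \<le> dist a 0 + dist 0 k" by (rule dist_triangle)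
  moreover have "dist a 0 < 1" "dist 0 k < 1" using a k A_subset K_ball by (auto simp: dist_commute)
  ultimately show ?thesis using rad_K[OF k, of a] by linarith
qed

lemma rad_in_ball: "a \<in> A \<Longrightarrow> dist a x < rad a \<Longrightarrow> x \<in> ball 0 1"
  using rad_le_dist[of x a] zero_le_dist[of a x] by (force simp: rest_def)

lemma rad_unique:
  assumes "a \<in> A" "b \<in> A" "dist a x < rad a" "dist b x < rad b"
  shows "a = b"
proof (rule ccontr)
  assume "a \<noteq> b"
  then have "2 * rad a \<le> dist a b" "2 * rad b \<le> dist b a"
    using assms by (auto intro!: rad_le_dist simp: rest_def)
  moreover have "dist a b \<le> dist a x + dist b x" by (rule dist_triangle2)
  ultimately show False using assms(3,4) by (simp add: dist_commute)
qed

lemma rad_dist_K: "dist a x < rad a \<Longrightarrow> k \<in> K \<Longrightarrow> rad a \<le> dist x k"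
  using rad_K[of k a] dist_triangle[of a k x] by linarith

lemma rad_isolates: "a \<in> A \<Longrightarrow> dist a x < rad a \<Longrightarrow> x \<in> K \<union> A \<Longrightarrow> x = a"
  using rad_unique[of a x x] rad_pos[of x] rad_K[of x a] zero_le_dist[of a x] by force

text \<open>By \<open>rad_unique\<close> the sum has at most one term.\<close>

definition patch :: "(real^5 \<Rightarrow> real^5 \<Rightarrow> 'b::real_normed_vector) \<Rightarrow> real^5 \<Rightarrow> 'b" where
  "patch f x = (\<Sum>a\<in>{a\<in>A. dist a x < rad a}. f a x)"

lemma patch_in: "a \<in> A \<Longrightarrow> dist a x < rad a \<Longrightarrow> patch f x = f a x"
proof -
  assume a: "a \<in> A" "dist a x < rad a"
  then have "{a\<in>A. dist a x < rad a} = {a}" using rad_unique by blast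
  then show ?thesis by (simp add: patch_def)
qed

lemma patch_out: "(\<And>a. a \<in> A \<Longrightarrow> rad a \<le> dist a x) \<Longrightarrow> patch f x = 0"
  unfolding patch_def by (rule sum.neutral) (auto simp: not_less[symmetric])

lemma patch_K: "x \<in> K \<Longrightarrow> patch f x = 0"
proof (rule patch_out)
  fix a assume "x \<in> K" "a \<in> A"
  then show "rad a \<le> dist a x" using rad_K[of x a] rad_pos[of a] by simp
qed

text \<open>The two points may lie in balls of different centres. Each copy is then compared with
  its own value 0 at the other point, whence the factor 2.\<close>

lemma patch_diff:
  assumes zero: "\<And>a z. a \<in> A \<Longrightarrow> rad a \<le> dist a z \<Longrightarrow> f a z = 0"
    and c: "0 \<le> c" "\<And>a. a \<in> A \<Longrightarrow> norm (f a x - f a y) \<le> c"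
  shows "norm (patch f x - patch f y) \<le> 2 * c"
proof (cases "\<exists>a\<in>A. dist a x < rad a")
  case True
  then obtain a where a: "a \<in> A" "dist a x < rad a" by blast
  show ?thesis
  proof (cases "\<exists>b\<in>A. dist b y < rad b")
    case True
    then obtain b where b: "b \<in> A" "dist b y < rad b" by blast
    show ?thesis
    proof (cases "a = b")
      case True then show ?thesis using c(1) c(2)[OF a(1)] by (simp add: patch_in[OF a] patch_in[OF b])
    next
      case False
      then have "f a y = 0" "f b x = 0" using zero a b rad_unique by (meson not_le)+
      then have "patch f x - patch f y = (f a x - f a y) + (f b x - f b y)" by (simp add: patch_in[OF a] patch_in[OF b])
      also have "norm \<dots> \<le> norm (f a x - f a y) + norm (f b x - f b y)" by (rule norm_triangle_ineq)
      finally show ?thesis using c(2)[OF a(1)] c(2)[OF b(1)] by linarith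
    qed
  next
    case False
    then have "patch f y = 0" "f a y = 0" using a zero by (auto intro!: patch_out simp: not_less)
    then show ?thesis using c(1) c(2)[OF a(1)] by (simp add: patch_in[OF a])
  qed
next
  case False
  then have x: "patch f x = 0" "\<And>a. a \<in> A \<Longrightarrow> f a x = 0" using zero by (auto intro!: patch_out simp: not_less)
  show ?thesis
  proof (cases "\<exists>b\<in>A. dist b y < rad b")
    case True
    then obtain b where b: "b \<in> A" "dist b y < rad b" by blast
    then show ?thesis using c(1) c(2)[OF b(1)] x by (simp add: patch_in[OF b])
  next
    case False
    then have "patch f y = 0" by (auto intro!: patch_out simp: not_less)
    then show ?thesis using c(1) x by simp
  qed
qed

text \<open>A point on the boundary of a ball is allowed; there is room because the model vanishes
  already beyond \<open>3/4\<close> of the radius.\<close>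

lemma clear_neighbourhood:
  assumes "x \<in> ball 0 1" "x \<notin> K" "\<And>a. a \<in> A \<Longrightarrow> rad a \<le> dist a x"
  obtains U where "open U" "x \<in> U" "U \<subseteq> ball 0 1 - K" "\<forall>a\<in>A. \<forall>y\<in>U. 3/4 * rad a < dist a y"
proof -
  define d where "d = infdist x K"
  have d: "d > 0" unfolding d_def using infdist_pos_not_in_closed[OF compact_imp_closed[OF compact_K] K_nonempty assms(2)] .
  \<comment> \<open>Centres outside \<open>B\<close> have radius below \<open>d/4\<close> and lie at
    distance at least \<open>d/2\<close> from \<open>x\<close>, so they cannot reach
    \<open>ball x (d/4)\<close>. The finitely many centres in \<open>B\<close> are cut out by closed
    balls.\<close>
  define B where "B = {a\<in>A. d/2 \<le> infdist a K}"
  have "finite B" unfolding B_def using A_finite[of "d/2"] d by simp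
  define U where "U = ball x (d/4) \<inter> ball 0 1 - (\<Union>a\<in>B. cball a (3/4 * rad a))"
  have "3/4 * rad a < dist a y" if a: "a \<in> A" and y: "y \<in> U" for a y
  proof (cases "a \<in> B")
    case True then show ?thesis using y by (auto simp: U_def)
  next
    case False
    then have "infdist a K < d/2" using a by (auto simp: B_def)
    moreover have "2 * rad a \<le> infdist a K"
      using rad_K K_nonempty by (simp add: infdist_notempty le_cINF_iff)
    moreover have "d \<le> infdist a K + dist x a" unfolding d_def by (rule infdist_triangle)
    moreover have "dist x a \<le> dist x y + dist a y" by (rule dist_triangle2)
    moreover have "dist x y < d/4" using y by (auto simp: U_def)
    ultimately show ?thesis using rad_pos[OF a] by linarith
  qed
  moreover have "open U" unfolding U_def using \<open>finite B\<close> by (intro open_Diff open_Int closed_UN) auto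
  moreover have "x \<in> U"
  proof -
    have "\<not> dist a x \<le> 3/4 * rad a" if "a \<in> A" for a using assms(3)[OF that] rad_pos[OF that] by linarith
    then show ?thesis using d assms(1) by (auto simp: U_def B_def)
  qed
  moreover have "U \<subseteq> ball 0 1 - K"
  proof -
    have "y \<notin> K" if "y \<in> U" for y
    proof
      assume "y \<in> K"
      then have "d \<le> dist x y" unfolding d_def by (rule infdist_le)
      then show False using that d by (auto simp: U_def)
    qed
    then show ?thesis by (auto simp: U_def)
  qed
  ultimately show ?thesis using that by blast
qed

end

section \<open>Regularity of the solution\<close>

lemma grad_affine:
  fixes f :: "real^'n \<Rightarrow> real"
  assumes "f differentiable (at (s *\<^sub>R (x - a)))"
  shows "((\<lambda>x. c * f (s *\<^sub>R (x - a))) has_derivative (\<lambda>h. ((c * s) *\<^sub>R grad f (s *\<^sub>R (x - a))) \<bullet> h)) (at x)"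
proof -
  have "((\<lambda>x. s *\<^sub>R (x - a)) has_derivative (\<lambda>h. s *\<^sub>R h)) (at x)" by (auto intro!: derivative_eq_intros)
  from has_derivative_compose[OF this grad_has_derivative[OF assms]]
  have "((\<lambda>x. f (s *\<^sub>R (x - a))) has_derivative (\<lambda>h. grad f (s *\<^sub>R (x - a)) \<bullet> (s *\<^sub>R h))) (at x)" .
  from has_derivative_mult_right[OF this, of c] show ?thesis by (simp add: mult_ac)
qed

lemma has_derivative_zero_quadratic:
  fixes g :: "'a::real_normed_vector \<Rightarrow> 'b::real_normed_vector"
  assumes "g x = 0" "\<And>y. norm (g y) \<le> C * (norm (y - x))\<^sup>2"
  shows "(g has_derivative (\<lambda>_. 0)) (at x)"
proof -
  have "((\<lambda>h. norm (g (x + h)) / norm h) \<longlongrightarrow> 0) (at 0)"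
  proof (rule Lim_null_comparison)
    show "\<forall>\<^sub>F h in at 0. norm (norm (g (x + h)) / norm h) \<le> C * norm h"
      unfolding eventually_at
    proof (intro exI[of _ 1] conjI ballI impI)
      fix h :: 'a assume "h \<noteq> 0 \<and> dist h 0 < 1"
      then show "norm (norm (g (x + h)) / norm h) \<le> C * norm h"
        using assms(2)[of "x + h"] by (simp add: field_simps power2_eq_square)
    qed simp
    show "((\<lambda>h :: 'a. C * norm h) \<longlongrightarrow> 0) (at 0)" by (auto intro!: tendsto_eq_intros)
  qed
  then show ?thesis by (simp add: has_derivative_at assms(1))
qed

context planted_singularities
begin

text \<open>The cube of the radius makes the copies third-order small at \<open>K\<close>. The
  Hessian is then of size \<open>rad a / M\<close>, while that of \<open>P\<close> varies over the
  ball by the order of \<open>rad a\<close>: their ratio is governed by \<open>M\<close>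
  alone.\<close>

definition bump :: "real^5 \<Rightarrow> real^5 \<Rightarrow> real" where
  "bump a x = (rad a ^ 3 / M) * model ((1 / rad a) *\<^sub>R (x - a))"

definition bump_grad :: "real^5 \<Rightarrow> real^5 \<Rightarrow> real^5" where
  "bump_grad a x = ((rad a)\<^sup>2 / M) *\<^sub>R grad model ((1 / rad a) *\<^sub>R (x - a))"

definition bump_hess :: "real^5 \<Rightarrow> real^5 \<Rightarrow> real^5^5" where
  "bump_hess a x = (rad a / M) *\<^sub>R model_hessian ((1 / rad a) *\<^sub>R (x - a))"

definition sol :: "real^5 \<Rightarrow> real" where
  "sol x = cartan_cubic x + patch bump x"

text \<open>Total by design: at a centre \<open>model_hessian 0 = 0\<close> turns it into the
  Hessian of \<open>P\<close>, so its range is the whole family on which the operator must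
  vanish.\<close>

definition sol_hess :: "real^5 \<Rightarrow> real^5^5" where
  "sol_hess x = hessian cartan_cubic x + patch bump_hess x"

lemma norm_rescaled: "a \<in> A \<Longrightarrow> norm ((1 / rad a) *\<^sub>R (x - a)) = dist a x / rad a"
  using rad_pos[of a] by (simp add: dist_norm norm_minus_commute)

lemma rescaled_far: "a \<in> A \<Longrightarrow> 3/4 * rad a < dist a x \<Longrightarrow> 3/4 < norm ((1 / rad a) *\<^sub>R (x - a))"
  by (subst norm_rescaled) (use rad_pos[of a] in \<open>auto simp: field_simps\<close>)

lemma bump_far:
  assumes "a \<in> A" "3/4 * rad a < dist a x"
  shows "bump a x = 0" "bump_grad a x = 0" "bump_hess a x = 0"
  using model_zero[OF rescaled_far[OF assms]] model_far_derivatives[OF rescaled_far[OF assms]]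
  by (simp_all add: bump_def bump_grad_def bump_hess_def)

lemma bump_far':
  assumes "a \<in> A" "rad a \<le> dist a x"
  shows "bump a x = 0" "bump_grad a x = 0" "bump_hess a x = 0"
  using bump_far[OF assms(1)] rad_pos[OF assms(1)] assms(2) by force+

lemma bump_has_derivative: "a \<in> A \<Longrightarrow> (bump a has_derivative (\<lambda>h. bump_grad a x \<bullet> h)) (at x)"
  using grad_affine[OF model_differentiable, of "rad a ^ 3 / M" "1 / rad a" a x] rad_pos[of a]
  by (simp add: bump_def[abs_def] bump_grad_def power2_eq_square power3_eq_cube)

lemma bump_grad_has_derivative:
  assumes "a \<in> A" "x \<noteq> a"
  shows "(bump_grad a has_derivative (\<lambda>v. bump_hess a x *v v)) (at x)"
proof -
  let ?y = "(1 / rad a) *\<^sub>R (x - a)"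
  have "((\<lambda>x. (1 / rad a) *\<^sub>R (x - a)) has_derivative (\<lambda>h. (1 / rad a) *\<^sub>R h)) (at x)"
    by (auto intro!: derivative_eq_intros)
  moreover have "?y \<noteq> 0" using assms rad_pos[of a] by simp
  ultimately have "((\<lambda>x. grad model ((1 / rad a) *\<^sub>R (x - a))) has_derivative (\<lambda>h. model_hessian ?y *v ((1 / rad a) *\<^sub>R h))) (at x)"
    using has_derivative_compose model_hessian_derivative by blast
  from has_derivative_scaleR_right[OF this, of "(rad a)\<^sup>2 / M"]
  show ?thesis using rad_pos[OF assms(1)]
    by (simp add: bump_grad_def[abs_def] bump_hess_def matrix_vector_mult_scaleR scaleR_matrix_vector_assoc power2_eq_square)
qed

lemma Ck_on_bump: "a \<in> A \<Longrightarrow> Ck_on k (- {a}) (bump a)"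
  unfolding bump_def[abs_def] using rad_pos[of a]
  by (intro Ck_on_mult Ck_on_const Ck_on_affine[OF _ _ Ck_on_model]) (auto simp: open_Compl)

lemma bump_odd: "bump a (a - h) = - bump a (a + h)"
  using model_minus[of "(1 / rad a) *\<^sub>R h"] by (simp add: bump_def)

lemma sol_in:
  assumes "a \<in> A" "dist a x < rad a"
  shows "sol x = cartan_cubic x + bump a x"
  by (simp add: sol_def patch_in[OF assms])

lemma sol_clear:
  assumes "\<And>a. a \<in> A \<Longrightarrow> 3/4 * rad a < dist a x"
  shows "sol x = cartan_cubic x" "patch bump x = 0" "patch bump_grad x = 0" "patch bump_hess x = 0"
proof -
  have "patch f x = 0" if "\<And>a. a \<in> A \<Longrightarrow> f a x = 0" for f :: "real^5 \<Rightarrow> real^5 \<Rightarrow> 'b::real_normed_vector"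
    unfolding patch_def by (rule sum.neutral) (use that in auto)
  note this[of bump] this[of bump_grad] this[of bump_hess]
  then show "patch bump x = 0" "patch bump_grad x = 0" "patch bump_hess x = 0" using bump_far assms by blast+
  then show "sol x = cartan_cubic x" by (simp add: sol_def)
qed

text \<open>A point in the ball of \<open>a\<close> is at distance at least \<open>rad a\<close>
  from \<open>K\<close>, so powers of the radius become powers of the distance to
  \<open>k\<close>.\<close>

lemma patch_power_bound:
  fixes f :: "real^5 \<Rightarrow> real^5 \<Rightarrow> 'b::real_normed_vector"
  assumes "0 \<le> C" "\<And>a y. a \<in> A \<Longrightarrow> norm (f a y) \<le> C * rad a ^ n" "k \<in> K"
  shows "norm (patch f y) \<le> C * norm (y - k) ^ n"
proof (cases "\<exists>a\<in>A. dist a y < rad a")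
  case True
  then obtain a where a: "a \<in> A" "dist a y < rad a" by blast
  have "norm (patch f y) \<le> C * rad a ^ n" using assms(2)[OF a(1)] by (simp add: patch_in[OF a])
  also have "\<dots> \<le> C * norm (y - k) ^ n"
    using rad_dist_K[OF a(2) assms(3)] rad_pos[OF a(1)] assms(1) by (intro mult_left_mono power_mono) (auto simp: dist_norm)
  finally show ?thesis .
next
  case False
  then have "patch f y = 0" by (auto intro!: patch_out simp: not_less)
  then show ?thesis using assms(1) by simp
qed

text \<open>The weaker quadratic bound, from \<open>rad a \<le> 1\<close>, has the form needed for
  differentiating at points of \<open>K\<close>; the cubic one serves the third-order
  expansion.\<close>

lemma bump_bounds:
  obtains C where "0 \<le> C" "\<And>a y. a \<in> A \<Longrightarrow> norm (bump a y) \<le> C * rad a ^ 3"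
    "\<And>a y. a \<in> A \<Longrightarrow> norm (bump a y) \<le> C * (rad a)\<^sup>2" "\<And>a y. a \<in> A \<Longrightarrow> norm (bump_grad a y) \<le> C * (rad a)\<^sup>2"
proof -
  obtain C where C: "0 < C" "\<And>x. \<bar>model x\<bar> \<le> C" "\<And>x. norm (grad model x) \<le> C" by (rule model_bounds) blast
  have 1: "norm (bump a y) \<le> C / M * rad a ^ 3" if "a \<in> A" for a y
    using mult_left_mono[OF C(2), of "rad a ^ 3 / M" "(1 / rad a) *\<^sub>R (y - a)"] rad_pos[OF that] M_pos
    by (simp add: bump_def abs_mult mult.commute)
  have 2: "norm (bump a y) \<le> C / M * (rad a)\<^sup>2" if "a \<in> A" for a y
  proof -
    have "rad a ^ 3 \<le> (rad a)\<^sup>2" using rad_pos[OF that] rad_le_1[OF that] by (intro power_decreasing) auto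
    then have "C / M * rad a ^ 3 \<le> C / M * (rad a)\<^sup>2" using C(1) M_pos by (intro mult_left_mono) auto
    then show ?thesis using 1[OF that, of y] by linarith
  qed
  have 3: "norm (bump_grad a y) \<le> C / M * (rad a)\<^sup>2" if "a \<in> A" for a y
    using mult_left_mono[OF C(3), of "(rad a)\<^sup>2 / M" "(1 / rad a) *\<^sub>R (y - a)"] rad_pos[OF that] M_pos
    by (simp add: bump_grad_def mult.commute)
  have "0 \<le> C / M" using C(1) M_pos by simp
  then show ?thesis using that 1 2 3 by blast
qed

lemma clear_cases [consumes 1, case_names K A clear]:
  assumes "x \<in> ball 0 1"
  obtains "x \<in> K"
  | a where "a \<in> A" "dist a x < rad a"
  | U where "open U" "x \<in> U" "U \<subseteq> ball 0 1 - (K \<union> A)" "\<forall>a\<in>A. \<forall>y\<in>U. 3/4 * rad a < dist a y"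
proof -
  consider "x \<in> K" | "\<exists>a\<in>A. dist a x < rad a" | "x \<notin> K" "\<And>a. a \<in> A \<Longrightarrow> rad a \<le> dist a x" by (meson not_le)
  then show ?thesis
  proof cases
    case 3
    obtain U where U: "open U" "x \<in> U" "U \<subseteq> ball 0 1 - K" "\<forall>a\<in>A. \<forall>y\<in>U. 3/4 * rad a < dist a y"
      by (rule clear_neighbourhood[OF assms 3]) blast
    have "y \<notin> A" if "y \<in> U" for y using U(4) rad_pos[of y] that by force
    then show ?thesis using that(3)[of U] U by blast
  qed (use that in blast)+
qed

section \<open>Derivatives and singular set of the solution\<close>

lemma sol_has_derivative:
  assumes "x \<in> ball 0 1"
  shows "(sol has_derivative (\<lambda>h. (cubic_grad x + patch bump_grad x) \<bullet> h)) (at x)"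
  using assms
proof (cases rule: clear_cases)
  case K
  obtain C where C: "0 \<le> C" "\<And>a y. a \<in> A \<Longrightarrow> norm (bump a y) \<le> C * (rad a)\<^sup>2" by (rule bump_bounds) blast
  have "(patch bump has_derivative (\<lambda>_. 0)) (at x)"
    by (rule has_derivative_zero_quadratic[OF patch_K[OF K] patch_power_bound[where f = bump, OF C K]])
  from has_derivative_add[OF cubic_has_derivative this]
  show ?thesis by (simp add: sol_def[abs_def] patch_K[OF K])
next
  case (A a)
  have o: "open (ball a (rad a))" "x \<in> ball a (rad a)" using A by auto
  have "((\<lambda>x. cartan_cubic x + bump a x) has_derivative (\<lambda>h. (cubic_grad x + bump_grad a x) \<bullet> h)) (at x)"
    unfolding inner_add_left by (intro has_derivative_add cubic_has_derivative bump_has_derivative A)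
  from has_derivative_transform_within_open[OF this o]
  show ?thesis using A by (simp add: sol_in patch_in)
next
  case (clear U)
  from has_derivative_transform_within_open[OF cubic_has_derivative clear(1,2)]
  show ?thesis using clear by (simp add: sol_clear)
qed

lemma grad_sol: "x \<in> ball 0 1 \<Longrightarrow> grad sol x = cubic_grad x + patch bump_grad x"
  by (rule grad_eqI[OF sol_has_derivative])

lemma sol_differentiable: "x \<in> ball 0 1 \<Longrightarrow> sol differentiable (at x)"
  using sol_has_derivative differentiable_def by blast

lemma eventually_sol_differentiable: "x \<in> ball 0 1 \<Longrightarrow> \<forall>\<^sub>F y in nhds x. sol differentiable (at y)"
  unfolding eventually_nhds using sol_differentiable by (intro exI[of _ "ball 0 1"]) auto

lemma sol_twice_differentiable:
  assumes "x \<in> ball 0 1" "x \<notin> A"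
  shows "twice_differentiable_at sol x" "hessian sol x = sol_hess x"
proof -
  have "(grad sol has_derivative (\<lambda>v. sol_hess x *v v)) (at x)"
    using assms(1)
  proof (cases rule: clear_cases)
    case K
    obtain C where C: "0 \<le> C" "\<And>a y. a \<in> A \<Longrightarrow> norm (bump_grad a y) \<le> C * (rad a)\<^sup>2" by (rule bump_bounds) blast
    have "(patch bump_grad has_derivative (\<lambda>_. 0)) (at x)"
      by (rule has_derivative_zero_quadratic[OF patch_K[OF K] patch_power_bound[where f = bump_grad, OF C K]])
    from has_derivative_add[OF cubic_grad_has_derivative this]
    have "((\<lambda>x. cubic_grad x + patch bump_grad x) has_derivative (\<lambda>v. sol_hess x *v v)) (at x)"
      by (simp add: sol_hess_def patch_K[OF K] hessian_cubic)
    then show ?thesis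
      by (rule has_derivative_transform_within_open[OF _ open_ball assms(1)]) (simp add: grad_sol)
  next
    case (A a)
    have o: "open (ball a (rad a))" "x \<in> ball a (rad a)" using A by auto
    have "((\<lambda>x. cubic_grad x + bump_grad a x) has_derivative (\<lambda>v. sol_hess x *v v)) (at x)"
      using has_derivative_add[OF cubic_grad_has_derivative bump_grad_has_derivative[OF A(1)], of x] assms(2) A
      by (auto simp: sol_hess_def patch_in matrix_vector_mult_add_rdistrib hessian_cubic)
    then show ?thesis
      by (rule has_derivative_transform_within_open[OF _ o]) (use A rad_in_ball in \<open>auto simp: grad_sol patch_in\<close>)
  next
    case (clear U)
    have "(grad sol has_derivative cubic_hess x) (at x)"
      by (rule has_derivative_transform_within_open[OF cubic_grad_has_derivative clear(1,2)])
        (use clear in \<open>auto simp: grad_sol sol_clear subset_iff\<close>)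
    then show ?thesis using sol_clear(4)[of x] clear by (simp add: sol_hess_def hessian_cubic)
  qed
  then show "twice_differentiable_at sol x" "hessian sol x = sol_hess x"
    using twice_differentiableI eventually_sol_differentiable[OF assms(1)] by blast+
qed

text \<open>Subtracting the gradient of \<open>P\<close> and rescaling the ball of \<open>a\<close>
  to the unit ball recovers \<open>grad model\<close>, which is not differentiable at the
  origin.\<close>

lemma sol_not_twice_differentiable:
  assumes "a \<in> A"
  shows "\<not> grad sol differentiable (at a)"
proof
  assume "grad sol differentiable (at a)"
  then obtain D where D: "(grad sol has_derivative D) (at a)" by (auto simp: differentiable_def)
  have a1: "a \<in> ball 0 1" using assms A_subset by auto
  let ?r = "rad a"
  have r: "0 < ?r" by (rule rad_pos[OF assms])
  have "((\<lambda>y. grad sol y - cubic_grad y) has_derivative (\<lambda>h. D h - cubic_hess a h)) (at a)"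
    by (rule has_derivative_diff[OF D cubic_grad_has_derivative])
  then have "((\<lambda>y. (M / ?r\<^sup>2) *\<^sub>R (grad sol y - cubic_grad y)) has_derivative (\<lambda>h. (M / ?r\<^sup>2) *\<^sub>R (D h - cubic_hess a h))) (at (a + ?r *\<^sub>R 0))"
    by (intro has_derivative_scaleR_right) simp
  moreover have "((\<lambda>y. a + ?r *\<^sub>R y) has_derivative (\<lambda>h. ?r *\<^sub>R h)) (at 0)" by (auto intro!: derivative_eq_intros)
  ultimately have T: "((\<lambda>y. (M / ?r\<^sup>2) *\<^sub>R (grad sol (a + ?r *\<^sub>R y) - cubic_grad (a + ?r *\<^sub>R y)))
    has_derivative (\<lambda>h. (M / ?r\<^sup>2) *\<^sub>R (D (?r *\<^sub>R h) - cubic_hess a (?r *\<^sub>R h)))) (at 0)"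
    using has_derivative_compose by blast
  have "(M / ?r\<^sup>2) *\<^sub>R (grad sol (a + ?r *\<^sub>R y) - cubic_grad (a + ?r *\<^sub>R y)) = grad model y" if "y \<in> ball 0 1" for y
  proof -
    have d: "dist a (a + ?r *\<^sub>R y) < ?r" using that r by (simp add: dist_norm)
    show ?thesis
      using r M_pos rad_in_ball[OF assms d] by (simp add: grad_sol patch_in[OF assms d] bump_grad_def)
  qed
  then have "(grad model has_derivative (\<lambda>h. (M / ?r\<^sup>2) *\<^sub>R (D (?r *\<^sub>R h) - cubic_hess a (?r *\<^sub>R h)))) (at 0)"
    by (intro has_derivative_transform_within_open[OF T open_ball[of 0 1]]) auto
  then show False using model_grad_not_differentiable_0 by (auto simp: differentiable_def)
qed

lemma sol_smooth_near:
  assumes "x \<in> ball 0 1" "x \<notin> K \<union> A"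
  obtains U where "open U" "x \<in> U" "U \<subseteq> ball 0 1" "\<And>k. Ck_on k U sol"
  using assms(1)
proof (cases rule: clear_cases)
  case K then show ?thesis using assms(2) by simp
next
  case (A a)
  let ?U = "ball a (rad a) - {a}"
  have o: "open ?U" by (rule open_delete) simp
  have "Ck_on k ?U sol" for k
  proof -
    have "Ck_on k ?U (\<lambda>x. cartan_cubic x + bump a x)"
      by (intro Ck_on_add Ck_on_cubic o Ck_on_subset[OF Ck_on_bump[OF A(1)]]) auto
    then show ?thesis by (subst Ck_on_cong[OF o]) (auto simp: sol_in[OF A(1)])
  qed
  moreover have "x \<in> ?U" using A assms(2) by auto
  moreover have "?U \<subseteq> ball 0 1" using rad_in_ball[OF A(1)] by auto
  ultimately show ?thesis using that o by blast
next
  case (clear U)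
  have "Ck_on k U sol" for k
    using Ck_on_cubic[OF clear(1)] clear(4)
    by (subst Ck_on_cong[OF clear(1), where g = cartan_cubic]) (auto simp: sol_clear)
  then show ?thesis using that clear by blast
qed

text \<open>Points of \<open>K\<close> are singular only through accumulation: the solution is twice
  differentiable there, but every neighbourhood contains a centre.\<close>

lemma Sing_sol: "Sing sol = K \<union> A"
proof (intro equalityI subsetI)
  fix x assume "x \<in> Sing sol"
  then have x: "x \<in> ball 0 1" "\<nexists>U. open U \<and> x \<in> U \<and> U \<subseteq> ball 0 1 \<and> Ck_on 2 U sol" by (auto simp: Sing_def)
  show "x \<in> K \<union> A"
  proof (rule ccontr)
    assume "x \<notin> K \<union> A"
    then show False using sol_smooth_near[OF x(1)] x(2) by metis
  qed
next
  fix x assume x: "x \<in> K \<union> A"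
  have "\<not> Ck_on 2 U sol" if U: "open U" "x \<in> U" for U
  proof
    assume C2: "Ck_on 2 U sol"
    obtain a where a: "a \<in> A" "a \<in> U"
      using x
    proof
      assume "x \<in> K"
      then have "x islimpt A" using A_limpt by auto
      then show ?thesis using that U by (meson islimptE)
    qed (use that U in blast)
    have "grad sol differentiable (at a)"
      using Ck_2_imp_grad_differentiable[of 0 U sol a] C2 a by (simp add: numeral_2_eq_2)
    then show False using sol_not_twice_differentiable[OF a(1)] by blast
  qed
  then show "x \<in> Sing sol" using x K_ball A_subset by (auto simp: Sing_def)
qed

lemma smooth_sol: "smooth_on (ball 0 1 - Sing sol) sol"
  unfolding smooth_on_def Sing_sol
proof (intro allI Ck_on_local)
  fix k x assume "x \<in> ball 0 1 - (K \<union> A)"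
  then show "\<exists>V. open V \<and> x \<in> V \<and> Ck_on k V sol" using sol_smooth_near[of x] by (metis DiffE)
qed

lemma C11_sol: "C11_on (ball 0 1) sol"
proof -
  obtain L where L: "0 < L" "\<And>x y. norm (grad model x - grad model y) \<le> L * norm (x - y)"
    by (rule model_grad_lipschitz) blast
  obtain C where C: "0 < C" "\<And>x v. norm (cubic_hess x v) \<le> C * norm x * norm v" by (rule cubic_hess_bound) blast
  have b: "norm (bump_grad a x - bump_grad a y) \<le> L / M * norm (x - y)" if a: "a \<in> A" for a x y
  proof -
    have "norm (bump_grad a x - bump_grad a y) = (rad a)\<^sup>2 / M * norm (grad model ((1 / rad a) *\<^sub>R (x - a)) - grad model ((1 / rad a) *\<^sub>R (y - a)))"
      using M_pos by (simp add: bump_grad_def flip: scaleR_diff_right)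
    also have "\<dots> \<le> (rad a)\<^sup>2 / M * (L * norm ((1 / rad a) *\<^sub>R (x - a) - (1 / rad a) *\<^sub>R (y - a)))"
      using M_pos by (intro mult_left_mono L(2)) auto
    also have "\<dots> = rad a * (L / M * norm (x - y))"
      using rad_pos[OF a] by (simp add: power2_eq_square flip: scaleR_diff_right)
    also have "\<dots> \<le> 1 * (L / M * norm (x - y))"
      using rad_le_1[OF a] L(1) M_pos by (intro mult_right_mono) auto
    finally show ?thesis by simp
  qed
  have p: "norm (patch bump_grad x - patch bump_grad y) \<le> 2 * (L / M * norm (x - y))" for x y
    by (rule patch_diff) (use bump_far'(2) b L(1) M_pos in auto)
  have c: "norm (cubic_grad x - cubic_grad y) \<le> C * norm (x - y)" if "x \<in> ball 0 1" "y \<in> ball 0 1" for x y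
  proof -
    have "cubic_hess x x - cubic_hess y y = cubic_hess (x - y) (x + y)"
      using cubic_hess_sym[of x y] by (simp add: cubic_hess_simps)
    then have "norm (cubic_grad x - cubic_grad y) = norm (cubic_hess (x - y) (x + y)) / 2"
      by (simp add: cubic_grad_def flip: scaleR_diff_right)
    also have "\<dots> \<le> C * norm (x - y) * norm (x + y) / 2" using C(2)[of "x - y" "x + y"] by simp
    also have "\<dots> \<le> C * norm (x - y) * 2 / 2"
      using norm_triangle_ineq[of x y] that C(1) by (intro divide_right_mono mult_left_mono) auto
    finally show ?thesis by simp
  qed
  have lip: "(C + 2 * L / M)-lipschitz_on (ball 0 1) (grad sol)"
  proof (rule lipschitz_onI)
    fix x y :: "real^5" assume xy: "x \<in> ball 0 1" "y \<in> ball 0 1"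
    have "grad sol x - grad sol y = (cubic_grad x - cubic_grad y) + (patch bump_grad x - patch bump_grad y)"
      using xy by (simp add: grad_sol)
    also have "norm \<dots> \<le> C * norm (x - y) + 2 * (L / M * norm (x - y))"
      using norm_triangle_ineq c[OF xy] p[of x y] by (meson add_mono order_trans)
    finally show "dist (grad sol x) (grad sol y) \<le> (C + 2 * L / M) * dist x y"
      by (simp add: dist_norm algebra_simps)
  qed (use C L M_pos in simp)
  then have "continuous_on (ball 0 1) (grad sol)" by (rule lipschitz_on_continuous_on)
  then have "continuous_on (ball 0 1) (\<lambda>x. grad sol x $ i)" for i by (intro continuous_intros)
  then show ?thesis using lip sol_differentiable by (auto simp: C11_on_def)
qed

text \<open>The remainder is \<open>P(h)\<close> plus at most one copy, each bounded by a multiple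
  of \<open>|h|^3\<close> with a constant common to all points of \<open>K\<close>.\<close>

lemma sol_remainder:
  "\<exists>C r. 0 < C \<and> 0 < r \<and> (\<forall>x\<in>K. \<forall>h. norm h < r \<longrightarrow>
    \<bar>sol (x + h) - (cartan_cubic x + grad cartan_cubic x \<bullet> h + 1/2 * (h \<bullet> (hessian cartan_cubic x *v h)))\<bar>
      \<le> C * norm h ^ 3)"
proof -
  obtain C where C: "0 \<le> C" "\<And>a y. a \<in> A \<Longrightarrow> norm (bump a y) \<le> C * rad a ^ 3" by (rule bump_bounds) blast
  obtain D where D: "0 < D" "\<And>x. \<bar>cartan_cubic x\<bar> \<le> D * norm x ^ 3" by (rule cubic_bound) blast
  have "\<bar>sol (x + h) - (cartan_cubic x + grad cartan_cubic x \<bullet> h + 1/2 * (h \<bullet> (hessian cartan_cubic x *v h)))\<bar>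
    \<le> (D + C) * norm h ^ 3" if "x \<in> K" for x h
  proof -
    have "\<bar>patch bump (x + h)\<bar> \<le> C * norm h ^ 3"
      using patch_power_bound[where f = bump and y = "x + h", OF C that] by simp
    then show ?thesis
      using D(2)[of h] by (simp add: sol_def cubic_add grad_cubic hessian_cubic inner_commute distrib_right)
  qed
  then show ?thesis using C(1) D(1) by (intro exI[of _ "D + C"] exI[of _ 1]) auto
qed

text \<open>At a centre the copy is odd and cancels, so \<open>P\<close> can serve as
  \<open>s\<close>; elsewhere the solution serves itself.\<close>

lemma sol_second_difference:
  assumes "x \<in> ball 0 1"
  obtains s where "twice_differentiable_at s x" "hessian s x = sol_hess x"
    "\<forall>\<^sub>F h in nhds 0. sol (x + h) + sol (x - h) - 2 * sol x = s (x + h) + s (x - h) - 2 * s x"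
proof (cases "x \<in> A")
  case False
  show ?thesis by (rule that[OF sol_twice_differentiable[OF assms False]]) simp
next
  case True
  have "\<forall>\<^sub>F y in nhds x. cartan_cubic differentiable (at y)"
    by (rule always_eventually) (use cubic_has_derivative differentiable_def in blast)
  moreover have "(grad cartan_cubic has_derivative (\<lambda>v. hessian cartan_cubic x *v v)) (at x)"
    by (simp add: grad_cubic hessian_cubic cubic_grad_has_derivative)
  ultimately have "twice_differentiable_at cartan_cubic x" by (rule twice_differentiableI)
  moreover have "hessian cartan_cubic x = sol_hess x"
    using rad_pos[OF True] by (simp add: sol_hess_def patch_in[OF True] bump_hess_def model_hessian_def)
  moreover have "\<forall>\<^sub>F h in nhds 0. sol (x + h) + sol (x - h) - 2 * sol x
    = cartan_cubic (x + h) + cartan_cubic (x - h) - 2 * cartan_cubic x"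
    unfolding eventually_nhds_metric
  proof (intro exI[of _ "rad x"] conjI allI impI)
    fix h :: "real^5" assume "dist h 0 < rad x"
    then have "dist x (x + h) < rad x" "dist x (x - h) < rad x" "dist x x < rad x"
      using rad_pos[OF True] by (simp_all add: dist_norm)
    then show "sol (x + h) + sol (x - h) - 2 * sol x = cartan_cubic (x + h) + cartan_cubic (x - h) - 2 * cartan_cubic x"
      using bump_odd[of x h] bump_odd[of x 0] by (simp add: sol_in[OF True])
  qed (rule rad_pos[OF True])
  ultimately show ?thesis by (rule that)
qed

end

section \<open>Ellipticity and the viscosity property\<close>

text \<open>\<open>P\<close> is harmonic. In dimension five the Laplacian of \<open>P/|x|\<close>
  collects \<open>-2 p\<close> from that of \<open>1/|x|\<close> and, by Euler's relation,
  \<open>-6 p\<close> from the mixed term.\<close>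

lemma singular_form_trace: "(\<Sum>i\<in>UNIV. singular_form x (axis i 1)) = - 8 * cubic_ratio x"
proof (cases "x = 0")
  case False
  define r P where "r = norm x" and "P = cartan_cubic x"
  have r: "0 < r" using False by (simp add: r_def)
  have 1: "(\<Sum>i\<in>UNIV. cubic_hess x (axis i 1) \<bullet> axis i 1) = 0"
    unfolding sum_5 inner_axis by (simp add: cubic_hess_def axis_def)
  have 2: "(\<Sum>i\<in>UNIV. (x \<bullet> axis i 1) * (cubic_grad x \<bullet> axis i 1)) = 3 * P"
    using cubic_grad_inner_self[of x] unfolding sum_5 inner_5 by (simp add: P_def axis_def mult.commute)
  have 3: "(\<Sum>i\<in>UNIV. (x \<bullet> axis i 1)\<^sup>2) = r\<^sup>2"
    by (simp add: r_def inner_axis norm_5_sq sum_5)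
  have "(\<Sum>i\<in>UNIV. singular_form x (axis i 1)) = (1 + 1 / r) * (\<Sum>i\<in>UNIV. cubic_hess x (axis i 1) \<bullet> axis i 1)
     - 2 * (\<Sum>i\<in>UNIV. (x \<bullet> axis i 1) * (cubic_grad x \<bullet> axis i 1)) / r ^ 3
     + P * (3 * (\<Sum>i\<in>UNIV. (x \<bullet> axis i 1)\<^sup>2) / r ^ 5 - 5 / r ^ 3)"
    unfolding singular_form_def r_def[symmetric] P_def[symmetric]
    by (simp add: sum.distrib sum_subtractf sum_distrib_left sum_divide_distrib norm_axis_1 mult.assoc right_diff_distrib)
  also have "\<dots> = - 8 * (P / r ^ 3)"
    unfolding 1 2 3 using r by (simp add: field_simps eval_nat_numeral)
  finally show ?thesis by (simp add: cubic_ratio_def P_def r_def)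
qed (simp add: cubic_ratio_def singular_form_def cubic_hess_simps cartan_cubic_def)

lemma singular_form_0: "singular_form 0 v = 0" "cubic_ratio 0 = 0"
  by (simp_all add: cubic_ratio_def singular_form_def cubic_hess_simps cartan_cubic_def)

text \<open>The factor 400 times the gap \<open>1/50\<close> is the 8 of the trace, so the two
  contributions balance. When the trace is nonnegative, some axis direction has a nonnegative value
  and no gap is called for.\<close>

lemma singular_form_elliptic:
  obtains v where "norm v = 1"
    "0 \<le> (\<Sum>i\<in>UNIV. singular_form x (axis i 1) - singular_form y (axis i 1)) + 400 * (singular_form x v - singular_form y v)"
proof -
  have tr: "(\<Sum>i\<in>UNIV. singular_form x (axis i 1) - singular_form y (axis i 1)) = 8 * (cubic_ratio y - cubic_ratio x)"
    by (simp add: sum_subtractf singular_form_trace)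
  show ?thesis
  proof (cases "cubic_ratio y < cubic_ratio x")
    case True
    have "\<exists>v. norm v = 1 \<and> 1/50 * (cubic_ratio x - cubic_ratio y) \<le> singular_form x v - singular_form y v"
    proof -
      consider "x \<noteq> 0" "y \<noteq> 0" | "y = 0" | "x = 0" "y \<noteq> 0" by blast
      then show ?thesis
      proof cases
        case 1 then show ?thesis using singular_form_gap[OF 1 True] by blast
      next
        case 2
        then have "x \<noteq> 0" "0 < cubic_ratio x" using True singular_form_0 by auto
        then show ?thesis using singular_form_pos[of x] 2 by (auto simp: singular_form_0)
      next
        case 3
        then have "- y \<noteq> 0" "0 < cubic_ratio (- y)" using True singular_form_0 by (auto simp: cubic_ratio_minus)
        then obtain v where "norm v = 1" "1/50 * cubic_ratio (- y) \<le> singular_form (- y) v" by (rule singular_form_pos)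
        then show ?thesis using 3 by (auto simp: singular_form_0 cubic_ratio_minus singular_form_minus)
      qed
    qed
    then show ?thesis using that unfolding tr by force
  next
    case False
    have "\<exists>i. 0 \<le> singular_form x (axis i 1) - singular_form y (axis i 1)"
    proof (rule ccontr)
      assume "\<nexists>i. 0 \<le> singular_form x (axis i 1) - singular_form y (axis i 1)"
      then have "(\<Sum>i\<in>UNIV. singular_form x (axis i 1) - singular_form y (axis i 1)) < 0"
        using sum_strict_mono[of UNIV "\<lambda>i. singular_form x (axis i 1) - singular_form y (axis i 1)" "\<lambda>_. 0"]
        by (auto simp: not_le)
      then show False using tr False by simp
    qed
    then obtain i where "0 \<le> singular_form x (axis i 1) - singular_form y (axis i 1)" by blast
    then show ?thesis using that[of "axis i 1"] tr False by (simp add: norm_axis_1)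
  qed
qed

text \<open>If the form stayed below \<open>l\<close> on unit vectors, vanishing trace would bound
  the diagonal from below, and testing with \<open>e_1 + e_j\<close> and \<open>e_1 - e_j\<close>
  would bound the first row by \<open>5 * l\<close>.\<close>

lemma cubic_hess_pos:
  obtains v where "norm v = 1" "norm z / 10 \<le> cubic_hess z v \<bullet> v"
proof (rule ccontr)
  assume "\<not> thesis"
  define l where "l = norm z / 10"
  have neg: "cubic_hess z v \<bullet> v < l" if "norm v = 1" for v
    using that \<open>\<not> thesis\<close> \<open>\<And>v. norm v = 1 \<Longrightarrow> norm z / 10 \<le> cubic_hess z v \<bullet> v \<Longrightarrow> thesis\<close> by (force simp: l_def)
  have le: "cubic_hess z v \<bullet> v \<le> l * (norm v)\<^sup>2" for v
  proof (cases "v = 0")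
    case False
    have "cubic_hess z (v /\<^sub>R norm v) \<bullet> (v /\<^sub>R norm v) < l" using False by (intro neg) simp
    then show ?thesis using False by (simp add: cubic_hess_simps field_simps power2_eq_square)
  qed (simp add: cubic_hess_simps)
  define b where "b i j = cubic_hess z (axis i 1) \<bullet> axis j 1" for i j
  have bsym: "b i j = b j i" for i j unfolding b_def by (rule cubic_hess_trilinear_sym)
  have diag: "b i i \<le> l" for i using le[of "axis i 1"] by (simp add: b_def norm_axis_1)
  have tr: "b 1 1 + b 2 2 + b 3 3 + b 4 4 + b 5 5 = 0"
    unfolding b_def inner_axis by (simp add: cubic_hess_def axis_def)
  have off: "\<bar>b 1 j\<bar> \<le> 5 * l" for j
  proof (cases "j = 1")
    case True
    then show ?thesis using diag[of 1] diag[of 2] diag[of 3] diag[of 4] diag[of 5] tr by (simp add: abs_le_iff)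
  next
    case False
    have n: "(norm (axis 1 1 + s *\<^sub>R axis j 1 :: real^5))\<^sup>2 = 2" if "s\<^sup>2 = 1" for s
      using False that unfolding power2_norm_eq_inner
      by (simp add: inner_add_left inner_add_right inner_axis_axis power2_eq_square)
    have "cubic_hess z (axis 1 1 + s *\<^sub>R axis j 1) \<bullet> (axis 1 1 + s *\<^sub>R axis j 1) = b 1 1 + 2 * s * b 1 j + s\<^sup>2 * b j j" for s
      using bsym[of j 1] by (simp add: b_def cubic_hess_simps inner_add_left inner_add_right power2_eq_square algebra_simps)
    then have "b 1 1 + 2 * s * b 1 j + s\<^sup>2 * b j j \<le> l * 2" if "s\<^sup>2 = 1" for s
      using le[of "axis 1 1 + s *\<^sub>R axis j 1"] unfolding n[OF that] by simp
    from this[of 1] this[of "-1"]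
    have "b 1 1 + 2 * b 1 j + b j j \<le> 2 * l" "b 1 1 - 2 * b 1 j + b j j \<le> 2 * l" by simp_all
    moreover have "- (8 * l) \<le> b 1 1 + b j j"
      using exhaust_5[of j] False diag[of 1] diag[of 2] diag[of 3] diag[of 4] diag[of 5] tr by auto
    ultimately show ?thesis by (simp add: abs_le_iff)
  qed
  \<comment> \<open>The first row of the Hessian determines \<open>z\<close> up to fixed factors of
    absolute value at least 3. The resulting bound \<open>25/3 * l\<close> falls short of
    \<open>norm z = 10 * l\<close> unless \<open>z = 0\<close>.\<close>
  have "b 1 1 = 6 * z$1" "b 1 2 = - 6 * z$2" "b 1 3 = 3 * z$3" "b 1 4 = 3 * z$4" "b 1 5 = - 6 * z$5"
    unfolding b_def inner_axis by (simp_all add: cubic_hess_def axis_def)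
  then have comp: "\<bar>z$1\<bar> \<le> 5/3 * l" "\<bar>z$2\<bar> \<le> 5/3 * l" "\<bar>z$3\<bar> \<le> 5/3 * l" "\<bar>z$4\<bar> \<le> 5/3 * l" "\<bar>z$5\<bar> \<le> 5/3 * l"
    using off[of 1] off[of 2] off[of 3] off[of 4] off[of 5] by (simp_all add: abs_mult)
  have "norm z \<le> \<bar>z$1\<bar> + \<bar>z$2\<bar> + \<bar>z$3\<bar> + \<bar>z$4\<bar> + \<bar>z$5\<bar>"
    using norm_le_l1_cart[of z] by (simp add: sum_5)
  also have "\<dots> \<le> 25/3 * l" using comp by linarith
  finally have "norm z \<le> 0" by (simp add: l_def)
  then have "z = 0" by simp
  then show False using neg[of "axis 1 1"] by (simp add: l_def norm_axis_1 cubic_hess_simps)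
qed

text \<open>Degree zero allows zooming at a centre by \<open>M / rad a\<close> in place of
  \<open>1 / rad a\<close>, which gives the cubic and the singular term equal weight.\<close>

lemma model_hess_scale: "0 < c \<Longrightarrow> model_hess (c *\<^sub>R x) v = model_hess x v"
  by (cases "x = 0")
    (simp_all add: model_hess_def cubic_grad_def cubic_hess_simps cubic_scale field_simps eval_nat_numeral)

context planted_singularities
begin

lemma sol_hess_form_core:
  assumes "a \<in> A" "dist a x < rad a / 2"
  shows "v \<bullet> (sol_hess x *v v) = cubic_hess a v \<bullet> v + (rad a / M) * singular_form ((M / rad a) *\<^sub>R (x - a)) v"
proof -
  have r: "0 < rad a" by (rule rad_pos[OF assms(1)])
  have d: "dist a x < rad a" using assms(2) r by simp
  have n: "norm ((1 / rad a) *\<^sub>R (x - a)) < 1/2" unfolding norm_rescaled[OF assms(1)] using assms(2) r by (simp add: field_simps)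
  have s: "model_hess ((M / rad a) *\<^sub>R (x - a)) v = model_hess ((1 / rad a) *\<^sub>R (x - a)) v"
    using model_hess_scale[OF M_pos, of "(1 / rad a) *\<^sub>R (x - a)" v] by simp
  have c: "cubic_hess x v = cubic_hess a v + (rad a / M) *\<^sub>R cubic_hess ((M / rad a) *\<^sub>R (x - a)) v"
    using r M_pos by (simp add: cubic_hess_simps)
  have "sol_hess x *v v = cubic_hess x v + (rad a / M) *\<^sub>R model_hess ((1 / rad a) *\<^sub>R (x - a)) v"
    unfolding sol_hess_def patch_in[OF assms(1) d] bump_hess_def
    by (simp add: matrix_vector_mult_add_rdistrib hessian_cubic model_hessian_near_0[OF n] flip: scaleR_matrix_vector_assoc)
  also have "\<dots> = cubic_hess a v + (rad a / M) *\<^sub>R (cubic_hess ((M / rad a) *\<^sub>R (x - a)) v + model_hess ((M / rad a) *\<^sub>R (x - a)) v)"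
    unfolding s c by (simp add: scaleR_add_right)
  finally show ?thesis
    by (simp only: inner_add_right inner_commute[of v] inner_scaleR_left model_hess_form)
qed

lemma sol_hess_pair:
  assumes L: "\<And>x y i j. 1/2 \<le> norm x \<or> 1/2 \<le> norm y \<Longrightarrow> \<bar>model_hessian x $ i $ j - model_hessian y $ i $ j\<bar> \<le> L * norm (x - y)"
    and "0 < L" "600 * L \<le> M"
  shows "\<exists>v. norm v = 1 \<and> 0 \<le> trace (sol_hess x - sol_hess y) + 400 * (v \<bullet> ((sol_hess x - sol_hess y) *v v))"
proof (cases "\<exists>a\<in>A. dist a x < rad a / 2 \<and> dist a y < rad a / 2")
  case True
  then obtain a where a: "a \<in> A" "dist a x < rad a / 2" "dist a y < rad a / 2" by blast
  let ?x = "(M / rad a) *\<^sub>R (x - a)" and ?y = "(M / rad a) *\<^sub>R (y - a)"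
  have D: "v \<bullet> ((sol_hess x - sol_hess y) *v v) = (rad a / M) * (singular_form ?x v - singular_form ?y v)" for v
    by (simp add: matrix_vector_mult_diff_rdistrib inner_diff_right sol_hess_form_core[OF a(1,2)] sol_hess_form_core[OF a(1,3)]
      right_diff_distrib)
  obtain v where v: "norm v = 1"
    "0 \<le> (\<Sum>i\<in>UNIV. singular_form ?x (axis i 1) - singular_form ?y (axis i 1)) + 400 * (singular_form ?x v - singular_form ?y v)"
    by (rule singular_form_elliptic)
  have "trace (sol_hess x - sol_hess y) + 400 * (v \<bullet> ((sol_hess x - sol_hess y) *v v))
    = (rad a / M) * ((\<Sum>i\<in>UNIV. singular_form ?x (axis i 1) - singular_form ?y (axis i 1)) + 400 * (singular_form ?x v - singular_form ?y v))"
    unfolding trace_eq_sum_form D sum_distrib_left[symmetric] by (simp only: distrib_left mult.left_commute[of 400])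
  also have "0 \<le> \<dots>" using v(2) rad_pos[OF a(1)] M_pos by (intro mult_nonneg_nonneg) auto
  finally show ?thesis using v(1) by blast
next
  case False
  \<comment> \<open>Bounds every entry of the difference of the patched Hessians, since
    \<open>2 * L / M \<le> 1/300\<close>. The Hessian of \<open>P\<close> contributes at least
    \<open>30 * b\<close>, the patches at most \<open>25 * b\<close> to the form and
    \<open>5 * b\<close> to the trace, and \<open>400 * (30 - 25) > 5\<close>.\<close>
  define b where "b = norm (x - y) / 300"
  define E where "E = patch bump_hess x - patch bump_hess y"
  have E: "\<bar>E $ i $ j\<bar> \<le> b" for i j
  proof -
    have p: "patch (\<lambda>a z. bump_hess a z $ i $ j) z = patch bump_hess z $ i $ j" for z
      by (simp add: patch_def sum_component)
    have "norm (patch (\<lambda>a z. bump_hess a z $ i $ j) x - patch (\<lambda>a z. bump_hess a z $ i $ j) y) \<le> 2 * (L / M * norm (x - y))"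
    proof (rule patch_diff)
      fix a assume a: "a \<in> A"
      have r: "0 < rad a" by (rule rad_pos[OF a])
      \<comment> \<open>No centre has both points in its inner half ball, so after rescaling at
        least one of them has norm at least \<open>1/2\<close>, as the Lipschitz bound
        requires.\<close>
      have h: "1/2 \<le> norm ((1 / rad a) *\<^sub>R (x - a)) \<or> 1/2 \<le> norm ((1 / rad a) *\<^sub>R (y - a))"
        unfolding norm_rescaled[OF a] using False a r by (force simp: field_simps)
      have "norm (bump_hess a x $ i $ j - bump_hess a y $ i $ j)
        = rad a / M * \<bar>model_hessian ((1 / rad a) *\<^sub>R (x - a)) $ i $ j - model_hessian ((1 / rad a) *\<^sub>R (y - a)) $ i $ j\<bar>"
      proof -
        have "bump_hess a z $ i $ j = rad a / M * model_hessian ((1 / rad a) *\<^sub>R (z - a)) $ i $ j" for z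
          by (simp add: bump_hess_def)
        then show ?thesis using r M_pos by (simp only: right_diff_distrib[symmetric] real_norm_def abs_mult) simp
      qed
      also have "\<dots> \<le> rad a / M * (L * norm ((1 / rad a) *\<^sub>R (x - a) - (1 / rad a) *\<^sub>R (y - a)))"
        using r M_pos by (intro mult_left_mono L h) auto
      also have "\<dots> = L / M * norm (x - y)" using r by (simp flip: scaleR_diff_right)
      finally show "norm (bump_hess a x $ i $ j - bump_hess a y $ i $ j) \<le> L / M * norm (x - y)" .
    next
      show "0 \<le> L / M * norm (x - y)" using assms(2) M_pos by simp
    next
      fix a z assume "a \<in> A" "rad a \<le> dist a z"
      then show "bump_hess a z $ i $ j = 0" by (simp add: bump_far'(3))
    qed
    also have "2 * (L / M * norm (x - y)) \<le> b"
    proof -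
      have "2 * (L / M) \<le> 1 / 300" using assms(3) M_pos by (simp add: field_simps)
      from mult_right_mono[OF this norm_ge_zero[of "x - y"]] show ?thesis by (simp add: b_def)
    qed
    finally show ?thesis unfolding p by (simp add: E_def)
  qed
  obtain v where v: "norm v = 1" "norm (x - y) / 10 \<le> cubic_hess (x - y) v \<bullet> v" by (rule cubic_hess_pos)
  have vi: "\<bar>v$i\<bar> \<le> 1" for i using component_le_norm_cart[of v i] v(1) by simp
  have "\<bar>v \<bullet> (E *v v)\<bar> \<le> (\<Sum>i\<in>UNIV. \<Sum>j\<in>UNIV. \<bar>v$i * v$j * E$i$j\<bar>)"
    unfolding form_sum by (intro order.trans[OF sum_abs] sum_mono sum_abs)
  also have "\<dots> \<le> (\<Sum>i\<in>(UNIV :: 5 set). \<Sum>j\<in>(UNIV :: 5 set). b)"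
  proof (intro sum_mono)
    fix i j :: 5
    have "\<bar>v$i * v$j\<bar> * \<bar>E$i$j\<bar> \<le> 1 * b"
      using mult_mono[OF vi vi, of j i] E[of i j] by (intro mult_mono) (auto simp: abs_mult)
    then show "\<bar>v$i * v$j * E$i$j\<bar> \<le> b" by (simp add: abs_mult)
  qed
  also have "\<dots> = 25 * b" by simp
  finally have form: "- (25 * b) \<le> v \<bullet> (E *v v)" by linarith
  have "\<bar>trace E\<bar> \<le> (\<Sum>i\<in>UNIV. \<bar>E$i$i\<bar>)" unfolding trace_def by (rule sum_abs)
  also have "\<dots> \<le> (\<Sum>i\<in>(UNIV :: 5 set). b)" by (intro sum_mono E)
  finally have tr: "- (5 * b) \<le> trace E" by simp
  have "sol_hess x - sol_hess y = (hessian cartan_cubic x - hessian cartan_cubic y) + E"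
    by (simp add: sol_hess_def E_def)
  moreover have "w \<bullet> ((hessian cartan_cubic x - hessian cartan_cubic y) *v w) = cubic_hess (x - y) w \<bullet> w" for w
    by (simp add: matrix_vector_mult_diff_rdistrib hessian_cubic cubic_hess_simps inner_commute)
  moreover have "(\<Sum>i\<in>UNIV. cubic_hess (x - y) (axis i 1) \<bullet> axis i 1) = 0"
    unfolding sum_5 inner_axis by (simp add: cubic_hess_def axis_def algebra_simps)
  ultimately have "trace (sol_hess x - sol_hess y) = trace E"
    "v \<bullet> ((sol_hess x - sol_hess y) *v v) = cubic_hess (x - y) v \<bullet> v + v \<bullet> (E *v v)"
    by (simp_all add: trace_add trace_eq_sum_form[of "hessian cartan_cubic x - hessian cartan_cubic y"]
      matrix_vector_mult_add_rdistrib inner_add_right)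
  moreover have "0 \<le> b" "norm (x - y) = 300 * b" by (auto simp: b_def)
  ultimately have "0 \<le> trace (sol_hess x - sol_hess y) + 400 * (v \<bullet> ((sol_hess x - sol_hess y) *v v))"
    using form tr v(2) by simp
  then show ?thesis using v(1) by blast
qed

lemma isolated_sol:
  assumes "a \<in> A"
  shows "a isolated_in Sing sol"
  unfolding Sing_sol isolated_in_def
proof (intro conjI exI[of _ "ball a (rad a)"])
  show "ball a (rad a) \<inter> (K \<union> A) = {a}"
    using rad_isolates[OF assms] rad_pos[OF assms] assms by auto
qed (use assms in auto)

lemma sol_viscosity:
  assumes F0: "\<And>x. F (sol_hess x) = 0" and mono: "\<And>M N. (\<And>v. 0 \<le> v \<bullet> ((M - N) *v v)) \<Longrightarrow> F N \<le> F M"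
  shows "viscosity_solution F sol"
  unfolding viscosity_solution_def
proof (intro conjI ballI allI impI)
  show "continuous_on (ball 0 1) sol"
    by (intro continuous_at_imp_continuous_on ballI differentiable_imp_continuous_within sol_differentiable)
  fix x :: "real^5" and \<phi> assume x: "x \<in> ball 0 1" and \<phi>: "C2_near \<phi> x"
  obtain s where s: "twice_differentiable_at s x" "hessian s x = sol_hess x"
    "\<forall>\<^sub>F h in nhds 0. sol (x + h) + sol (x - h) - 2 * sol x = s (x + h) + s (x - h) - 2 * s x"
    by (rule sol_second_difference[OF x])
  show "0 \<le> F (hessian \<phi> x)" if "touches_above \<phi> sol x"
    using mono[of "hessian \<phi> x" "sol_hess x"] touching_hessian(1)[OF s(1,3) \<phi> that] F0 s(2) by simp
  show "F (hessian \<phi> x) \<le> 0" if "touches_below \<phi> sol x"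
    using mono[of "sol_hess x" "hessian \<phi> x"] touching_hessian(2)[OF s(1,3) \<phi> that] F0 s(2) by simp
qed

end

theorem theorem1p4:
  shows "\<exists>lam Lam :: real. 0 < lam \<and> lam \<le> Lam \<and>
    (\<forall>K :: (real^5) set.
      K \<noteq> {} \<and> compact K \<and> K \<subseteq> ball 0 1 \<and> interior (closure K) = {} \<longrightarrow>
      (\<exists>(A :: (real^5) set) (u :: real^5 \<Rightarrow> real) (F :: real^5^5 \<Rightarrow> real).
        countable A \<and> A \<subseteq> ball 0 1 - K \<and>
        C11_on (ball 0 1) u \<and>
        uniformly_elliptic lam Lam F \<and>
        Sing u = K \<union> A \<and>
        viscosity_solution F u \<and>
        {x. x islimpt A} = K \<and>
        (\<forall>a\<in>A. a isolated_in (Sing u)) \<and>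
        smooth_on (ball 0 1 - Sing u) u \<and>
        (\<forall>a\<in>A. \<not> twice_differentiable_at u a) \<and>
        (\<forall>x\<in>K. twice_differentiable_at u x \<and> hessian u x = hessian cartan_cubic x) \<and>
        (\<exists>C r. 0 < C \<and> 0 < r \<and>
          (\<forall>x\<in>K. \<forall>h. norm h < r \<longrightarrow>
            \<bar>u (x + h) - (cartan_cubic x + grad cartan_cubic x \<bullet> h
                + 1/2 * (h \<bullet> (hessian cartan_cubic x *v h)))\<bar> \<le> C * norm h ^ 3))))"
proof (rule exI[of _ 1], rule exI[of _ 2001], intro conjI allI impI)
  fix K :: "(real^5) set"
  assume K: "K \<noteq> {} \<and> compact K \<and> K \<subseteq> ball 0 1 \<and> interior (closure K) = {}"
  then have K': "compact K" "K \<noteq> {}" "interior K = {}" "K \<subseteq> ball 0 1" by (auto simp: closure_closed compact_imp_closed)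
  obtain A where A: "countable A" "A \<subseteq> ball 0 1 - K" "{x. x islimpt A} = K"
    "\<forall>d>0. finite {a\<in>A. d \<le> infdist a K}"
    by (rule accumulating_set_exists[OF K'(1-3) open_ball K'(4)])
  obtain L where L: "0 < L"
    "\<And>x y i j. 1/2 \<le> norm x \<or> 1/2 \<le> norm y \<Longrightarrow> \<bar>model_hessian x $ i $ j - model_hessian y $ i $ j\<bar> \<le> L * norm (x - y)"
    by (rule model_hessian_lipschitz) (rule that, assumption, blast)
  \<comment> \<open>\<open>L\<close> belongs to the model alone, so this choice of the parameter
    \<open>M\<close> is the same for every \<open>K\<close>.\<close>
  interpret planted_singularities K A "600 * L"
    by unfold_locales (use K A L(1) in auto)
  \<comment> \<open>Here \<open>1 + 400 * CARD(5)\<close> is the announced 2001. The operator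
    vanishes on the whole range of \<open>sol_hess\<close>, including the substitute values at the
    centres.\<close>
  obtain F :: "real^5^5 \<Rightarrow> real" where F: "uniformly_elliptic 1 (1 + 400 * CARD(5)) F" "\<And>B. B \<in> range sol_hess \<Longrightarrow> F B = 0"
    "\<And>M N :: real^5^5. (\<And>v. 0 \<le> v \<bullet> ((M - N) *v v)) \<Longrightarrow> F N \<le> F M"
    by (rule elliptic_operator_exists[of "range sol_hess" 400]) (use sol_hess_pair[OF L(2,1)] in auto)
  have "viscosity_solution F sol" by (rule sol_viscosity) (use F in blast)+
  moreover have "\<not> twice_differentiable_at sol a" if "a \<in> A" for a
    using sol_not_twice_differentiable[OF that] by (simp add: twice_differentiable_at_def)
  moreover have "twice_differentiable_at sol x \<and> hessian sol x = hessian cartan_cubic x" if "x \<in> K" for x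
  proof -
    have "x \<in> ball 0 1" "x \<notin> A" using that K A by auto
    then show ?thesis using sol_twice_differentiable by (simp add: sol_hess_def patch_K[OF that])
  qed
  ultimately show "\<exists>(A :: (real^5) set) (u :: real^5 \<Rightarrow> real) (F :: real^5^5 \<Rightarrow> real).
        countable A \<and> A \<subseteq> ball 0 1 - K \<and>
        C11_on (ball 0 1) u \<and>
        uniformly_elliptic 1 2001 F \<and>
        Sing u = K \<union> A \<and>
        viscosity_solution F u \<and>
        {x. x islimpt A} = K \<and>
        (\<forall>a\<in>A. a isolated_in (Sing u)) \<and>
        smooth_on (ball 0 1 - Sing u) u \<and>
        (\<forall>a\<in>A. \<not> twice_differentiable_at u a) \<and>
        (\<forall>x\<in>K. twice_differentiable_at u x \<and> hessian u x = hessian cartan_cubic x) \<and>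
        (\<exists>C r. 0 < C \<and> 0 < r \<and>
          (\<forall>x\<in>K. \<forall>h. norm h < r \<longrightarrow>
            \<bar>u (x + h) - (cartan_cubic x + grad cartan_cubic x \<bullet> h
                + 1/2 * (h \<bullet> (hessian cartan_cubic x *v h)))\<bar> \<le> C * norm h ^ 3))"
    using A F(1) C11_sol Sing_sol smooth_sol isolated_sol sol_remainder by (intro exI[of _ A] exI[of _ sol] exI[of _ F]) simp
qed simp_all

end
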